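(* The following are equivalent for $w\in\beta\mathbb Z\setminus\{0\}$. (1) The ultrafilter $w$ is self-divisible. (2) For all $B\in w$ there is $A\in w$ such that for all $a,a'\in A$ there is $b\in B$ with $b\mid\gcd(a,a')$. (3) For all $B\in w$ there are $A\in w$ and $b\in B$ such that $A\subseteq b\mathbb Z$. (4) For all $B\in w$ there is $b\in B$ such that $b\mathbb Z\in w$. (5) For all $B\in w$ we have $\{b\in B:b\mathbb Z\in w\}\in w$. (6) For all $k\in\mathbb Z\setminus\{0\}$, the ultrafilter $kw$ is self-divisible. (7) There are positive integers $n\neq m$ such that $w^{\oplus n}\equiv^{\mathrm s}_w w^{\oplus m}$. (8) For all $v\in\beta\mathbb Z\setminus\{0\}$, if $w\equiv_v0$ then $w\equiv^{\mathrm s}_v0$. (9) If $a\in{}^{*}\mathbb Z$ and $a\models w$, then $\{b\in{}^{*}\mathbb Z:b\mid a\}\subseteq{}^{*}D(w)$. (10) $Z_w$ is closed under $\oplus$ and, for all $u,t\in\beta\mathbb Z$ and $v\in\mathrm{MAX}$, if $u\oplus v\oplus t\in Z_w$ then $u\oplus t\in Z_w$. (11) $Z_w$ is closed under $\oplus$ and $Z_w=\pi^{-1}(\pi(Z_w))$. (12) $Z_w$ is closed under $\oplus$ and whether $w\mathrel{\tilde\mid}u$ depends only on the remainder classes of $u$ modulo standard integers $n$ (that is, if $u,u'\in\beta\mathbb Z$ have the same remainder modulo every $n\in\mathbb N$, then $w\mathrel{\tilde\mid}u$ iff $w\mathrel{\tilde\mid}u'$). (13) The kernel $\ker(\sigma_w)$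 is closed in $\hat{\mathbb Z}$. (14) $\beta\mathbb Z/{\equiv^{\mathrm s}_w}$ is a procyclic group with respect to the quotient topology. (15) $\beta\mathbb Z/{\equiv^{\mathrm s}_w}$ is a profinite group with respect to some topology. (16) $(\beta\mathbb Z,\oplus)/{\equiv^{\mathrm s}_w}\cong\prod_{p\in\mathbb P}G_p$, where $G_p=\mathbb Z_p$ if $\varphi_w(p)=\omega$, and $G_p=\mathbb Z/p^{\varphi_w(p)}\mathbb Z$ otherwise.
   Context: $\mathbb N=\{1,2,\dots\}$, $\omega=\mathbb N\cup\{0\}$, $\mathbb P$ is the set of primes, $\mathbb Z_p$ the additive group of $p$-adic integers. $\beta\mathbb Z$ is the space of ultrafilters on $\mathbb Z$; integers are identified with principal ultrafilters. For $u,v\in\beta\mathbb Z$: $A\in u\otimes v$ iff $\{x:\{y:(x,y)\in A\}\in v\}\in u$ (for $A\subseteq\mathbb Z^2$; similarly for more factors); $A\in u\oplus v$ iff $\{x:\{y:x+y\in A\}\in v\}\in u$; $-u=\{-A:A\in u\}$; $u\ominus v=u\oplus(-v)$; $w^{\oplus n}=w\oplus\cdots\oplus w$ ($n$ times); $kw$ is the image of $w$ under $x\mapsto kx$. Fix an elementary extension ${}^{*}\mathbb Z$ of $\mathbb Z$, in the language with a symbol for every subset of every $\mathbb Z^k$, that is $(2^{\aleph_0})^+$-saturated. For a tuple $a$ in ${}^{*}\mathbb Z$ and an ultrafilter $u$ on $\mathbb Z^k$, $a\models u$ means $u=\{A\subseteq\mathbb Z^k:a\in{}^{*}A\}$. -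 $u\mathrel{\tilde\mid}v$ iff there are $a\models u$, $b\models v$ with $a\mid b$; equivalently, every $A\in u$ that is upward closed under divisibility belongs to $v$. - For $w\neq0$: $u\equiv_w v$ iff there are $d\models w$ and $(a,b)\models u\otimes v$ with $d\mid a-b$; equivalently, $w\mathrel{\tilde\mid}u\ominus v$. - For $w\ne0$: $u\equiv^{\mathrm s}_w v$ iff there is (equivalently, for every) $(d,a,b)\models w\otimes u\otimes v$ one has $d\mid a-b$; equivalently, $\{n\in\mathbb Z:n\mathbb Z\in u\ominus v\}\in w$. It is known that $\equiv^{\mathrm s}_w$ is an equivalence relation compatible with $\oplus$. - $D(u)=\{n\in\mathbb Z:n\mathbb Z\in u\}$; $w\in\beta\mathbb Z\setminus\{0\}$ is self-divisible iff $D(w)\in w$. - $Z_w=\{u\in\beta\mathbb Z:w\mathrel{\tilde\mid}u\}$. - $\mathrm{MAX}$ is the set of $w\in\beta\mathbb Z$ such that $u\mathrel{\tilde\mid}w$ for all $u\in\beta\mathbb Z\setminus\{0\}$; equivalently, $n\mathbb Z\in w$ for every $n\in\mathbb N$. - $\hat{\mathbb Z}=\varprojlim\mathbb Z/n\mathbb Z$ is the profinite completion of $(\mathbb Z,+)$ with its usual topology; $\pi:\beta\mathbb Z\to\hat{\mathbb Z}$ sends $u$ to the sequence of its remainder classes, i.e. the $n$-th entry of $\pi(u)$ is the unique $r\in\mathbb Z/n\mathbb Z$ with $r+n\mathbb Z\in u$. - $\sigma_w:\hat{\mathbb Z}\to\beta\mathbb Z/{\equiv^{\mathrm s}_w}$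 is the (well-defined, surjective) homomorphism of groups sending $\pi(u)$ to the class $u/{\equiv^{\mathrm s}_w}$; in particular the quotient is a group. - $\varphi_w:\mathbb P\to\omega+1$ sends $p$ to $\max\{k\in\omega:p^k\mathbb Z\in w\}$ if this exists, and to $\omega$ otherwise. - A profinite group is a topological group whose underlying space is a Stone space; a procyclic group is a profinite group with a dense cyclic subgroup (equivalently, up to isomorphism, a quotient of $\hat{\mathbb Z}$ by a closed subgroup). In (16), $\cong$ is isomorphism of groups. *)

theory Defs
  imports
    "HOL-Analysis.Analysis"
    "HOL-Algebra.Product_Groups"
    "HOL-Algebra.Generated_Groups"
    "HOL-Computational_Algebra.Primes"
    "HOL-Library.Extended_Nat"
    "HOL-Library.Equipollence"
begin

section \<open>Ultrafilters on the integers\<close>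

definition ultrafilter :: "'a set set \<Rightarrow> bool" where
  "ultrafilter u \<longleftrightarrow>
     UNIV \<in> u \<and> {} \<notin> u \<and>
     (\<forall>A B. A \<in> u \<longrightarrow> A \<subseteq> B \<longrightarrow> B \<in> u) \<and>
     (\<forall>A B. A \<in> u \<longrightarrow> B \<in> u \<longrightarrow> A \<inter> B \<in> u) \<and>
     (\<forall>A. A \<in> u \<or> - A \<in> u)"

definition betaZ :: "int set set set" where
  "betaZ = {u. ultrafilter u}"

definition principal_uf :: "int \<Rightarrow> int set set" where
  "principal_uf n = {A. n \<in> A}"

definition betaZ_topology :: "int set set topology" where
  "betaZ_topology = topology_generated_by (range (\<lambda>A. {u \<in> betaZ. A \<in> u}))"

definition oplus :: "int set set \<Rightarrow> int set set \<Rightarrow> int set set" where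
  "oplus u v = {A. {x. {y. x + y \<in> A} \<in> v} \<in> u}"

text \<open>Only the values for positive exponents are used; the clause for \<open>0\<close> makes the first power \<open>w\<close>.\<close>
primrec oplus_pow :: "int set set \<Rightarrow> nat \<Rightarrow> int set set" where
  "oplus_pow w 0 = principal_uf 0"
| "oplus_pow w (Suc n) = oplus (oplus_pow w n) w"

definition scale_uf :: "int \<Rightarrow> int set set \<Rightarrow> int set set" where
  "scale_uf k w = {A. {x. k * x \<in> A} \<in> w}"

text \<open>A subset of \<open>\<int>\<^sup>k\<close> is represented by a set of integer lists of length \<open>k\<close>, and
  \<open>tensor [u\<^sub>1, \<dots>, u\<^sub>k]\<close> is the tensor product of \<open>u\<^sub>1, \<dots>, u\<^sub>k\<close>. It is an ultrafilter on the
  type of all integer lists which contains the set of lists of length \<open>k\<close>.\<close>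
primrec tensor :: "int set set list \<Rightarrow> int list set set" where
  "tensor [] = {A. [] \<in> A}"
| "tensor (u # us) = {A. {x. {xs. x # xs \<in> A} \<in> tensor us} \<in> u}"

lemma mem_tensor_1: "A \<in> tensor [u] \<longleftrightarrow> {x. [x] \<in> A} \<in> u"
  by simp

lemma mem_tensor_2: "A \<in> tensor [u, v] \<longleftrightarrow> {x. {y. [x, y] \<in> A} \<in> v} \<in> u"
  by simp


section \<open>Saturated elementary extensions of the integers\<close>

text \<open>First-order formulas with variables indexed by \<open>nat\<close>, over the language having, for every
  \<open>k\<close> and every \<open>A\<close>, a \<open>k\<close>-ary relation symbol for the set of lists of length \<open>k\<close> in \<open>A\<close>.
  \<open>Rel A is\<close> is an atomic formula with the symbol of arity \<open>length is\<close> belonging to \<open>A\<close>.\<close>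
datatype fm =
    Eq nat nat
  | Rel "int list set" "nat list"
  | Neg fm
  | Conj fm fm
  | Exi nat fm

primrec sat :: "(int list set \<Rightarrow> 'm list set) \<Rightarrow> (nat \<Rightarrow> 'm) \<Rightarrow> fm \<Rightarrow> bool" where
  "sat I e (Eq i j) \<longleftrightarrow> e i = e j"
| "sat I e (Rel A is) \<longleftrightarrow> map e is \<in> I A"
| "sat I e (Neg \<phi>) \<longleftrightarrow> \<not> sat I e \<phi>"
| "sat I e (Conj \<phi> \<psi>) \<longleftrightarrow> sat I e \<phi> \<and> sat I e \<psi>"
| "sat I e (Exi i \<phi>) \<longleftrightarrow> (\<exists>x. sat I (e(i := x)) \<phi>)"

text \<open>The structure on the integers interprets every symbol by itself, that is, by \<open>\<lambda>A. A\<close>.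
  The extension has universe \<open>'z\<close>, and \<open>star A\<close> is \<open>\<^sup>*A\<close>.\<close>
definition elementary_extension ::
    "(int \<Rightarrow> 'z) \<Rightarrow> (int list set \<Rightarrow> 'z list set) \<Rightarrow> bool" where
  "elementary_extension emb star \<longleftrightarrow>
     (\<forall>\<phi> e. sat (\<lambda>A. A) e \<phi> \<longleftrightarrow> sat star (emb \<circ> e) \<phi>)"

text \<open>\<open>(2\<^bsup>\<aleph>\<^sub>0\<^esup>)\<^sup>+\<close>-saturation: a finitely satisfiable set of formulas in one free variable (number \<open>0\<close>)
  with parameters from a set \<open>C\<close> of size at most \<open>2\<^bsup>\<aleph>\<^sub>0\<^esup>\<close> is satisfiable. A formula with parameters
  is a pair of a formula and an assignment of parameters to its variables.\<close>
definition continuum_plus_saturated :: "(int list set \<Rightarrow> 'z list set) \<Rightarrow> bool" where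
  "continuum_plus_saturated star \<longleftrightarrow>
     (\<forall>(C :: 'z set) (\<Gamma> :: (fm \<times> (nat \<Rightarrow> 'z)) set).
        C \<lesssim> (UNIV :: nat set set) \<longrightarrow>
        (\<forall>(\<phi>, e) \<in> \<Gamma>. range e \<subseteq> C) \<longrightarrow>
        (\<forall>F \<subseteq> \<Gamma>. finite F \<longrightarrow> (\<exists>x. \<forall>(\<phi>, e) \<in> F. sat star (e(0 := x)) \<phi>)) \<longrightarrow>
        (\<exists>x. \<forall>(\<phi>, e) \<in> \<Gamma>. sat star (e(0 := x)) \<phi>))"

definition star_set :: "(int list set \<Rightarrow> 'z list set) \<Rightarrow> int set \<Rightarrow> 'z set" where
  "star_set star A = {a. [a] \<in> star {[x] | x. x \<in> A}}"

definition star_dvd :: "(int list set \<Rightarrow> 'z list set) \<Rightarrow> 'z \<Rightarrow> 'z \<Rightarrow> bool" where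
  "star_dvd star a b \<longleftrightarrow> [a, b] \<in> star {[x, y] | x y. x dvd y}"

definition star_diff :: "(int list set \<Rightarrow> 'z list set) \<Rightarrow> 'z \<Rightarrow> 'z \<Rightarrow> 'z" where
  "star_diff star a b = (THE c. [a, b, c] \<in> star {[x, y, x - y] | x y. True})"

text \<open>\<open>realizes star a U\<close> is \<open>a \<Turnstile> U\<close> for a tuple \<open>a\<close> and an ultrafilter \<open>U\<close> on \<open>\<int>\<^sup>k\<close>, the latter
  given in the form \<open>tensor [u\<^sub>1, \<dots>, u\<^sub>k]\<close>; for \<open>k = 1\<close> one uses \<open>tensor [u]\<close>.\<close>
definition realizes ::
    "(int list set \<Rightarrow> 'z list set) \<Rightarrow> 'z list \<Rightarrow> int list set set \<Rightarrow> bool" where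
  "realizes star a U \<longleftrightarrow> U = {A. a \<in> star A}"


section \<open>Divisibility and congruences of ultrafilters\<close>

definition multiples :: "int \<Rightarrow> int set" where
  "multiples n = range ((*) n)"

definition tdvd ::
    "(int list set \<Rightarrow> 'z list set) \<Rightarrow> int set set \<Rightarrow> int set set \<Rightarrow> bool" where
  "tdvd star u v \<longleftrightarrow>
     (\<exists>a b. realizes star [a] (tensor [u]) \<and> realizes star [b] (tensor [v]) \<and> star_dvd star a b)"

definition wcong ::
    "(int list set \<Rightarrow> 'z list set) \<Rightarrow> int set set \<Rightarrow> int set set \<Rightarrow> int set set \<Rightarrow> bool" where
  "wcong star w u v \<longleftrightarrow>
     (\<exists>d a b. realizes star [d] (tensor [w]) \<and> realizes star [a, b] (tensor [u, v]) \<and>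
        star_dvd star d (star_diff star a b))"

definition scong ::
    "(int list set \<Rightarrow> 'z list set) \<Rightarrow> int set set \<Rightarrow> int set set \<Rightarrow> int set set \<Rightarrow> bool" where
  "scong star w u v \<longleftrightarrow>
     (\<exists>d a b. realizes star [d, a, b] (tensor [w, u, v]) \<and>
        star_dvd star d (star_diff star a b))"

definition Dset :: "int set set \<Rightarrow> int set" where
  "Dset u = {n. multiples n \<in> u}"

definition self_divisible :: "int set set \<Rightarrow> bool" where
  "self_divisible w \<longleftrightarrow> Dset w \<in> w"

definition Zset :: "(int list set \<Rightarrow> 'z list set) \<Rightarrow> int set set \<Rightarrow> int set set set" where
  "Zset star w = {u \<in> betaZ. tdvd star w u}"

definition closed_under_oplus :: "int set set set \<Rightarrow> bool" where
  "closed_under_oplus S \<longleftrightarrow> (\<forall>u \<in> S. \<forall>v \<in> S. oplus u v \<in> S)"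

definition MAX_uf :: "(int list set \<Rightarrow> 'z list set) \<Rightarrow> int set set set" where
  "MAX_uf star = {w \<in> betaZ. \<forall>u \<in> betaZ - {principal_uf 0}. tdvd star u w}"


section \<open>The profinite completion and the \<open>p\<close>-adic integers\<close>

text \<open>The inverse limit of the groups \<open>\<int>/n\<int>\<close> over \<open>n \<in> I\<close>, along divisibility. Elements of
  \<open>\<int>/n\<int>\<close> are represented by their remainders in \<open>{0..<n}\<close>.\<close>
definition residue_limit :: "nat set \<Rightarrow> (nat \<Rightarrow> int) monoid" where
  "residue_limit I =
     (product_group I integer_mod_group)
       \<lparr>carrier := {x \<in> carrier (product_group I integer_mod_group).
          \<forall>m \<in> I. \<forall>n \<in> I. m dvd n \<longrightarrow> x n mod int m = x m}\<rparr>"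

definition Zhat :: "(nat \<Rightarrow> int) monoid" where
  "Zhat = residue_limit {1..}"

definition Zhat_topology :: "(nat \<Rightarrow> int) topology" where
  "Zhat_topology =
     subtopology
       (product_topology (\<lambda>n. discrete_topology (carrier (integer_mod_group n))) {1..})
       (carrier Zhat)"

definition padic_group :: "nat \<Rightarrow> (nat \<Rightarrow> int) monoid" where
  "padic_group p = residue_limit (range (\<lambda>k. p ^ k))"

definition remainder_uf :: "int set set \<Rightarrow> nat \<Rightarrow> int" where
  "remainder_uf u n =
     (THE r. r \<in> carrier (integer_mod_group n) \<and> (+) r ` multiples (int n) \<in> u)"

definition pi_uf :: "int set set \<Rightarrow> nat \<Rightarrow> int" where
  "pi_uf u = (\<lambda>n \<in> {1..}. remainder_uf u n)"


section \<open>The quotient by strong congruence\<close>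

definition scong_rel ::
    "(int list set \<Rightarrow> 'z list set) \<Rightarrow> int set set \<Rightarrow> (int set set \<times> int set set) set" where
  "scong_rel star w = {(u, v). u \<in> betaZ \<and> v \<in> betaZ \<and> scong star w u v}"

definition scong_class ::
    "(int list set \<Rightarrow> 'z list set) \<Rightarrow> int set set \<Rightarrow> int set set \<Rightarrow> int set set set" where
  "scong_class star w u = scong_rel star w `` {u}"

text \<open>The classes united in the product all coincide, since strong congruence is an equivalence
  relation compatible with \<open>oplus\<close>.\<close>
definition scong_quotient ::
    "(int list set \<Rightarrow> 'z list set) \<Rightarrow> int set set \<Rightarrow> int set set set monoid" where
  "scong_quotient star w =
     \<lparr>carrier = betaZ // scong_rel star w,
      monoid.mult = (\<lambda>X Y. \<Union>u \<in> X. \<Union>v \<in> Y. scong_class star w (oplus u v)),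
      one = scong_class star w (principal_uf 0)\<rparr>"

definition sigma_uf ::
    "(int list set \<Rightarrow> 'z list set) \<Rightarrow> int set set \<Rightarrow> (nat \<Rightarrow> int) \<Rightarrow> int set set set" where
  "sigma_uf star w x = (THE X. \<exists>u \<in> betaZ. pi_uf u = x \<and> X = scong_class star w u)"

definition quotient_topology :: "'a topology \<Rightarrow> ('a \<Rightarrow> 'b) \<Rightarrow> 'b topology" where
  "quotient_topology X f =
     topology (\<lambda>V. V \<subseteq> f ` topspace X \<and> openin X {x \<in> topspace X. f x \<in> V})"

lemma openin_quotient_topology:
  "openin (quotient_topology X f) V \<longleftrightarrow>
     V \<subseteq> f ` topspace X \<and> openin X {x \<in> topspace X. f x \<in> V}"
proof -
  have "istopology (\<lambda>V. V \<subseteq> f ` topspace X \<and> openin X {x \<in> topspace X. f x \<in> V})"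
    unfolding istopology_def
  proof (intro conjI allI impI)
    fix S T
    assume S: "S \<subseteq> f ` topspace X \<and> openin X {x \<in> topspace X. f x \<in> S}"
      and T: "T \<subseteq> f ` topspace X \<and> openin X {x \<in> topspace X. f x \<in> T}"
    show "S \<inter> T \<subseteq> f ` topspace X" using S by blast
    have "{x \<in> topspace X. f x \<in> S \<inter> T} =
        {x \<in> topspace X. f x \<in> S} \<inter> {x \<in> topspace X. f x \<in> T}" by blast
    then show "openin X {x \<in> topspace X. f x \<in> S \<inter> T}" using S T by auto
  next
    fix \<K>
    assume K: "\<forall>K\<in>\<K>. K \<subseteq> f ` topspace X \<and> openin X {x \<in> topspace X. f x \<in> K}"
    show "\<Union> \<K> \<subseteq> f ` topspace X" using K by blast
    have "{x \<in> topspace X. f x \<in> \<Union> \<K>} = (\<Union>K\<in>\<K>. {x \<in> topspace X. f x \<in> K})" by blast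
    then show "openin X {x \<in> topspace X. f x \<in> \<Union> \<K>}" using K by auto
  qed
  then show ?thesis
    unfolding quotient_topology_def by simp
qed

lemma quotient_map_quotient_topology: "quotient_map X (quotient_topology X f) f"
proof -
  have "topspace (quotient_topology X f) = f ` topspace X"
  proof (rule antisym)
    show "topspace (quotient_topology X f) \<subseteq> f ` topspace X"
      using openin_quotient_topology[of X f "topspace (quotient_topology X f)"] openin_topspace
      by blast
    have "{x \<in> topspace X. f x \<in> f ` topspace X} = topspace X" by blast
    then have "openin (quotient_topology X f) (f ` topspace X)"
      by (simp add: openin_quotient_topology)
    then show "f ` topspace X \<subseteq> topspace (quotient_topology X f)"
      by (rule openin_subset)
  qed
  then show ?thesis
    by (simp add: quotient_map_def openin_quotient_topology)
qed

definition scong_quotient_topology ::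
    "(int list set \<Rightarrow> 'z list set) \<Rightarrow> int set set \<Rightarrow> int set set set topology" where
  "scong_quotient_topology star w = quotient_topology betaZ_topology (scong_class star w)"


section \<open>Profinite and procyclic groups\<close>

definition topological_group_on :: "'a monoid \<Rightarrow> 'a topology \<Rightarrow> bool" where
  "topological_group_on G T \<longleftrightarrow>
     group G \<and> topspace T = carrier G \<and>
     continuous_map (prod_topology T T) T (\<lambda>(x, y). x \<otimes>\<^bsub>G\<^esub> y) \<and>
     continuous_map T T (\<lambda>x. inv\<^bsub>G\<^esub> x)"

definition totally_disconnected_space :: "'a topology \<Rightarrow> bool" where
  "totally_disconnected_space T \<longleftrightarrow> (\<forall>S. connectedin T S \<longrightarrow> (\<exists>a. S \<subseteq> {a}))"

definition stone_space :: "'a topology \<Rightarrow> bool" where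
  "stone_space T \<longleftrightarrow> compact_space T \<and> Hausdorff_space T \<and> totally_disconnected_space T"

definition profinite_group :: "'a monoid \<Rightarrow> 'a topology \<Rightarrow> bool" where
  "profinite_group G T \<longleftrightarrow> topological_group_on G T \<and> stone_space T"

definition procyclic_group :: "'a monoid \<Rightarrow> 'a topology \<Rightarrow> bool" where
  "procyclic_group G T \<longleftrightarrow>
     profinite_group G T \<and> (\<exists>g \<in> carrier G. T closure_of (generate G {g}) = topspace T)"


section \<open>The local factors\<close>

definition phi_uf :: "int set set \<Rightarrow> nat \<Rightarrow> enat" where
  "phi_uf w p =
     (let K = {k. multiples (int p ^ k) \<in> w} in if finite K then enat (Max K) else \<infinity>)"

text \<open>In the finite case the group \<open>\<int>/p\<^sup>k\<int>\<close> is written as a product with a single factor, so that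
  it has the same type as \<open>\<int>\<^sub>p\<close>.\<close>
definition local_factor :: "int set set \<Rightarrow> nat \<Rightarrow> (nat \<Rightarrow> int) monoid" where
  "local_factor w p =
     (case phi_uf w p of
        enat k \<Rightarrow> product_group {p ^ k} integer_mod_group
      | \<infinity> \<Rightarrow> padic_group p)"


definition all_equivalent :: "bool list \<Rightarrow> bool" where
  "all_equivalent Ps \<longleftrightarrow> (\<forall>P \<in> set Ps. \<forall>Q \<in> set Ps. P \<longleftrightarrow> Q)"

end

theory Submission
  imports Defs "HOL-Number_Theory.Cong" "HOL-Algebra.Multiplicative_Group"
begin

text \<open>
  Strong congruence modulo \<open>w\<close> only depends on remainders: \<open>u\<close> and \<open>v\<close> are strongly congruent iff the
  set of moduli for which they have the same remainder belongs to \<open>w\<close>. Hence \<open>w\<close> is self-divisible iff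
  it is strongly congruent to \<open>0\<close>, and the quotient is \<open>\<int>\<close>-hat modulo a subgroup, which is closed if \<open>w\<close>
  is self-divisible. Conversely, the class of \<open>w\<close> is always divisible by every positive integer in the
  quotient. This forces it to be trivial when the quotient is a profinite group or a product of
  \<open>p\<close>-adic and finite cyclic groups, or when the kernel is closed, because infinitely divisible
  elements are trivial in such groups.

  If \<open>w\<close> is not self-divisible, the complement of \<open>Dset w\<close> is an upward closed set in \<open>w\<close>, so an
  ultrafilter \<open>u\<close> containing \<open>Dset w\<close> and divisible by all its elements is not in \<open>Z\<^sub>w\<close>; but if \<open>Z\<^sub>w\<close> is
  closed under addition, then, by compactness, some element of \<open>Z\<^sub>w\<close> has the same remainders as \<open>u\<close>.
\<close>

section \<open>Ultrafilters\<close>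

text \<open>Self-divisibility never fails at one prime: for almost all moduli \<open>d\<close>, in
  the sense of \<open>w\<close>, the \<open>p\<close>-part of \<open>d\<close> divides
  \<open>w\<close>. A failure involves primes outside every finite set, so no fixed integer factor
  can repair it. Hence positive factors cancel: if a positive multiple of \<open>w\<close> is
  strongly congruent to \<open>0\<close>, so is \<open>w\<close>. The class of \<open>w\<close> is
  thus either trivial or of infinite order, and it is infinitely divisible in both cases; the
  algebraic and topological conditions are ways to exclude the second case. The extension is an
  obstacle only at the start. Elementarity is given for standard assignments and saturation for one
  variable, whereas the relations concern nonstandard tuples. Once types of tuples are under
  control, each relation becomes a statement about membership in ultrafilters. Saturation also
  supplies every ultrafilter that has to be constructed, always from a directed family of nonempty
  sets, usually residue classes. The modulus \<open>0\<close> has no remainders; \<open>w\<close>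
  being different from \<open>0\<close> allows it to be discarded everywhere.\<close>

lemma uf_mono: "ultrafilter u \<Longrightarrow> A \<in> u \<Longrightarrow> A \<subseteq> B \<Longrightarrow> B \<in> u"
  unfolding ultrafilter_def by blast

lemma uf_mp: "ultrafilter u \<Longrightarrow> A \<in> u \<Longrightarrow> (\<And>x. x \<in> A \<Longrightarrow> x \<in> B) \<Longrightarrow> B \<in> u"
  by (rule uf_mono) auto

lemma uf_UNIV: "ultrafilter u \<Longrightarrow> UNIV \<in> u"
  unfolding ultrafilter_def by blast

lemma uf_empty: "ultrafilter u \<Longrightarrow> {} \<notin> u"
  unfolding ultrafilter_def by blast

lemma uf_Int: "ultrafilter u \<Longrightarrow> A \<inter> B \<in> u \<longleftrightarrow> A \<in> u \<and> B \<in> u"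
  unfolding ultrafilter_def by (meson inf_le1 inf_le2)

lemma uf_Collect_conj:
  "ultrafilter u \<Longrightarrow> {x. P x \<and> Q x} \<in> u \<longleftrightarrow> {x. P x} \<in> u \<and> {x. Q x} \<in> u"
  using uf_Int[of u "{x. P x}" "{x. Q x}"] by (simp add: Collect_conj_eq)

lemma uf_Compl: "ultrafilter u \<Longrightarrow> - A \<in> u \<longleftrightarrow> A \<notin> u"
  by (metis Compl_disjoint uf_Int uf_empty ultrafilter_def)

lemma uf_Un: "ultrafilter u \<Longrightarrow> A \<union> B \<in> u \<longleftrightarrow> A \<in> u \<or> B \<in> u"
  by (metis Compl_Un uf_Compl uf_Int)

lemma uf_Collect_not: "ultrafilter u \<Longrightarrow> {x. \<not> P x} \<in> u \<longleftrightarrow> {x. P x} \<notin> u"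
  using uf_Compl[of u "{x. P x}"] by (simp add: Collect_neg_eq)

lemma uf_UN:
  assumes "ultrafilter u" and "finite I"
  shows "(\<Union>i\<in>I. A i) \<in> u \<longleftrightarrow> (\<exists>i\<in>I. A i \<in> u)"
  using assms(2) by induction (auto simp: uf_empty uf_Un assms(1))

lemma uf_INT:
  assumes "ultrafilter u" and "finite I"
  shows "(\<Inter>i\<in>I. A i) \<in> u \<longleftrightarrow> (\<forall>i\<in>I. A i \<in> u)"
  using assms(2) by induction (auto simp: uf_UNIV uf_Int assms(1))

lemma uf_nonempty: "ultrafilter u \<Longrightarrow> A \<in> u \<Longrightarrow> \<exists>x. x \<in> A"
  by (metis ex_in_conv uf_empty)

text \<open>Pigeonhole for ultrafilters: the finitely many fibres cover the domain. It is used to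
  fix a residue, a gcd, or a truncated valuation on a set in the ultrafilter.\<close>

lemma uf_fiber:
  assumes u: "ultrafilter u" and "finite R" and f: "\<And>x. f x \<in> R"
  shows "\<exists>r\<in>R. {x. f x = r} \<in> u"
proof -
  have "(\<Union>r\<in>R. {x. f x = r}) = UNIV" using f by auto
  then show ?thesis using uf_UN[OF u \<open>finite R\<close>, of "\<lambda>r. {x. f x = r}"] uf_UNIV[OF u] by simp
qed

text \<open>Ultrafilters are maximal filters. Realizing a type therefore only needs one
  inclusion.\<close>

lemma uf_subset_eq:
  assumes "ultrafilter u" and "ultrafilter v" and "u \<subseteq> v"
  shows "u = v"
  using assms by (metis subsetD subsetI subset_antisym uf_Compl)

lemma ultrafilterI:
  assumes "UNIV \<in> u" and "{} \<notin> u"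
    and "\<And>A B. A \<in> u \<Longrightarrow> A \<subseteq> B \<Longrightarrow> B \<in> u"
    and "\<And>A B. A \<in> u \<Longrightarrow> B \<in> u \<Longrightarrow> A \<inter> B \<in> u"
    and "\<And>A. A \<in> u \<or> - A \<in> u"
  shows "ultrafilter u"
  using assms unfolding ultrafilter_def by blast

text \<open>Common form of the sum (\<open>f\<close> is addition) and of the tensor product
  (\<open>f\<close> is list construction).\<close>

lemma ultrafilter_bind:
  assumes "ultrafilter u" and "\<And>x. ultrafilter (v x)"
  shows "ultrafilter {A. {x. {y. f x y \<in> A} \<in> v x} \<in> u}"
proof (rule ultrafilterI)
  fix A B
  let ?M = "{A. {x. {y. f x y \<in> A} \<in> v x} \<in> u}"
  show "UNIV \<in> ?M" by (simp add: assms uf_UNIV)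
  show "{} \<notin> ?M" by (simp add: assms uf_empty)
  show "B \<in> ?M" if "A \<in> ?M" "A \<subseteq> B"
    using that(1) by simp (erule uf_mp[OF assms(1)], use that(2) in \<open>auto elim!: uf_mp[OF assms(2)]\<close>)
  show "A \<inter> B \<in> ?M" if "A \<in> ?M" "B \<in> ?M"
    using that by (simp add: uf_Collect_conj assms)
  show "A \<in> ?M \<or> - A \<in> ?M"
    by (simp add: uf_Collect_not assms)
qed

lemma ultrafilter_principal: "ultrafilter {A. x \<in> A}"
  by (rule ultrafilterI) auto

lemma ultrafilter_image: "ultrafilter u \<Longrightarrow> ultrafilter {A. {x. f x \<in> A} \<in> u}"
  by (rule ultrafilterI) (auto simp: uf_UNIV uf_empty uf_Collect_conj uf_Collect_not elim: uf_mp)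

lemma betaZ_ultrafilter: "u \<in> betaZ \<Longrightarrow> ultrafilter u"
  by (simp add: betaZ_def)

lemma principal_uf_betaZ: "principal_uf n \<in> betaZ"
  by (simp add: betaZ_def principal_uf_def ultrafilter_principal)

lemma mem_principal_uf: "A \<in> principal_uf n \<longleftrightarrow> n \<in> A"
  by (simp add: principal_uf_def)

lemma mem_oplus: "A \<in> oplus u v \<longleftrightarrow> {x. {y. x + y \<in> A} \<in> v} \<in> u"
  by (simp add: oplus_def)

lemma oplus_betaZ: "u \<in> betaZ \<Longrightarrow> v \<in> betaZ \<Longrightarrow> oplus u v \<in> betaZ"
  unfolding betaZ_def oplus_def using ultrafilter_bind[of u "\<lambda>_. v" "(+)"] by simp

lemma oplus_pow_betaZ: "w \<in> betaZ \<Longrightarrow> oplus_pow w n \<in> betaZ"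
  by (induction n) (auto simp: principal_uf_betaZ oplus_betaZ)

lemma mem_scale_uf: "A \<in> scale_uf k u \<longleftrightarrow> {x. k * x \<in> A} \<in> u"
  by (simp add: scale_uf_def)

lemma scale_uf_betaZ: "u \<in> betaZ \<Longrightarrow> scale_uf k u \<in> betaZ"
  unfolding betaZ_def scale_uf_def using ultrafilter_image[of u "(*) k"] by simp

lemma oplus_assoc: "oplus (oplus u v) t = oplus u (oplus v t)"
  by (simp add: oplus_def add.assoc)

lemma oplus_0_right: "u \<in> betaZ \<Longrightarrow> oplus u (principal_uf 0) = u"
  by (simp add: oplus_def principal_uf_def)

lemma oplus_0_left: "oplus (principal_uf 0) u = u"
  by (simp add: oplus_def principal_uf_def)

lemma ultrafilter_tensor: "(\<And>u. u \<in> set us \<Longrightarrow> u \<in> betaZ) \<Longrightarrow> ultrafilter (tensor us)"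
proof (induction us)
  case Nil
  then show ?case by (simp add: ultrafilter_principal)
next
  case (Cons u us)
  then show ?case using ultrafilter_bind[of u "\<lambda>_. tensor us" "(#)"] by (simp add: betaZ_def)
qed

lemma finite_subset_ultrafilter_Inter:
  assumes "ultrafilter u" and "finite G" and "G \<subseteq> u"
  shows "\<Inter>G \<in> u"
  using uf_INT[OF assms(1,2), of "\<lambda>A. A"] assms(3) by auto

text \<open>Otherwise \<open>{0}\<close> is in \<open>w\<close>, so \<open>w\<close> contains the
  principal ultrafilter at \<open>0\<close> and equals it by maximality.\<close>

lemma not_0_mem: "w \<in> betaZ \<Longrightarrow> w \<noteq> principal_uf 0 \<Longrightarrow> {d. d \<noteq> 0} \<in> w"
proof (rule ccontr)
  assume w: "w \<in> betaZ" "w \<noteq> principal_uf 0" and "{d. d \<noteq> 0} \<notin> w"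
  then have "{0} \<in> w" using uf_Collect_not[of w "\<lambda>d. d = 0"] by (auto simp: betaZ_def)
  then have "principal_uf 0 \<subseteq> w"
    using w(1) by (auto simp: mem_principal_uf betaZ_def intro: uf_mono)
  then show False
    using uf_subset_eq[of "principal_uf 0" w] w principal_uf_betaZ[of 0] by (auto simp: betaZ_def)
qed


section \<open>Transfer\<close>

text \<open>Exceeds every variable index, free or bound, so that finitely many values of an
  assignment decide satisfaction and a formula can be closed by finitely many quantifiers.\<close>

primrec fm_bound :: "fm \<Rightarrow> nat" where
  "fm_bound (Eq i j) = max (Suc i) (Suc j)"
| "fm_bound (Rel A is) = Suc (Max (insert 0 (set is)))"
| "fm_bound (Neg \<phi>) = fm_bound \<phi>"
| "fm_bound (Conj \<phi> \<psi>) = max (fm_bound \<phi>) (fm_bound \<psi>)"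
| "fm_bound (Exi i \<phi>) = max (Suc i) (fm_bound \<phi>)"

lemma sat_cong:
  "(\<And>i. i < fm_bound \<phi> \<Longrightarrow> e i = e' i) \<Longrightarrow> sat I e \<phi> \<longleftrightarrow> sat I e' \<phi>"
proof (induction \<phi> arbitrary: e e')
  case (Rel A js)
  have "e i = e' i" if "i \<in> set js" for i
    using that by (intro Rel) (auto simp: less_Suc_eq_le)
  then have "map e js = map e' js" by simp
  then show ?case by (simp del: map_eq_conv)
next
  case (Neg \<phi>)
  have "sat I e \<phi> \<longleftrightarrow> sat I e' \<phi>" by (rule Neg.IH) (simp add: Neg.prems)
  then show ?case by simp
next
  case (Conj \<phi> \<psi>)
  have "sat I e \<phi> \<longleftrightarrow> sat I e' \<phi>" by (rule Conj.IH) (simp add: Conj.prems)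
  moreover have "sat I e \<psi> \<longleftrightarrow> sat I e' \<psi>" by (rule Conj.IH) (simp add: Conj.prems)
  ultimately show ?case by simp
next
  case (Exi i \<phi>)
  have "sat I (e(i := x)) \<phi> \<longleftrightarrow> sat I (e'(i := x)) \<phi>" for x
    by (rule Exi.IH) (simp add: Exi.prems)
  then show ?case by simp
qed simp

primrec exists_below :: "nat \<Rightarrow> fm \<Rightarrow> fm" where
  "exists_below 0 \<phi> = \<phi>"
| "exists_below (Suc n) \<phi> = Exi n (exists_below n \<phi>)"

lemma sat_exists_below:
  "sat I e (exists_below n \<phi>) \<longleftrightarrow> (\<exists>f. sat I (\<lambda>i. if i < n then f i else e i) \<phi>)"
proof (induction n arbitrary: e)
  case (Suc n)
  show ?case
  proof
    assume "sat I e (exists_below (Suc n) \<phi>)"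
    then obtain x f where f: "sat I (\<lambda>i. if i < n then f i else (e(n := x)) i) \<phi>"
      using Suc by auto
    have "(\<lambda>i. if i < n then f i else (e(n := x)) i) = (\<lambda>i. if i < Suc n then (f(n := x)) i else e i)"
      by auto
    then show "\<exists>f. sat I (\<lambda>i. if i < Suc n then f i else e i) \<phi>" using f by metis
  next
    assume "\<exists>f. sat I (\<lambda>i. if i < Suc n then f i else e i) \<phi>"
    then obtain f where f: "sat I (\<lambda>i. if i < Suc n then f i else e i) \<phi>" by blast
    have "(\<lambda>i. if i < Suc n then f i else e i) = (\<lambda>i. if i < n then f i else (e(n := f n)) i)"
      by (auto simp: less_Suc_eq)
    then show "sat I e (exists_below (Suc n) \<phi>)" using f Suc by auto
  qed
qed simp

text \<open>Elementarity compares only assignments of standard elements. A nonstandard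
  counterexample makes the existential closure of the negation true; this no longer depends on the
  assignment and descends to the integers.\<close>

lemma transfer:
  assumes elementary: "elementary_extension emb star"
    and valid: "\<And>e. sat (\<lambda>A. A) e \<phi>"
  shows "sat star e \<phi>"
proof (rule ccontr)
  assume "\<not> sat star e \<phi>"
  \<comment> \<open>Above the bound the values are irrelevant, so they may be replaced by the
    standard element \<open>emb 0\<close>.\<close>
  moreover have "sat star e (Neg \<phi>) \<longleftrightarrow>
      sat star (\<lambda>i. if i < fm_bound \<phi> then e i else (emb \<circ> (\<lambda>_. 0)) i) (Neg \<phi>)"
    by (rule sat_cong) simp
  ultimately have "sat star (emb \<circ> (\<lambda>_. 0)) (exists_below (fm_bound \<phi>) (Neg \<phi>))"
    unfolding sat_exists_below by auto
  then have "sat (\<lambda>A. A) (\<lambda>_. 0) (exists_below (fm_bound \<phi>) (Neg \<phi>))"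
    using elementary unfolding elementary_extension_def by blast
  then show False unfolding sat_exists_below using valid by simp
qed

section \<open>Types of tuples and their realization by saturation\<close>

locale saturated_extension =
  fixes emb :: "int \<Rightarrow> 'z" and star :: "int list set \<Rightarrow> 'z list set"
  assumes elementary: "elementary_extension emb star"
    and satur: "continuum_plus_saturated star"
begin

text \<open>Transfer of a rule with two premises. The index lists select different tuples from one
  assignment; a rule with one premise is obtained by repeating it.\<close>

lemma star_rule:
  assumes valid: "\<And>e :: nat \<Rightarrow> int. map e is \<in> A \<Longrightarrow> map e js \<in> B \<Longrightarrow> map e ks \<in> C"
    and "map e is \<in> star A" and "map e js \<in> star B"
  shows "map e ks \<in> star C"
proof -
  have "sat star e (Neg (Conj (Conj (Rel A is) (Rel B js)) (Neg (Rel C ks))))"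
  proof (rule transfer[OF elementary])
    fix e show "sat (\<lambda>A. A) e (Neg (Conj (Conj (Rel A is) (Rel B js)) (Neg (Rel C ks))))"
      using valid[of e] by simp
  qed
  then show ?thesis using assms(2,3) by simp
qed

text \<open>\<open>star A\<close>, tested on \<open>a\<close>, interprets the symbol of arity
  \<open>length a\<close>, so lists of other lengths in \<open>A\<close> do not matter.\<close>

lemma star_mono_length:
  assumes "a \<in> star A" and "\<And>xs. length xs = length a \<Longrightarrow> xs \<in> A \<Longrightarrow> xs \<in> B"
  shows "a \<in> star B"
proof -
  have "map ((!) a) [0..<length a] \<in> star B"
  proof (rule star_rule[of "[0..<length a]" A "[0..<length a]" A])
    show "map e [0..<length a] \<in> B" if "map e [0..<length a] \<in> A" for e
      by (rule assms(2)) (use that in simp_all)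
  qed (simp_all add: assms(1) map_nth)
  then show ?thesis by (simp add: map_nth)
qed

lemma ultrafilter_type: "ultrafilter {A. a \<in> star A}"
proof (rule ultrafilterI)
  fix A B
  let ?n = "[0..<length a]"
  have "sat star ((!) a) (Rel UNIV ?n)" by (rule transfer[OF elementary]) simp
  then show "UNIV \<in> {A. a \<in> star A}" by (simp add: map_nth)
  have "sat star ((!) a) (Neg (Rel {} ?n))" by (rule transfer[OF elementary]) simp
  then show "{} \<notin> {A. a \<in> star A}" by (simp add: map_nth)
  show "A \<subseteq> B \<Longrightarrow> A \<in> {A. a \<in> star A} \<Longrightarrow> B \<in> {A. a \<in> star A}"
    using star_mono_length[of a A B] by auto
  have "sat star ((!) a) (Neg (Conj (Conj (Rel A ?n) (Rel B ?n)) (Neg (Rel (A \<inter> B) ?n))))"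
    by (rule transfer[OF elementary]) simp
  then show "A \<in> {A. a \<in> star A} \<Longrightarrow> B \<in> {A. a \<in> star A} \<Longrightarrow> A \<inter> B \<in> {A. a \<in> star A}"
    by (simp add: map_nth)
  have "sat star ((!) a) (Neg (Conj (Neg (Rel A ?n)) (Neg (Rel (- A) ?n))))"
    by (rule transfer[OF elementary]) simp
  then show "A \<in> {A. a \<in> star A} \<or> - A \<in> {A. a \<in> star A}" by (simp add: map_nth)
qed

text \<open>Existence and uniqueness of differences both transfer, which justifies the description
  operator in \<open>star_diff\<close>.\<close>

lemma star_diff_graph: "[a, b, star_diff star a b] \<in> star {[x, y, x - y] | x y. True}"
proof -
  let ?D = "{[x, y, x - y] | x y :: int. True}"
  have "sat star ((\<lambda>_ :: nat. a)(1 := b)) (Exi 2 (Rel ?D [0, 1, 2]))"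
    by (rule transfer[OF elementary]) auto
  then obtain c where c: "[a, b, c] \<in> star ?D" by auto
  have uniq: "c' = c" if c': "[a, b, c'] \<in> star ?D" for c'
  proof -
    have "sat star ((\<lambda>_ :: nat. a)(1 := b, 2 := c, 3 := c'))
        (Neg (Conj (Conj (Rel ?D [0, 1, 2]) (Rel ?D [0, 1, 3])) (Neg (Eq 3 2))))"
      by (rule transfer[OF elementary]) auto
    then show ?thesis using c c' by simp
  qed
  have "star_diff star a b = c"
    unfolding star_diff_def by (rule the_equality) (fact c, erule uniq)
  then show ?thesis using c by simp
qed

text \<open>Removes the nonstandard difference: the condition becomes one standard ternary relation,
  whose truth can be read off the type of \<open>[d, a, b]\<close>.\<close>

lemma star_dvd_diff:
  "star_dvd star d (star_diff star a b) \<longleftrightarrow> [d, a, b] \<in> star {[x, y, z] | x y z. x dvd y - z}"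
proof
  let ?e = "((\<lambda>_ :: nat. d)(1 := a, 2 := b, 3 := star_diff star a b))"
  let ?D = "{[x, y, x - y] | x y :: int. True}"
  let ?Q = "{[x, y, z] | x y z :: int. x dvd y - z}"
  let ?R = "{[x, y] | x y :: int. x dvd y}"
  show "[d, a, b] \<in> star ?Q" if "star_dvd star d (star_diff star a b)"
  proof -
    have "map ?e [0, 1, 2] \<in> star ?Q"
      by (rule star_rule[of "[0, 3]" ?R "[1, 2, 3]" ?D])
        (use that star_diff_graph[of a b] in \<open>auto simp: star_dvd_def\<close>)
    then show ?thesis by simp
  qed
  show "star_dvd star d (star_diff star a b)" if "[d, a, b] \<in> star ?Q"
  proof -
    have "map ?e [0, 3] \<in> star ?R"
      by (rule star_rule[of "[0, 1, 2]" ?Q "[1, 2, 3]" ?D]) (use that star_diff_graph[of a b] in auto)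
    then show ?thesis by (simp add: star_dvd_def)
  qed
qed

text \<open>Saturation bounds the number of parameters, not of formulas, so \<open>F\<close> may be
  any family; the only parameter is the dummy \<open>emb 0\<close>.\<close>

lemma realize_int:
  assumes "\<And>G. finite G \<Longrightarrow> G \<subseteq> F \<Longrightarrow> \<exists>x. \<forall>A\<in>G. [x] \<in> A"
  shows "\<exists>a. \<forall>A\<in>F. [a] \<in> star A"
proof -
  let ?e = "\<lambda>_ :: nat. emb 0"
  define \<Gamma> where "\<Gamma> = (\<lambda>A. (Rel A [0], ?e)) ` F"
  have sm: "{emb 0} \<lesssim> (UNIV :: nat set set)"
    unfolding lepoll_def by (rule exI[of _ "\<lambda>_. {}"]) simp
  have fin: "\<exists>x. \<forall>(\<phi>, e)\<in>H. sat star (e(0 := x)) \<phi>" if H: "H \<subseteq> \<Gamma>" "finite H" for H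
  proof -
    obtain G where G: "finite G" "G \<subseteq> F" "H = (\<lambda>A. (Rel A [0], ?e)) ` G"
      using H unfolding \<Gamma>_def by (metis finite_subset_image)
    then obtain x where x: "\<forall>A\<in>G. [x] \<in> A" using assms by blast
    have "[emb x] \<in> star A" if "A \<in> G" for A
    proof -
      have "sat (\<lambda>A. A) (\<lambda>_. x) (Rel A [0])" using x that by simp
      then have "sat star (emb \<circ> (\<lambda>_. x)) (Rel A [0])"
        using elementary unfolding elementary_extension_def by blast
      then show ?thesis by simp
    qed
    then show ?thesis unfolding G(3) by auto
  qed
  have "\<forall>(\<phi>, e)\<in>\<Gamma>. range e \<subseteq> {emb 0}" unfolding \<Gamma>_def by auto
  then have "\<exists>x. \<forall>(\<phi>, e)\<in>\<Gamma>. sat star (e(0 := x)) \<phi>"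
    using satur[unfolded continuum_plus_saturated_def, THEN spec, THEN spec, THEN mp, OF sm, of \<Gamma>] fin
    by blast
  then show ?thesis unfolding \<Gamma>_def by auto
qed

text \<open>Triples are coded by single integers, since saturation speaks of one variable only.\<close>
lemma realize_triple:
  assumes "\<And>G. finite G \<Longrightarrow> G \<subseteq> F \<Longrightarrow> \<exists>x y z. \<forall>A\<in>G. [x, y, z] \<in> A"
  shows "\<exists>a b c. \<forall>A\<in>F. [a, b, c] \<in> star A"
proof -
  define f :: "int \<Rightarrow> int \<times> int \<times> int" where "f n = from_nat (nat n)" for n
  define g where "g n = [fst (f n), fst (snd (f n)), snd (snd (f n))]" for n
  have g_surj: "\<exists>n. g n = [x, y, z]" for x y z
    unfolding g_def f_def by (rule exI[of _ "int (to_nat (x, y, z))"]) simp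
  let ?c = "\<lambda>A. {[n] | n. g n \<in> A}"
  have "\<exists>n. \<forall>A\<in>H. [n] \<in> A" if H: "finite H" "H \<subseteq> ?c ` F" for H
  proof -
    obtain G where G: "G \<subseteq> F" "finite G" "H = ?c ` G"
      using finite_subset_image[OF H] by blast
    obtain x y z where xyz: "\<forall>A\<in>G. [x, y, z] \<in> A" using assms[OF G(2,1)] by blast
    obtain n where "g n = [x, y, z]" using g_surj by blast
    then show ?thesis unfolding G(3) using xyz by (intro exI[of _ n]) auto
  qed
  then have "\<exists>n. \<forall>A\<in>?c ` F. [n] \<in> star A" by (rule realize_int)
  then obtain n where n: "\<forall>A\<in>?c ` F. [n] \<in> star A" ..
  let ?R = "{n # g n | n. True}"
  \<comment> \<open>The nonstandard code \<open>n\<close> has components because every integer has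
    some; they are obtained by transfer.\<close>
  have "sat star (\<lambda>_. n) (Exi 1 (Exi 2 (Exi 3 (Rel ?R [0, 1, 2, 3]))))"
    by (rule transfer[OF elementary]) (simp add: g_def)
  then obtain a b c where abc: "[n, a, b, c] \<in> star ?R" by auto
  have "[a, b, c] \<in> star A" if "A \<in> F" for A
  proof -
    have nA: "[n] \<in> star (?c A)" using n that by blast
    have "map ((\<lambda>_ :: nat. n)(1 := a, 2 := b, 3 := c)) [1, 2, 3] \<in> star A"
      by (rule star_rule[of "[0]" "?c A" "[0, 1, 2, 3]" ?R]) (use abc nA in \<open>auto simp: g_def\<close>)
    then show ?thesis by simp
  qed
  then show ?thesis by blast
qed

text \<open>The ultrafilter lemma, derived from saturation: \<open>u\<close> is the type of an
  element realizing \<open>F\<close>.\<close>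

lemma ultrafilter_extending:
  assumes "\<And>G. finite G \<Longrightarrow> G \<subseteq> F \<Longrightarrow> \<Inter>G \<noteq> {}"
  shows "\<exists>u\<in>betaZ. F \<subseteq> u"
proof -
  let ?l = "\<lambda>A. {[x] | x :: int. x \<in> A}"
  have "\<exists>x. \<forall>A\<in>H. [x] \<in> A" if H: "finite H" "H \<subseteq> ?l ` F" for H
  proof -
    obtain G where G: "G \<subseteq> F" "finite G" "H = ?l ` G"
      using finite_subset_image[OF H] by blast
    obtain x where "x \<in> \<Inter>G" using assms[OF G(2,1)] by blast
    then show ?thesis unfolding G(3) by (intro exI[of _ x]) auto
  qed
  then have "\<exists>a. \<forall>A\<in>?l ` F. [a] \<in> star A" by (rule realize_int)
  then obtain a where a: "\<forall>A\<in>?l ` F. [a] \<in> star A" ..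
  have "ultrafilter {A. {xs. hd xs \<in> A} \<in> {B. [a] \<in> star B}}"
    by (rule ultrafilter_image[OF ultrafilter_type])
  moreover have "[a] \<in> star {xs. hd xs \<in> A}" if "A \<in> F" for A
    by (rule star_mono_length[of _ "?l A"]) (use a that in auto)
  ultimately show ?thesis unfolding betaZ_def by auto
qed

text \<open>By directedness every finite intersection contains a member of the family, hence is
  nonempty. This is the form in which compactness is used below.\<close>

lemma directed_ultrafilter:
  assumes "I \<noteq> {}" and ne: "\<And>i. i \<in> I \<Longrightarrow> C i \<noteq> {}"
    and dir: "\<And>i j. i \<in> I \<Longrightarrow> j \<in> I \<Longrightarrow> \<exists>k\<in>I. C k \<subseteq> C i \<inter> C j"
  shows "\<exists>u\<in>betaZ. \<forall>i\<in>I. C i \<in> u"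
proof -
  have "\<exists>k\<in>I. C k \<subseteq> \<Inter>G" if "finite G" "G \<subseteq> C ` I" for G
    using that
  proof induction
    case empty
    then show ?case using assms(1) by auto
  next
    case (insert A G)
    then obtain k i where "k \<in> I" "C k \<subseteq> \<Inter>G" "i \<in> I" "A = C i" by auto
    then show ?case using dir[of k i] by auto
  qed
  then have "\<exists>u\<in>betaZ. C ` I \<subseteq> u"
    by (intro ultrafilter_extending) (use ne in fastforce)
  then show ?thesis by auto
qed

section \<open>Divisibility and congruences expressed by membership in ultrafilters\<close>

lemma realizes_tensor_1:
  assumes "u \<in> betaZ"
  shows "realizes star [a] (tensor [u]) \<longleftrightarrow> (\<forall>A\<in>u. a \<in> star_set star A)"
proof
  assume r: "realizes star [a] (tensor [u])"
  show "\<forall>A\<in>u. a \<in> star_set star A"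
  proof
    fix A assume "A \<in> u"
    then have "{[x] | x. x \<in> A} \<in> tensor [u]" by simp
    then show "a \<in> star_set star A" using r unfolding realizes_def star_set_def by blast
  qed
next
  assume r: "\<forall>A\<in>u. a \<in> star_set star A"
  have "[a] \<in> star A" if "A \<in> tensor [u]" for A
  proof -
    have "{x. [x] \<in> A} \<in> u" using that by simp
    then have "a \<in> star_set star {x. [x] \<in> A}" using r by blast
    then have "[a] \<in> star {[x] | x. [x] \<in> A}" unfolding star_set_def by simp
    then show ?thesis by (rule star_mono_length) auto
  qed
  then show "realizes star [a] (tensor [u])"
    unfolding realizes_def
    by (intro uf_subset_eq ultrafilter_type ultrafilter_tensor) (use assms in auto)
qed

lemma star_set_type_betaZ: "{A. a \<in> star_set star A} \<in> betaZ"
proof -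
  have "[a] \<in> star {xs. hd xs \<in> A} \<longleftrightarrow> a \<in> star_set star A" for A
    unfolding star_set_def mem_Collect_eq
    by (rule iffI; erule star_mono_length) (auto simp: length_Suc_conv)
  then show ?thesis
    using ultrafilter_image[OF ultrafilter_type[of "[a]"], of hd] by (simp add: betaZ_def)
qed

lemma realizes_type: "realizes star [a] (tensor [{A. a \<in> star_set star A}])"
  unfolding realizes_tensor_1[OF star_set_type_betaZ] by blast

lemma realizes_tensor_1_eq:
  "u \<in> betaZ \<Longrightarrow> realizes star [a] (tensor [u]) \<longleftrightarrow> u = {A. a \<in> star_set star A}"
  using realizes_tensor_1[of u a] realizes_type[of a] uf_subset_eq[of u "{A. a \<in> star_set star A}"]
    star_set_type_betaZ[of a]
  by (auto simp: betaZ_ultrafilter)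

text \<open>A finite intersection of sets in the tensor product is again in it, so \<open>x\<close>,
  \<open>y\<close>, \<open>z\<close> can be picked one after another from the nested sets.\<close>

lemma tensor_3_realized:
  assumes "u \<in> betaZ" and "v \<in> betaZ" and "t \<in> betaZ"
  shows "\<exists>a b c. realizes star [a, b, c] (tensor [u, v, t])"
proof -
  have uf: "ultrafilter (tensor [u, v, t])" by (rule ultrafilter_tensor) (use assms in auto)
  have "\<exists>x y z. \<forall>A\<in>G. [x, y, z] \<in> A" if "finite G" "G \<subseteq> tensor [u, v, t]" for G
  proof -
    have "\<Inter>G \<in> tensor [u, v, t]" by (rule finite_subset_ultrafilter_Inter[OF uf that])
    then have "{x. {y. {z. [x, y, z] \<in> \<Inter>G} \<in> t} \<in> v} \<in> u" by simp
    then obtain x where "{y. {z. [x, y, z] \<in> \<Inter>G} \<in> t} \<in> v"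
      using uf_nonempty[OF betaZ_ultrafilter[OF assms(1)]] by blast
    then obtain y where "{z. [x, y, z] \<in> \<Inter>G} \<in> t"
      using uf_nonempty[OF betaZ_ultrafilter[OF assms(2)]] by blast
    then obtain z where "[x, y, z] \<in> \<Inter>G"
      using uf_nonempty[OF betaZ_ultrafilter[OF assms(3)]] by blast
    then show ?thesis by blast
  qed
  then have "\<exists>a b c. \<forall>A\<in>tensor [u, v, t]. [a, b, c] \<in> star A" by (rule realize_triple)
  then obtain a b c where "\<forall>A\<in>tensor [u, v, t]. [a, b, c] \<in> star A" by blast
  then have "realizes star [a, b, c] (tensor [u, v, t])"
    unfolding realizes_def by (intro uf_subset_eq ultrafilter_type uf) auto
  then show ?thesis by blast
qed

text \<open>Whether \<open>d\<close> divides \<open>a - b\<close> depends only on the type of the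
  triple. All realizations therefore agree, and there is at least one.\<close>

lemma scong_iff_mem:
  assumes "w \<in> betaZ" and "u \<in> betaZ" and "v \<in> betaZ"
  shows "scong star w u v \<longleftrightarrow> {d. {a. {b. d dvd a - b} \<in> v} \<in> u} \<in> w"
proof -
  let ?Q = "{[x, y, z] | x y z. x dvd y - z}"
  have 1: "?Q \<in> tensor [w, u, v] \<longleftrightarrow> {d. {a. {b. d dvd a - b} \<in> v} \<in> u} \<in> w" by simp
  have 2: "[d, a, b] \<in> star ?Q \<longleftrightarrow> ?Q \<in> tensor [w, u, v]"
    if "realizes star [d, a, b] (tensor [w, u, v])" for d a b
    using that unfolding realizes_def by blast
  show ?thesis
    unfolding scong_def star_dvd_diff 1[symmetric] using 2 tensor_3_realized[OF assms] by blast
qed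

lemma star_set_dvd:
  assumes "star_dvd star a b" and "a \<in> star_set star A" and "\<And>x y. x \<in> A \<Longrightarrow> x dvd y \<Longrightarrow> y \<in> B"
  shows "b \<in> star_set star B"
proof -
  have "map ((\<lambda>_ :: nat. a)(1 := b)) [1] \<in> star {[x] | x. x \<in> B}"
    by (rule star_rule[of "[0]" "{[x] | x. x \<in> A}" "[0, 1]" "{[x, y] | x y. x dvd y}"])
      (use assms in \<open>auto simp: star_dvd_def star_set_def\<close>)
  then show ?thesis by (simp add: star_set_def)
qed

lemma star_set_dvd':
  assumes "star_dvd star a b" and "b \<in> star_set star B" and "\<And>x y. y \<in> B \<Longrightarrow> x dvd y \<Longrightarrow> x \<in> A"
  shows "a \<in> star_set star A"
proof -
  have "map ((\<lambda>_ :: nat. a)(1 := b)) [0] \<in> star {[x] | x. x \<in> A}"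
    by (rule star_rule[of "[1]" "{[x] | x. x \<in> B}" "[0, 1]" "{[x, y] | x y. x dvd y}"])
      (use assms in \<open>auto simp: star_dvd_def star_set_def\<close>)
  then show ?thesis by (simp add: star_set_def)
qed

lemma star_dvd_refl: "star_dvd star a a"
  unfolding star_dvd_def
proof -
  have "sat star (\<lambda>_. a) (Rel {[x, y] | x y. x dvd y} [0, 0])"
    by (rule transfer[OF elementary]) simp
  then show "[a, a] \<in> star {[x, y] | x y. x dvd y}" by simp
qed

text \<open>Upward closed sets pass from a divisor to a multiple by transfer. Conversely, saturation
  yields the pair once \<open>x dvd y\<close> is solvable with \<open>x\<close> in \<open>A\<close>
  and \<open>y\<close> in \<open>B\<close>, for all \<open>A\<close> in \<open>u\<close> and
  \<open>B\<close> in \<open>v\<close>.\<close>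

lemma tdvd_iff:
  assumes u: "u \<in> betaZ" and v: "v \<in> betaZ"
  shows "tdvd star u v \<longleftrightarrow> (\<forall>A\<in>u. (\<forall>x\<in>A. \<forall>y. x dvd y \<longrightarrow> y \<in> A) \<longrightarrow> A \<in> v)"
proof
  assume "tdvd star u v"
  then obtain a b where ab: "realizes star [a] (tensor [u])" "realizes star [b] (tensor [v])"
    "star_dvd star a b" unfolding tdvd_def by blast
  show "\<forall>A\<in>u. (\<forall>x\<in>A. \<forall>y. x dvd y \<longrightarrow> y \<in> A) \<longrightarrow> A \<in> v"
    using ab(1,2) star_set_dvd[OF ab(3)]
    unfolding realizes_tensor_1_eq[OF u] realizes_tensor_1_eq[OF v] by blast
next
  assume R: "\<forall>A\<in>u. (\<forall>x\<in>A. \<forall>y. x dvd y \<longrightarrow> y \<in> A) \<longrightarrow> A \<in> v"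
  \<comment> \<open>The third coordinate is a dummy that makes \<open>realize_triple\<close>
    applicable.\<close>
  let ?T = "\<lambda>A B. {[x, y, z] | x y z :: int. x \<in> A \<and> y \<in> B \<and> x dvd y}"
  let ?F = "{?T A B | A B. A \<in> u \<and> B \<in> v}"
  have below: "\<exists>A\<in>u. \<exists>B\<in>v. ?T A B \<subseteq> \<Inter>G" if "finite G" "G \<subseteq> ?F" for G
    using that
  proof induction
    case empty
    then show ?case using uf_UNIV u v by (auto simp: betaZ_def)
  next
    case (insert C G)
    then obtain A B A' B' where AB: "A \<in> u" "B \<in> v" "?T A B \<subseteq> \<Inter>G" "A' \<in> u" "B' \<in> v" "C = ?T A' B'"
      by auto
    then have "A \<inter> A' \<in> u" "B \<inter> B' \<in> v" "?T (A \<inter> A') (B \<inter> B') \<subseteq> \<Inter>(insert C G)"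
      using u v by (auto simp: betaZ_def uf_Int)
    then show ?case by blast
  qed
  have ne: "\<exists>x y. [x, y, 0] \<in> ?T A B" if AB: "A \<in> u" "B \<in> v" for A B
  proof -
    \<comment> \<open>The upward closure of \<open>A\<close> is in \<open>u\<close>, hence in
      \<open>v\<close> by \<open>R\<close>, and so meets \<open>B\<close>.\<close>
    let ?C = "{y. \<exists>x\<in>A. x dvd y}"
    have "?C \<in> u"
      by (rule uf_mp[OF betaZ_ultrafilter[OF u] AB(1)]) (rule CollectI, rule bexI, rule dvd_refl)
    moreover have "\<forall>y\<in>?C. \<forall>z. y dvd z \<longrightarrow> z \<in> ?C"
      by (blast intro: dvd_trans)
    ultimately have "?C \<in> v" by (rule R[THEN bspec, THEN mp])
    then have "?C \<inter> B \<in> v" using AB(2) uf_Int[OF betaZ_ultrafilter[OF v]] by blast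
    then obtain y where "y \<in> ?C" "y \<in> B" using uf_nonempty[OF betaZ_ultrafilter[OF v]] by blast
    then show ?thesis by blast
  qed
  have "\<exists>x y z. \<forall>A\<in>G. [x, y, z] \<in> A" if G: "finite G" "G \<subseteq> ?F" for G
  proof -
    obtain A B where AB: "A \<in> u" "B \<in> v" "?T A B \<subseteq> \<Inter>G" using below[OF G] by blast
    obtain x y where "[x, y, 0] \<in> ?T A B" using ne[OF AB(1,2)] by blast
    then have "[x, y, 0] \<in> \<Inter>G" using AB(3) by (rule rev_subsetD)
    then show ?thesis by blast
  qed
  then have "\<exists>a b c. \<forall>A\<in>?F. [a, b, c] \<in> star A" by (rule realize_triple)
  then obtain a b c where abc: "\<forall>A\<in>?F. [a, b, c] \<in> star A" by (elim exE)
  have T: "[a, b, c] \<in> star (?T A B)" if "A \<in> u" "B \<in> v" for A B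
    by (rule bspec[OF abc], rule CollectI, rule exI[of _ A], rule exI[of _ B], intro conjI refl that)
  let ?e = "(\<lambda>_ :: nat. a)(1 := b, 2 := c)"
  have U: "UNIV \<in> u" "UNIV \<in> v" using u v by (auto simp: betaZ_def uf_UNIV)
  have "a \<in> star_set star A" if "A \<in> u" for A
  proof -
    have "map ?e [0] \<in> star {[x] | x. x \<in> A}"
      by (rule star_rule[of "[0, 1, 2]" "?T A UNIV" "[0, 1, 2]" "?T A UNIV"])
        (use T[OF that U(2)] in auto)
    then show ?thesis by (simp add: star_set_def)
  qed
  moreover have "b \<in> star_set star B" if "B \<in> v" for B
  proof -
    have "map ?e [1] \<in> star {[x] | x. x \<in> B}"
      by (rule star_rule[of "[0, 1, 2]" "?T UNIV B" "[0, 1, 2]" "?T UNIV B"])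
        (use T[OF U(1) that] in auto)
    then show ?thesis by (simp add: star_set_def)
  qed
  moreover have "star_dvd star a b"
  proof -
    have "map ?e [0, 1] \<in> star {[x, y] | x y. x dvd y}"
      by (rule star_rule[of "[0, 1, 2]" "?T UNIV UNIV" "[0, 1, 2]" "?T UNIV UNIV"])
        (use T[OF U] in auto)
    then show ?thesis by (simp add: star_dvd_def)
  qed
  ultimately show "tdvd star u v"
    unfolding tdvd_def using realizes_tensor_1[OF u] realizes_tensor_1[OF v] by blast
qed

text \<open>Since \<open>b\<close> has the type of \<open>0\<close>, subtracting it does not change
  the type of \<open>a\<close>.\<close>

lemma realizes_star_diff_0:
  assumes w: "w \<in> betaZ" and ab: "realizes star [a, b] (tensor [w, principal_uf 0])"
  shows "realizes star [star_diff star a b] (tensor [w])"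
  unfolding realizes_tensor_1[OF w]
proof
  fix A assume "A \<in> w"
  then have "{[x, y] | x y. x - y \<in> A} \<in> tensor [w, principal_uf 0]"
    by (simp add: mem_principal_uf)
  then have 1: "[a, b] \<in> star {[x, y] | x y. x - y \<in> A}" using ab by (auto simp: realizes_def)
  let ?e = "((\<lambda>_ :: nat. a)(1 := b, 2 := star_diff star a b))"
  have "map ?e [2] \<in> star {[x] | x. x \<in> A}"
    by (rule star_rule[of "[0, 1]" "{[x, y] | x y. x - y \<in> A}" "[0, 1, 2]" "{[x, y, x - y] | x y. True}"])
      (use 1 star_diff_graph[of a b] in auto)
  then show "star_diff star a b \<in> star_set star A" by (simp add: star_set_def)
qed

lemma wcong_0_imp_tdvd:
  assumes "w \<in> betaZ" and "wcong star v w (principal_uf 0)"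
  shows "tdvd star v w"
  using assms realizes_star_diff_0 unfolding wcong_def tdvd_def by blast

text \<open>The realization of the modulus can be chosen to be the difference \<open>a - b\<close>
  itself, which has type \<open>w\<close>.\<close>

lemma wcong_refl_0:
  assumes w: "w \<in> betaZ"
  shows "wcong star w w (principal_uf 0)"
proof -
  let ?U = "tensor [w, principal_uf 0]"
  \<comment> \<open>Only the pair \<open>[a, b]\<close> is wanted; the first component is
    discarded.\<close>
  obtain d a b where dab: "realizes star [d, a, b] (tensor [w, w, principal_uf 0])"
    using tensor_3_realized[OF w w principal_uf_betaZ] by blast
  have "[a, b] \<in> star A" if "A \<in> ?U" for A
  proof -
    have "{[x, y, z] | x y z. [y, z] \<in> A} \<in> tensor [w, w, principal_uf 0]"
      using that w by (simp add: betaZ_def uf_UNIV)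
    then have 1: "[d, a, b] \<in> star {[x, y, z] | x y z. [y, z] \<in> A}"
      using dab by (auto simp: realizes_def)
    have "map ((\<lambda>_ :: nat. d)(1 := a, 2 := b)) [1, 2] \<in> star A"
      by (rule star_rule[of "[0, 1, 2]" "{[x, y, z] | x y z. [y, z] \<in> A}"
            "[0, 1, 2]" "{[x, y, z] | x y z. [y, z] \<in> A}"]) (use 1 in auto)
    then show ?thesis by simp
  qed
  then have "realizes star [a, b] ?U"
    unfolding realizes_def
    by (intro uf_subset_eq ultrafilter_type ultrafilter_tensor) (auto simp: w principal_uf_betaZ)
  then show ?thesis
    unfolding wcong_def using realizes_star_diff_0[OF w] star_dvd_refl by blast
qed

end

section \<open>Remainders\<close>

lemma multiples_eq: "multiples n = {x. n dvd x}"
  unfolding multiples_def by (auto elim: dvdE)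

text \<open>Moduli are integers of either sign because they range over sets in ultrafilters on the
  integers. The lemmas on remainders exclude \<open>d = 0\<close>.\<close>

definition zrem :: "int set set \<Rightarrow> int \<Rightarrow> int" where
  "zrem u d = remainder_uf u (nat \<bar>d\<bar>)"

lemma cong_coset: "(+) r ` multiples n = {x. [x = r] (mod n)}"
proof -
  have "x \<in> (+) r ` {x. n dvd x}" if "n dvd x - r" for x
    using that by (intro image_eqI[of _ _ "x - r"]) auto
  then show ?thesis unfolding multiples_eq cong_iff_dvd_diff by auto
qed

lemma cong_unique:
  fixes r s :: int
  assumes "[r = s] (mod d)" and "0 \<le> r" and "r < \<bar>d\<bar>" and "0 \<le> s" and "s < \<bar>d\<bar>"
  shows "r = s"
  using cong_less_imp_eq_int[of r "\<bar>d\<bar>" s] assms by (simp add: cong_iff_dvd_diff)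

text \<open>Pigeonhole gives a residue class in \<open>u\<close>. Two such classes meet, so the
  residue is unique and the description in \<open>remainder_uf\<close> is justified.\<close>

lemma zrem:
  assumes u: "u \<in> betaZ" and "d \<noteq> 0"
  shows "0 \<le> zrem u d" and "zrem u d < \<bar>d\<bar>" and "{x. [x = zrem u d] (mod d)} \<in> u"
proof -
  note uf = betaZ_ultrafilter[OF u]
  have "\<exists>r\<in>{0..<\<bar>d\<bar>}. {x. x mod \<bar>d\<bar> = r} \<in> u"
    by (rule uf_fiber[OF uf]) (use \<open>d \<noteq> 0\<close> in auto)
  then obtain r where r: "0 \<le> r" "r < \<bar>d\<bar>" "{x. x mod \<bar>d\<bar> = r} \<in> u" by auto
  have r': "{x. [x = r] (mod d)} \<in> u"
  proof (rule uf_mp[OF uf r(3)])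
    fix x assume "x \<in> {x. x mod \<bar>d\<bar> = r}"
    then show "x \<in> {x. [x = r] (mod d)}"
      using dvd_minus_mod[of "\<bar>d\<bar>" x] by (simp add: cong_iff_dvd_diff)
  qed
  let ?P = "\<lambda>r. r \<in> carrier (integer_mod_group (nat \<bar>d\<bar>)) \<and> (+) r ` multiples (int (nat \<bar>d\<bar>)) \<in> u"
  have P: "?P s \<longleftrightarrow> 0 \<le> s \<and> s < \<bar>d\<bar> \<and> {x. [x = s] (mod d)} \<in> u" for s
    using \<open>d \<noteq> 0\<close> by (auto simp: carrier_integer_mod_group cong_coset cong_iff_dvd_diff)
  have uniq: "s = r" if "?P s" for s
  proof -
    have "{x. [x = s] (mod d)} \<inter> {x. [x = r] (mod d)} \<in> u" using that r' unfolding P by (simp add: uf_Int[OF uf])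
    then obtain x where "[x = s] (mod d)" "[x = r] (mod d)" using uf_nonempty[OF uf] by blast
    then show ?thesis using cong_unique[of s r d] r that unfolding P by (metis cong_sym cong_trans)
  qed
  have Pr: "?P r" unfolding P using r r' by simp
  have "zrem u d = r"
    unfolding zrem_def remainder_uf_def using Pr uniq by (rule the_equality)
  then show "0 \<le> zrem u d" "zrem u d < \<bar>d\<bar>" "{x. [x = zrem u d] (mod d)} \<in> u"
    using r r' by auto
qed

lemma mem_cong_iff:
  assumes u: "u \<in> betaZ" and "d \<noteq> 0"
  shows "{x. [x = r] (mod d)} \<in> u \<longleftrightarrow> [zrem u d = r] (mod d)"
proof
  note uf = betaZ_ultrafilter[OF u]
  assume "{x. [x = r] (mod d)} \<in> u"
  then have "{x. [x = r] (mod d)} \<inter> {x. [x = zrem u d] (mod d)} \<in> u"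
    using zrem(3)[OF assms] by (simp add: uf_Int[OF uf])
  then obtain x where "[x = r] (mod d)" "[x = zrem u d] (mod d)" using uf_nonempty[OF uf] by blast
  then show "[zrem u d = r] (mod d)" by (metis cong_sym cong_trans)
next
  assume "[zrem u d = r] (mod d)"
  then show "{x. [x = r] (mod d)} \<in> u"
    by (intro uf_mp[OF betaZ_ultrafilter[OF u] zrem(3)[OF assms]]) (auto intro: cong_trans)
qed

lemma zrem_eqI:
  assumes "u \<in> betaZ" and "v \<in> betaZ" and "d \<noteq> 0" and "[zrem u d = zrem v d] (mod d)"
  shows "zrem u d = zrem v d"
  using assms zrem by (intro cong_unique[of _ _ d]) auto

lemma zrem_dvd:
  assumes "u \<in> betaZ" and "e dvd d" and "d \<noteq> 0"
  shows "[zrem u d = zrem u e] (mod e)"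
proof -
  have "e \<noteq> 0" using assms by auto
  moreover have "{x. [x = zrem u d] (mod e)} \<in> u"
    by (rule uf_mp[OF betaZ_ultrafilter zrem(3)]) (use assms in \<open>auto intro: cong_dvd_modulus\<close>)
  ultimately show ?thesis using assms mem_cong_iff cong_sym by blast
qed

lemma multiples_mem_iff:
  assumes "u \<in> betaZ" and "d \<noteq> 0"
  shows "multiples d \<in> u \<longleftrightarrow> zrem u d = 0"
proof -
  have "multiples d \<in> u \<longleftrightarrow> [zrem u d = 0] (mod d)"
    using mem_cong_iff[OF assms, of 0] by (simp add: multiples_eq cong_iff_dvd_diff)
  also have "\<dots> \<longleftrightarrow> zrem u d = 0"
    using cong_unique[of "zrem u d" 0 d] zrem[OF assms] assms by auto
  finally show ?thesis .
qed

lemma zrem_0_iff: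
  assumes "u \<in> betaZ" and "d \<noteq> 0"
  shows "zrem u d = 0 \<longleftrightarrow> d dvd zrem u d"
  using cong_unique[of "zrem u d" 0 d] zrem[OF assms] assms by (auto simp: cong_iff_dvd_diff)

lemma zrem_0_dvd:
  assumes "u \<in> betaZ" and "e dvd d" and "d \<noteq> 0"
  shows "zrem u e = 0 \<longleftrightarrow> e dvd zrem u d"
  using zrem_dvd[OF assms] zrem_0_iff[OF assms(1), of e] assms
  by (metis cong_dvd_iff dvd_0_left_iff dvd_trans)

lemma zrem_oplus:
  assumes u: "u \<in> betaZ" and v: "v \<in> betaZ" and "d \<noteq> 0"
  shows "[zrem (oplus u v) d = zrem u d + zrem v d] (mod d)"
proof -
  have "{x. {y. [x + y = zrem u d + zrem v d] (mod d)} \<in> v} \<in> u"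
    by (rule uf_mp[OF betaZ_ultrafilter zrem(3)], rule u, rule u, rule \<open>d \<noteq> 0\<close>, simp,
        rule uf_mp[OF betaZ_ultrafilter zrem(3)[OF v \<open>d \<noteq> 0\<close>]], rule v) (auto intro: cong_add)
  then show ?thesis using mem_cong_iff[OF oplus_betaZ[OF u v] \<open>d \<noteq> 0\<close>] by (simp add: mem_oplus)
qed

lemma zrem_scale:
  assumes u: "u \<in> betaZ" and "d \<noteq> 0"
  shows "[zrem (scale_uf k u) d = k * zrem u d] (mod d)"
proof -
  have "{x. [k * x = k * zrem u d] (mod d)} \<in> u"
    by (rule uf_mp[OF betaZ_ultrafilter[OF u] zrem(3)[OF assms]]) (auto intro: cong_mult)
  then show ?thesis using mem_cong_iff[OF scale_uf_betaZ[OF u] \<open>d \<noteq> 0\<close>] by (simp add: mem_scale_uf)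
qed

lemma zrem_principal: "d \<noteq> 0 \<Longrightarrow> [zrem (principal_uf n) d = n] (mod d)"
  using mem_cong_iff[OF principal_uf_betaZ, of d n n] by (simp add: mem_principal_uf)

lemma zrem_principal_0: "d \<noteq> 0 \<Longrightarrow> zrem (principal_uf 0) d = 0"
  using zrem_principal[of d 0] zrem_0_iff[OF principal_uf_betaZ, of d 0]
  by (simp add: cong_iff_dvd_diff)

lemma zrem_oplus_pow:
  assumes u: "u \<in> betaZ" and "d \<noteq> 0"
  shows "[zrem (oplus_pow u n) d = int n * zrem u d] (mod d)"
proof (induction n)
  case 0
  then show ?case by (simp add: zrem_principal_0 assms)
next
  case (Suc n)
  have "[zrem (oplus_pow u (Suc n)) d = zrem (oplus_pow u n) d + zrem u d] (mod d)"
    using zrem_oplus[OF oplus_pow_betaZ[OF u] u \<open>d \<noteq> 0\<close>] by simp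
  also have "[zrem (oplus_pow u n) d + zrem u d = int n * zrem u d + zrem u d] (mod d)"
    using Suc by (intro cong_add) auto
  finally show ?case by (simp add: algebra_simps)
qed

text \<open>For fixed \<open>a\<close> the inner set is the residue class of \<open>a\<close>, which
  is in \<open>v\<close> iff \<open>a\<close> is congruent to \<open>zrem v d\<close>. The outer set
  is then the residue class of \<open>zrem v d\<close>.\<close>

lemma mem_dvd_diff_iff:
  assumes u: "u \<in> betaZ" and v: "v \<in> betaZ" and "d \<noteq> 0"
  shows "{a. {b. d dvd a - b} \<in> v} \<in> u \<longleftrightarrow> zrem u d = zrem v d"
proof -
  have "{b. d dvd a - b} = {b. [b = a] (mod d)}" for a
    by (auto simp: cong_iff_dvd_diff dvd_diff_commute)
  then have "{a. {b. d dvd a - b} \<in> v} = {a. [a = zrem v d] (mod d)}"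
    using mem_cong_iff[OF v \<open>d \<noteq> 0\<close>] by (auto simp: cong_sym_eq)
  then show ?thesis using mem_cong_iff[OF u \<open>d \<noteq> 0\<close>] zrem_eqI[OF u v \<open>d \<noteq> 0\<close>] by auto
qed

lemma zrem_lcm:
  assumes u: "u \<in> betaZ" and "d \<noteq> 0" and "e \<noteq> 0" and "zrem u d = 0" and "zrem u e = 0"
  shows "zrem u (lcm d e) = 0"
proof -
  have "multiples d \<inter> multiples e \<in> u"
    using assms by (simp add: uf_Int[OF betaZ_ultrafilter[OF u]] multiples_mem_iff)
  then have "multiples (lcm d e) \<in> u"
    by (rule uf_mp[OF betaZ_ultrafilter[OF u]]) (auto simp: multiples_eq)
  then show ?thesis using assms by (simp add: multiples_mem_iff lcm_eq_0_iff)
qed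


section \<open>Self-divisibility\<close>

context
  fixes w :: "int set set"
  assumes w: "w \<in> betaZ" and w0: "w \<noteq> principal_uf 0"
begin

lemma uf_w: "ultrafilter w" using w by (rule betaZ_ultrafilter)

lemma nonzero_conj: "{d. P d} \<in> w \<Longrightarrow> {d. d \<noteq> 0 \<and> P d} \<in> w"
  using not_0_mem[OF w w0] by (simp add: uf_Collect_conj[OF uf_w])

text \<open>The modulus \<open>0\<close> is excluded because its only multiple is
  \<open>0\<close>.\<close>

lemma Dset_eq: "Dset w = {d. d \<noteq> 0 \<and> zrem w d = 0}"
proof -
  have "multiples 0 \<notin> w"
    using not_0_mem[OF w w0] uf_Collect_not[OF uf_w, of "\<lambda>d. d = 0"] by (simp add: multiples_eq)
  then show ?thesis unfolding Dset_def using multiples_mem_iff[OF w] by (metis (lifting) Collect_cong)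
qed

lemma self_divisible_iff: "self_divisible w \<longleftrightarrow> {d. d \<noteq> 0 \<and> zrem w d = 0} \<in> w"
  unfolding self_divisible_def Dset_eq ..

lemma one_mem_Dset: "1 \<in> Dset w"
proof -
  have "multiples 1 = UNIV" by (auto simp: multiples_eq)
  then show ?thesis using uf_UNIV[OF uf_w] by (simp add: Dset_def)
qed

lemma Dset_dvd: "n \<in> Dset w \<Longrightarrow> m dvd n \<Longrightarrow> m \<in> Dset w"
  unfolding Dset_def multiples_eq by (auto elim: uf_mp[OF uf_w] intro: dvd_trans)

lemma Dset_lcm: "n \<in> Dset w \<Longrightarrow> m \<in> Dset w \<Longrightarrow> lcm n m \<in> Dset w"
  unfolding Dset_eq using zrem_lcm[OF w] by (auto simp: lcm_eq_0_iff)

text \<open>The implications form a cycle. Its substantial link is the last one, from common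
  divisors back to self-divisibility, by a finiteness argument.\<close>

lemma self_divisible_iff_common_divisor: "self_divisible w \<longleftrightarrow> (\<forall>B\<in>w. \<exists>A\<in>w. \<forall>a\<in>A. \<forall>a'\<in>A. \<exists>b\<in>B. b dvd gcd a a')"
  and self_divisible_iff_subset_multiples: "self_divisible w \<longleftrightarrow> (\<forall>B\<in>w. \<exists>A\<in>w. \<exists>b\<in>B. A \<subseteq> multiples b)"
  and self_divisible_iff_ex_multiples: "self_divisible w \<longleftrightarrow> (\<forall>B\<in>w. \<exists>b\<in>B. multiples b \<in> w)"
  and self_divisible_iff_Collect_multiples: "self_divisible w \<longleftrightarrow> (\<forall>B\<in>w. {b\<in>B. multiples b \<in> w} \<in> w)"
proof -
  let ?P2 = "\<forall>B\<in>w. \<exists>A\<in>w. \<forall>a\<in>A. \<forall>a'\<in>A. \<exists>b\<in>B. b dvd gcd a a'"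
  let ?P3 = "\<forall>B\<in>w. \<exists>A\<in>w. \<exists>b\<in>B. A \<subseteq> multiples b"
  let ?P4 = "\<forall>B\<in>w. \<exists>b\<in>B. multiples b \<in> w"
  let ?P5 = "\<forall>B\<in>w. {b\<in>B. multiples b \<in> w} \<in> w"
  have 15: ?P5 if "self_divisible w"
    using that by (simp add: self_divisible_def Dset_def uf_Collect_conj[OF uf_w])
  have 54: ?P4 if ?P5
    using that uf_nonempty[OF uf_w] by blast
  have 43: ?P3 if ?P4
    using that by blast
  have 32: ?P2 if P3: ?P3
  proof
    fix B assume "B \<in> w"
    then obtain A b where A: "A \<in> w" "b \<in> B" "A \<subseteq> multiples b" using P3 by blast
    then have "b dvd a" if "a \<in> A" for a using that by (auto simp: multiples_eq)
    with A show "\<exists>A\<in>w. \<forall>a\<in>A. \<forall>a'\<in>A. \<exists>b\<in>B. b dvd gcd a a'"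
      by (intro bexI[of _ A] ballI bexI[of _ b]) simp_all
  qed
  have 21: "self_divisible w" if P2: ?P2
  proof (rule ccontr)
    assume "\<not> self_divisible w"
    then have nD: "- Dset w \<in> w" by (simp add: self_divisible_def uf_Compl[OF uf_w])
    obtain A where A: "A \<in> w" "\<forall>a\<in>A. \<forall>a'\<in>A. \<exists>b\<in>- Dset w. b dvd gcd a a'"
      using bspec[OF P2 nD] by (elim bexE)
    have "{d. d \<noteq> 0} \<inter> A \<in> w" using A(1) not_0_mem[OF w w0] by (simp add: uf_Int[OF uf_w])
    then obtain a where a: "a \<in> A" "a \<noteq> 0" using uf_nonempty[OF uf_w] by blast
    \<comment> \<open>A fixed nonzero \<open>a\<close> has finitely many divisors, and the multiples
      of those outside \<open>Dset w\<close> cover \<open>A\<close>. Hence the multiples of one of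
      them are in \<open>w\<close>, a contradiction.\<close>
    let ?I = "{b. b dvd a} \<inter> - Dset w"
    have "(\<Union>b\<in>?I. multiples b) \<in> w"
    proof (rule uf_mp[OF uf_w A(1)])
      fix a' assume "a' \<in> A"
      then obtain b where "b \<in> - Dset w" "b dvd a" "b dvd a'" using A(2) a(1) by fastforce
      then show "a' \<in> (\<Union>b\<in>?I. multiples b)" by (auto simp: multiples_eq)
    qed
    moreover have "finite ?I" using a(2) by (simp add: finite_divisors_int)
    ultimately show False using uf_UN[OF uf_w, of ?I multiples] by (auto simp: Dset_def)
  qed
  show "self_divisible w \<longleftrightarrow> ?P2" "self_divisible w \<longleftrightarrow> ?P3" "self_divisible w \<longleftrightarrow> ?P4"
    "self_divisible w \<longleftrightarrow> ?P5"
    using 15 54 43 32 21 by argo+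
qed

text \<open>For nonzero \<open>k\<close>, \<open>k * x\<close> divides \<open>k * y\<close> iff
  \<open>x\<close> divides \<open>y\<close>, so \<open>Dset (scale_uf k w)\<close> pulls back to
  \<open>Dset w\<close> under multiplication by \<open>k\<close>.\<close>

lemma self_divisible_scale: "k \<noteq> 0 \<Longrightarrow> self_divisible (scale_uf k w) \<longleftrightarrow> self_divisible w"
  by (simp add: self_divisible_def Dset_def multiples_eq mem_scale_uf)

lemma self_divisible_iff_scale: "self_divisible w \<longleftrightarrow> (\<forall>k::int. k \<noteq> 0 \<longrightarrow> self_divisible (scale_uf k w))"
  using self_divisible_scale by (metis one_neq_zero)

text \<open>Self-divisibility at a single prime holds for every \<open>w\<close>. Either all powers
  of \<open>p\<close> divide \<open>w\<close>, or the \<open>p\<close>-adic valuation has a constant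
  value \<open>r\<close> on a set in \<open>w\<close>; then \<open>p ^ r\<close> divides almost
  every element, that is, it divides \<open>w\<close>.\<close>

lemma prime_power_part:
  fixes p :: int
  assumes p: "prime p"
  shows "{d. d \<noteq> 0 \<and> zrem w (p ^ multiplicity p d) = 0} \<in> w"
proof (cases "\<exists>j. zrem w (p ^ j) \<noteq> 0")
  case False
  then show ?thesis using not_0_mem[OF w w0] by simp
next
  case True
  have p0: "p ^ i \<noteq> 0" for i using p by auto
  from True obtain j where "multiples (p ^ j) \<notin> w" using multiples_mem_iff[OF w p0] by auto
  then have j: "{d. \<not> p ^ j dvd d} \<in> w" by (simp add: multiples_eq uf_Collect_not[OF uf_w])
  \<comment> \<open>Truncation at \<open>j\<close> makes the range finite and changes nothing where
    \<open>p ^ j\<close> does not divide \<open>d\<close>.\<close>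
  let ?f = "\<lambda>d. min j (multiplicity p d)"
  have "\<exists>r\<in>{..j}. {d. ?f d = r} \<in> w" by (rule uf_fiber[OF uf_w]) auto
  then obtain r where "{d. ?f d = r} \<in> w" by blast
  then have "{d. \<not> p ^ j dvd d \<and> ?f d = r} \<in> w" using j by (simp add: uf_Collect_conj[OF uf_w])
  then have *: "{d. d \<noteq> 0 \<and> \<not> p ^ j dvd d \<and> ?f d = r} \<in> w" by (rule nonzero_conj)
  have **: "multiplicity p d = r" if "d \<noteq> 0 \<and> \<not> p ^ j dvd d \<and> ?f d = r" for d
    using that by (metis min_def multiplicity_dvd')
  have "multiples (p ^ r) \<in> w"
  proof (rule uf_mp[OF uf_w *])
    fix d assume "d \<in> {d. d \<noteq> 0 \<and> \<not> p ^ j dvd d \<and> ?f d = r}"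
    then have "multiplicity p d = r" using ** by blast
    then show "d \<in> multiples (p ^ r)" using multiplicity_dvd[of p d] by (simp add: multiples_eq)
  qed
  then have r0: "zrem w (p ^ r) = 0" using multiples_mem_iff[OF w p0] by simp
  show ?thesis
  proof (rule uf_mp[OF uf_w *])
    fix d assume d: "d \<in> {d. d \<noteq> 0 \<and> \<not> p ^ j dvd d \<and> ?f d = r}"
    then have "multiplicity p d = r" using ** by blast
    then show "d \<in> {d. d \<noteq> 0 \<and> zrem w (p ^ multiplicity p d) = 0}" using r0 d by simp
  qed
qed

text \<open>The modulus may itself be divisible by \<open>p\<close>. Its part prime to
  \<open>p\<close> allows cancellation, and its \<open>p\<close>-part divides
  \<open>zrem w d\<close> by \<open>prime_power_part\<close>; the two parts are coprime.\<close>

lemma cancel_prime: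
  fixes p k :: int
  assumes p: "prime p" and "{d. d \<noteq> 0 \<and> d dvd p * k * zrem w d} \<in> w"
  shows "{d. d \<noteq> 0 \<and> d dvd k * zrem w d} \<in> w"
proof -
  have *: "{d. (d \<noteq> 0 \<and> zrem w (p ^ multiplicity p d) = 0) \<and> (d \<noteq> 0 \<and> d dvd p * k * zrem w d)} \<in> w"
    unfolding uf_Collect_conj[OF uf_w, of "\<lambda>d. d \<noteq> 0 \<and> zrem w (p ^ multiplicity p d) = 0"]
    using prime_power_part[OF p] assms(2) by blast
  show ?thesis
  proof (rule uf_mp[OF uf_w *], clarsimp)
    fix d assume d: "d \<noteq> 0" "zrem w (p ^ multiplicity p d) = 0" "d dvd p * k * zrem w d"
    obtain e where e: "d = p ^ multiplicity p d * e" "\<not> p dvd e"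
      using multiplicity_decompose'[OF \<open>d \<noteq> 0\<close>, of p] p by (metis not_prime_unit)
    have cop: "coprime p e" using p e(2) by (simp add: prime_imp_coprime)
    have "e dvd p * k * zrem w d" using d(3) e(1) by (metis dvd_mult_right)
    then have "e dvd k * zrem w d"
      using cop by (metis coprime_commute coprime_dvd_mult_right_iff mult.assoc)
    moreover have "p ^ multiplicity p d dvd k * zrem w d"
      using d zrem_0_dvd[OF w multiplicity_dvd \<open>d \<noteq> 0\<close>] by (metis dvd_mult)
    moreover have "coprime (p ^ multiplicity p d) e" using cop by simp
    ultimately show "d dvd k * zrem w d" using e(1) by (metis divides_mult)
  qed
qed

text \<open>Prime factors of \<open>k\<close> are removed one by one. At \<open>k = 1\<close> the
  modulus divides a remainder smaller than itself, which must then be \<open>0\<close>.\<close>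

lemma cancel_pos:
  assumes "k > 0" and "{d. d \<noteq> 0 \<and> d dvd int k * zrem w d} \<in> w"
  shows "self_divisible w"
  using assms
proof (induction k rule: less_induct)
  case (less k)
  show ?case
  proof (cases "k = 1")
    case True
    then show ?thesis using less.prems(2) zrem_0_iff[OF w]
      by (auto simp: self_divisible_iff elim!: uf_mp[OF uf_w])
  next
    case False
    then obtain p where p: "prime p" "p dvd k" using prime_factor_nat by blast
    then obtain l where l: "k = p * l" by blast
    have "{d. d \<noteq> 0 \<and> d dvd int l * zrem w d} \<in> w"
      by (rule cancel_prime[of "int p"]) (use p less.prems l in auto)
    moreover have "l < k" "l > 0" using l p less.prems prime_gt_1_nat[OF p(1)] by auto
    ultimately show ?thesis using less.IH by blast
  qed
qed

end

context saturated_extension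
begin

text \<open>The bridge from the extension to remainders. It is stated for an arbitrary nonzero
  modulus because it is also applied with moduli other than the fixed \<open>w\<close>.\<close>

lemma scong_iff:
  assumes w: "w \<in> betaZ" "w \<noteq> principal_uf 0" and u: "u \<in> betaZ" and v: "v \<in> betaZ"
  shows "scong star w u v \<longleftrightarrow> {d. d \<noteq> 0 \<and> zrem u d = zrem v d} \<in> w"
proof -
  note uf = betaZ_ultrafilter[OF w(1)]
  have "{d. d \<noteq> 0 \<and> zrem u d = zrem v d} = {d. d \<noteq> 0 \<and> {a. {b. d dvd a - b} \<in> v} \<in> u}"
    using mem_dvd_diff_iff[OF u v] by blast
  then show ?thesis
    unfolding scong_iff_mem[OF w(1) u v] using not_0_mem[OF w] by (simp add: uf_Collect_conj[OF uf])
qed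

end

section \<open>Conditions for a fixed nonzero ultrafilter\<close>

locale nonzero_ultrafilter = saturated_extension emb star
  for emb :: "int \<Rightarrow> 'z" and star :: "int list set \<Rightarrow> 'z list set" +
  fixes w :: "int set set"
  assumes w: "w \<in> betaZ" and w0: "w \<noteq> principal_uf 0"
begin

lemma uf_w: "ultrafilter w" using w by (rule betaZ_ultrafilter)

lemma self_divisible_iff_scong: "self_divisible w \<longleftrightarrow> scong star w w (principal_uf 0)"
proof -
  have "{d. d \<noteq> 0 \<and> zrem w d = zrem (principal_uf 0) d} = {d. d \<noteq> 0 \<and> zrem w d = 0}"
    using zrem_principal_0 by auto
  then show ?thesis
    unfolding scong_iff[OF w w0 w principal_uf_betaZ] self_divisible_iff[OF w w0] by simp
qed

text \<open>Since \<open>gcd d n\<close> is constant on a set of moduli \<open>d\<close> in \<open>w\<close>, the congruences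
  \<open>n * y = w\<close> modulo these \<open>d\<close> are simultaneously solvable.\<close>
lemma scong_multiple_exists:
  assumes n: "n > 0"
  shows "\<exists>y\<in>betaZ. scong star w w (oplus_pow y n)"
proof -
  have "\<exists>c\<in>{0..int n}. {d. gcd d (int n) = c} \<in> w"
    by (rule uf_fiber[OF uf_w]) (use n in \<open>auto intro: zdvd_imp_le\<close>)
  then obtain c where "{d. gcd d (int n) = c} \<in> w" by blast
  then have S: "{d. d \<noteq> 0 \<and> gcd d (int n) = c} \<in> w" by (rule nonzero_conj[OF w w0])
  let ?S = "{d. d \<noteq> 0 \<and> gcd d (int n) = c}"
  obtain d0 where d0: "d0 \<in> ?S" using uf_nonempty[OF uf_w S] by blast
  have c0: "c \<noteq> 0" and cn: "c dvd int n" using d0 n by auto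
  \<comment> \<open>Since \<open>c\<close> divides every \<open>d\<close> in \<open>?S\<close>, it
    divides \<open>w\<close>, hence each \<open>zrem w d\<close>. This is the solvability condition
    for the congruences \<open>?C d\<close>.\<close>
  have "multiples c \<in> w"
    by (rule uf_mp[OF uf_w S]) (auto simp: multiples_eq)
  then have wc: "zrem w c = 0" using multiples_mem_iff[OF w c0] by simp
  let ?C = "\<lambda>d. {y. [int n * y = zrem w d] (mod d)}"
  have "\<exists>y\<in>betaZ. \<forall>d\<in>?S. ?C d \<in> y"
  proof (rule directed_ultrafilter)
    show "?S \<noteq> {}" using d0 by blast
    fix d assume d: "d \<in> ?S"
    then have "c dvd d" by auto
    then have "c dvd zrem w d" using zrem_0_dvd[OF w, of c d] wc d by auto
    then have "gcd (int n) d dvd zrem w d" using d by (simp add: gcd.commute)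
    then show "?C d \<noteq> {}" using cong_solve_dvd_int by blast
    fix e assume e: "e \<in> ?S"
    obtain d' e' n' where f: "d = c * d'" "e = c * e'" "int n = c * n'"
      using d e cn by (metis (mono_tags, lifting) dvdE gcd_dvd1 mem_Collect_eq)
    have cpos: "\<bar>c\<bar> = c" using d by auto
    have cop: "coprime x n'" if "gcd (c * x) (c * n') = c" for x
      using that c0 cpos gcd_mult_distrib_int[of c x n'] by (simp add: coprime_iff_gcd_eq_1)
    \<comment> \<open>After division by \<open>c\<close>, both moduli are coprime to
      \<open>n'\<close>, and so is their lcm. Thus \<open>?S\<close> is closed under lcm, which
      makes the solution sets directed.\<close>
    have "coprime (lcm d' e') n'"
    proof (rule coprime_divisors)
      show "lcm d' e' dvd d' * e'" by (simp add: lcm_least)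
      show "coprime (d' * e') n'" using cop[of d'] cop[of e'] d e f by simp
    qed simp
    then have "gcd (lcm d e) (int n) = c"
      using cpos f lcm_mult_distrib'[of c d' e'] gcd_mult_distrib_int[of c "lcm d' e'" n']
      by (simp add: coprime_iff_gcd_eq_1)
    then have l: "lcm d e \<in> ?S" using d e by (simp add: lcm_eq_0_iff)
    moreover have "?C (lcm d e) \<subseteq> ?C x" if "x \<noteq> 0" "x dvd lcm d e" for x
    proof
      fix y assume "y \<in> ?C (lcm d e)"
      then have "[int n * y = zrem w (lcm d e)] (mod x)"
        using that cong_dvd_modulus by blast
      moreover have "[zrem w (lcm d e) = zrem w x] (mod x)"
        using zrem_dvd[OF w that(2)] l by blast
      ultimately show "y \<in> ?C x" using cong_trans by blast
    qed
    ultimately show "\<exists>k\<in>?S. ?C k \<subseteq> ?C d \<inter> ?C e" using d e by (intro bexI[of _ "lcm d e"]) auto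
  qed
  then obtain y where y: "y \<in> betaZ" and C: "\<And>d. d \<in> ?S \<Longrightarrow> ?C d \<in> y" by blast
  note ufy = betaZ_ultrafilter[OF y]
  have "zrem w d = zrem (oplus_pow y n) d" if d: "d \<in> ?S" for d
  proof (rule zrem_eqI[OF w oplus_pow_betaZ[OF y]])
    show "d \<noteq> 0" using d by simp
    have "?C d \<inter> {x. [x = zrem y d] (mod d)} \<in> y"
      using C[OF d] zrem(3)[OF y \<open>d \<noteq> 0\<close>] by (simp add: uf_Int[OF ufy])
    then obtain x where "[int n * x = zrem w d] (mod d)" "[x = zrem y d] (mod d)"
      using uf_nonempty[OF ufy] by blast
    then have "[zrem w d = int n * zrem y d] (mod d)"
      by (metis cong_scalar_left cong_sym cong_trans)
    then show "[zrem w d = zrem (oplus_pow y n) d] (mod d)"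
      using zrem_oplus_pow[OF y \<open>d \<noteq> 0\<close>] cong_sym cong_trans by blast
  qed
  then have "{d. d \<noteq> 0 \<and> zrem w d = zrem (oplus_pow y n) d} \<in> w"
    by (intro uf_mono[OF uf_w S]) blast
  then show ?thesis using scong_iff[OF w w0 w oplus_pow_betaZ[OF y]] y by blast
qed

text \<open>The multiple \<open>m - n\<close> of \<open>w\<close> is strongly congruent to
  \<open>0\<close>, and this positive factor cancels.\<close>

lemma scong_powers_imp:
  assumes "n < m" and sc: "{d. d \<noteq> 0 \<and> zrem (oplus_pow w n) d = zrem (oplus_pow w m) d} \<in> w"
  shows "self_divisible w"
proof (rule cancel_pos[OF w w0])
  show "0 < m - n" using assms by simp
  show "{d. d \<noteq> 0 \<and> d dvd int (m - n) * zrem w d} \<in> w"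
  proof (rule uf_mp[OF uf_w sc])
    fix d assume d: "d \<in> {d. d \<noteq> 0 \<and> zrem (oplus_pow w n) d = zrem (oplus_pow w m) d}"
    then have "[int m * zrem w d = int n * zrem w d] (mod d)"
      using zrem_oplus_pow[OF w, of d n] zrem_oplus_pow[OF w, of d m]
      by (metis (mono_tags, lifting) cong_sym cong_trans mem_Collect_eq)
    then have "d dvd int (m - n) * zrem w d"
      using \<open>n < m\<close> by (simp add: cong_iff_dvd_diff left_diff_distrib of_nat_diff)
    then show "d \<in> {d. d \<noteq> 0 \<and> d dvd int (m - n) * zrem w d}" using d by simp
  qed
qed

lemma self_divisible_iff_oplus_pow: "self_divisible w \<longleftrightarrow>
  (\<exists>n m::nat. 0 < n \<and> 0 < m \<and> n \<noteq> m \<and> scong star w (oplus_pow w n) (oplus_pow w m))"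
proof
  assume "self_divisible w"
  then have sd: "{d. d \<noteq> 0 \<and> zrem w d = 0} \<in> w" by (simp add: self_divisible_iff[OF w w0])
  have "zrem (oplus_pow w n) d = 0" if "d \<noteq> 0" "zrem w d = 0" for n d
    using zrem_oplus_pow[OF w \<open>d \<noteq> 0\<close>, of n] that zrem_0_iff[OF oplus_pow_betaZ[OF w] \<open>d \<noteq> 0\<close>]
    by (simp add: cong_iff_dvd_diff)
  then have "{d. d \<noteq> 0 \<and> zrem (oplus_pow w 1) d = zrem (oplus_pow w 2) d} \<in> w"
    by (intro uf_mono[OF uf_w sd]) (auto simp del: oplus_pow.simps)
  then have "scong star w (oplus_pow w 1) (oplus_pow w 2)"
    unfolding scong_iff[OF w w0 oplus_pow_betaZ[OF w] oplus_pow_betaZ[OF w]] .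
  then show "\<exists>n m::nat. 0 < n \<and> 0 < m \<and> n \<noteq> m \<and> scong star w (oplus_pow w n) (oplus_pow w m)"
    by (intro exI[of _ 1] exI[of _ 2]) simp
next
  assume "\<exists>n m::nat. 0 < n \<and> 0 < m \<and> n \<noteq> m \<and> scong star w (oplus_pow w n) (oplus_pow w m)"
  then obtain n m where "n \<noteq> m"
    and nm: "{d. d \<noteq> 0 \<and> zrem (oplus_pow w n) d = zrem (oplus_pow w m) d} \<in> w"
    unfolding scong_iff[OF w w0 oplus_pow_betaZ[OF w] oplus_pow_betaZ[OF w]] by blast
  have mn: "{d. d \<noteq> 0 \<and> zrem (oplus_pow w m) d = zrem (oplus_pow w n) d} \<in> w"
    by (rule uf_mp[OF uf_w nm]) simp
  show "self_divisible w"
    using \<open>n \<noteq> m\<close> scong_powers_imp[OF _ nm] scong_powers_imp[OF _ mn] by linarith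
qed

text \<open>\<open>a\<close> lies in the extension of \<open>Dset w\<close> by self-divisibility,
  and closure of \<open>Dset w\<close> under divisors transfers.\<close>

lemma divisors_in_Dset:
  assumes "self_divisible w" and "realizes star [a] (tensor [w])" and "star_dvd star b a"
  shows "b \<in> star_set star (Dset w)"
proof (rule star_set_dvd'[OF assms(3)])
  show "a \<in> star_set star (Dset w)"
    using assms(1,2) unfolding self_divisible_def realizes_tensor_1[OF w] by blast
qed (rule Dset_dvd[OF w w0])

lemma tdvd_refl: "tdvd star w w"
  unfolding tdvd_iff[OF w w] by blast

text \<open>If some realization of \<open>v\<close> divides one of \<open>w\<close>, it lies in the
  extension of \<open>Dset w\<close>, so \<open>Dset w\<close> is in \<open>v\<close>. For the
  converse take \<open>v = w\<close>: the weak congruence of \<open>w\<close> to \<open>0\<close>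
  modulo itself always holds.\<close>

lemma self_divisible_iff_wcong: "self_divisible w \<longleftrightarrow> (\<forall>v \<in> betaZ - {principal_uf 0}.
  wcong star v w (principal_uf 0) \<longrightarrow> scong star v w (principal_uf 0))"
proof
  assume sd: "self_divisible w"
  show "\<forall>v \<in> betaZ - {principal_uf 0}.
    wcong star v w (principal_uf 0) \<longrightarrow> scong star v w (principal_uf 0)"
  proof (intro ballI impI)
    fix v assume "v \<in> betaZ - {principal_uf 0}" and wc: "wcong star v w (principal_uf 0)"
    then have v: "v \<in> betaZ" "v \<noteq> principal_uf 0" by auto
    obtain d a where d: "realizes star [d] (tensor [v])" and a: "realizes star [a] (tensor [w])"
      and da: "star_dvd star d a"
      using wcong_0_imp_tdvd[OF w wc] unfolding tdvd_def by blast
    have "Dset w \<in> v"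
      using divisors_in_Dset[OF sd a da] d unfolding realizes_tensor_1_eq[OF v(1)] by blast
    then have "{d. d \<noteq> 0 \<and> zrem w d = zrem (principal_uf 0) d} \<in> v"
      by (rule uf_mp[OF betaZ_ultrafilter[OF v(1)]]) (simp add: Dset_eq[OF w w0] zrem_principal_0)
    then show "scong star v w (principal_uf 0)"
      using scong_iff[OF v w principal_uf_betaZ] by simp
  qed
next
  assume "\<forall>v \<in> betaZ - {principal_uf 0}.
    wcong star v w (principal_uf 0) \<longrightarrow> scong star v w (principal_uf 0)"
  then show "self_divisible w"
    unfolding self_divisible_iff_scong using w w0 wcong_refl_0[OF w] by blast
qed

lemma self_divisible_iff_star_divisors: "self_divisible w \<longleftrightarrow>
  (\<forall>a. realizes star [a] (tensor [w]) \<longrightarrow> {b. star_dvd star b a} \<subseteq> star_set star (Dset w))"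
proof
  assume R: "\<forall>a. realizes star [a] (tensor [w]) \<longrightarrow> {b. star_dvd star b a} \<subseteq> star_set star (Dset w)"
  obtain a where a: "realizes star [a] (tensor [w])" using tdvd_refl unfolding tdvd_def by blast
  then have "a \<in> star_set star (Dset w)" using R star_dvd_refl by blast
  then show "self_divisible w"
    using a unfolding realizes_tensor_1_eq[OF w] self_divisible_def by blast
qed (use divisors_in_Dset in blast)

section \<open>The ultrafilters divisible by \<open>w\<close>\<close>

lemma tdvd_imp_Dset_subset:
  assumes u: "u \<in> betaZ" and "tdvd star w u"
  shows "Dset w \<subseteq> Dset u"
  using assms(2) unfolding tdvd_iff[OF w u] Dset_def multiples_eq
  by (auto intro: dvd_trans)

text \<open>An upward closed set in \<open>w\<close> meets \<open>Dset w\<close> in some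
  \<open>n\<close>, hence contains all multiples of \<open>n\<close>, and these form a set in
  \<open>u\<close>.\<close>

lemma tdvd_iff_Dset_subset:
  assumes "self_divisible w" and u: "u \<in> betaZ"
  shows "tdvd star w u \<longleftrightarrow> Dset w \<subseteq> Dset u"
proof
  assume D: "Dset w \<subseteq> Dset u"
  show "tdvd star w u"
    unfolding tdvd_iff[OF w u]
  proof (intro ballI impI)
    fix A assume A: "A \<in> w" and up: "\<forall>x\<in>A. \<forall>y. x dvd y \<longrightarrow> y \<in> A"
    have "A \<inter> Dset w \<in> w"
      using A assms(1) by (simp add: self_divisible_def uf_Int[OF uf_w])
    then obtain n where n: "n \<in> A" "n \<in> Dset w" using uf_nonempty[OF uf_w] by blast
    then have "multiples n \<in> u" using D by (auto simp: Dset_def)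
    then show "A \<in> u"
      by (rule uf_mono[OF betaZ_ultrafilter[OF u]]) (use n up in \<open>auto simp: multiples_eq\<close>)
  qed
qed (rule tdvd_imp_Dset_subset[OF u])

lemma Zset_closed_under_oplus:
  assumes sd: "self_divisible w"
  shows "closed_under_oplus (Zset star w)"
  unfolding closed_under_oplus_def
proof (intro ballI)
  fix u v assume "u \<in> Zset star w" and "v \<in> Zset star w"
  then have u: "u \<in> betaZ" "Dset w \<subseteq> Dset u" and v: "v \<in> betaZ" "Dset w \<subseteq> Dset v"
    using tdvd_iff_Dset_subset[OF sd] by (auto simp: Zset_def)
  have "n \<in> Dset (oplus u v)" if n: "n \<in> Dset w" for n
  proof -
    have "multiples n \<in> u" "multiples n \<in> v" using n u v by (auto simp: Dset_def)
    then have "n dvd zrem u n" "n dvd zrem v n" "n \<noteq> 0"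
      using n multiples_mem_iff[OF u(1), of n] multiples_mem_iff[OF v(1), of n]
      by (auto simp: Dset_eq[OF w w0])
    then have "n dvd zrem (oplus u v) n"
      using zrem_oplus[OF u(1) v(1)] by (metis cong_dvd_iff dvd_add)
    then show ?thesis
      using multiples_mem_iff[OF oplus_betaZ[OF u(1) v(1)] \<open>n \<noteq> 0\<close>]
        zrem_0_iff[OF oplus_betaZ[OF u(1) v(1)] \<open>n \<noteq> 0\<close>] by (simp add: Dset_def)
  qed
  then show "oplus u v \<in> Zset star w"
    using tdvd_iff_Dset_subset[OF sd oplus_betaZ[OF u(1) v(1)]] oplus_betaZ[OF u(1) v(1)]
    by (auto simp: Zset_def)
qed

lemma remainders_eq_iff:
  "(\<forall>n\<ge>1. remainder_uf u n = remainder_uf u' n) \<longleftrightarrow> (\<forall>d. d \<noteq> 0 \<longrightarrow> zrem u d = zrem u' d)"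
proof
  assume R: "\<forall>d. d \<noteq> 0 \<longrightarrow> zrem u d = zrem u' d"
  show "\<forall>n\<ge>1. remainder_uf u n = remainder_uf u' n"
  proof (intro allI impI)
    fix n :: nat assume "n \<ge> 1"
    then show "remainder_uf u n = remainder_uf u' n"
      using R[rule_format, of "int n"] by (simp add: zrem_def)
  qed
qed (simp add: zrem_def)

text \<open>One direction tests divisibility by principal ultrafilters. The other uses that an
  upward closed set in a nonzero ultrafilter contains all multiples of some nonzero integer.\<close>

lemma MAX_uf_iff: "v \<in> MAX_uf star \<longleftrightarrow> v \<in> betaZ \<and> (\<forall>n. n \<noteq> 0 \<longrightarrow> zrem v n = 0)"
proof (intro iffI conjI allI impI)
  assume "v \<in> MAX_uf star"
  then have v: "v \<in> betaZ" and M: "\<And>u. u \<in> betaZ - {principal_uf 0} \<Longrightarrow> tdvd star u v"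
    by (auto simp: MAX_uf_def)
  show "v \<in> betaZ" by (rule v)
  fix n :: int assume n: "n \<noteq> 0"
  have "principal_uf n \<noteq> principal_uf 0"
    using n mem_principal_uf[of "{0}" n] mem_principal_uf[of "{0}" 0] by auto
  then have "tdvd star (principal_uf n) v" using M principal_uf_betaZ by blast
  moreover have "multiples n \<in> principal_uf n" by (simp add: mem_principal_uf multiples_eq)
  moreover have "\<forall>x\<in>multiples n. \<forall>y. x dvd y \<longrightarrow> y \<in> multiples n"
    unfolding multiples_eq by (blast intro: dvd_trans)
  ultimately have "multiples n \<in> v" unfolding tdvd_iff[OF principal_uf_betaZ v] by blast
  then show "zrem v n = 0" using multiples_mem_iff[OF v n] by simp
next
  assume R: "v \<in> betaZ \<and> (\<forall>n. n \<noteq> 0 \<longrightarrow> zrem v n = 0)"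
  then have v: "v \<in> betaZ" by blast
  have "tdvd star u v" if u: "u \<in> betaZ" "u \<noteq> principal_uf 0" for u
    unfolding tdvd_iff[OF u(1) v]
  proof (intro ballI impI)
    fix A assume A: "A \<in> u" and up: "\<forall>x\<in>A. \<forall>y. x dvd y \<longrightarrow> y \<in> A"
    have "A \<inter> {d. d \<noteq> 0} \<in> u"
      using A not_0_mem[OF u] by (simp add: uf_Int[OF betaZ_ultrafilter[OF u(1)]])
    then obtain n where n: "n \<in> A" "n \<noteq> 0" using uf_nonempty[OF betaZ_ultrafilter[OF u(1)]] by blast
    then have "multiples n \<in> v" using R multiples_mem_iff[OF v] by blast
    then show "A \<in> v"
      by (rule uf_mono[OF betaZ_ultrafilter[OF v]]) (use n up in \<open>auto simp: multiples_eq\<close>)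
  qed
  then show "v \<in> MAX_uf star" using v by (simp add: MAX_uf_def)
qed

abbreviation tdvd_by_remainders :: bool where
  "tdvd_by_remainders \<equiv> \<forall>u \<in> betaZ. \<forall>u' \<in> betaZ.
    (\<forall>n \<ge> 1. remainder_uf u n = remainder_uf u' n) \<longrightarrow> (tdvd star w u \<longleftrightarrow> tdvd star w u')"

abbreviation MAX_cancellable :: bool where
  "MAX_cancellable \<equiv> \<forall>u \<in> betaZ. \<forall>t \<in> betaZ. \<forall>v \<in> MAX_uf star.
    oplus (oplus u v) t \<in> Zset star w \<longrightarrow> oplus u t \<in> Zset star w"

lemma Zset_eq_preimage_iff: "Zset star w = {u \<in> betaZ. pi_uf u \<in> pi_uf ` Zset star w} \<longleftrightarrow> tdvd_by_remainders"
proof -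
  have pi: "pi_uf u = pi_uf u' \<longleftrightarrow> (\<forall>n\<ge>1. remainder_uf u n = remainder_uf u' n)" for u u'
    unfolding pi_uf_def by (auto simp: fun_eq_iff restrict_def)
  show ?thesis unfolding pi[symmetric] Zset_def by (auto simp: set_eq_iff image_iff) metis+
qed

lemma tdvd_by_remainders_if_self_divisible:
  assumes sd: "self_divisible w"
  shows tdvd_by_remainders
  unfolding remainders_eq_iff
proof (intro ballI impI)
  fix u u' assume u: "u \<in> betaZ" "u' \<in> betaZ" and R: "\<forall>d. d \<noteq> 0 \<longrightarrow> zrem u d = zrem u' d"
  have "n \<in> Dset u \<longleftrightarrow> n \<in> Dset u'" if "n \<in> Dset w" for n
    using that R multiples_mem_iff[OF u(1), of n] multiples_mem_iff[OF u(2), of n]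
    unfolding Dset_eq[OF w w0] by (auto simp: Dset_def)
  then show "tdvd star w u \<longleftrightarrow> tdvd star w u'"
    using tdvd_iff_Dset_subset[OF sd u(1)] tdvd_iff_Dset_subset[OF sd u(2)] by blast
qed

text \<open>All remainders of \<open>v\<close> vanish, so dropping it from the sum preserves every
  remainder.\<close>

lemma MAX_cancellable_if_tdvd_by_remainders:
  assumes tdvd_by_remainders
  shows MAX_cancellable
proof (intro ballI impI)
  fix u t v assume u: "u \<in> betaZ" and t: "t \<in> betaZ" and "v \<in> MAX_uf star"
    and Z: "oplus (oplus u v) t \<in> Zset star w"
  then have v: "v \<in> betaZ" and v0: "\<And>n. n \<noteq> 0 \<Longrightarrow> zrem v n = 0" by (auto simp: MAX_uf_iff)
  have eq: "zrem (oplus (oplus u v) t) d = zrem (oplus u t) d" if d: "d \<noteq> 0" for d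
  proof (rule zrem_eqI[OF _ _ d])
    show "oplus (oplus u v) t \<in> betaZ" "oplus u t \<in> betaZ" by (simp_all add: oplus_betaZ u v t)
    have "[zrem (oplus (oplus u v) t) d = zrem (oplus u v) d + zrem t d] (mod d)"
      by (rule zrem_oplus[OF oplus_betaZ[OF u v] t d])
    also have "[zrem (oplus u v) d + zrem t d = zrem u d + zrem v d + zrem t d] (mod d)"
      by (rule cong_add[OF zrem_oplus[OF u v d] cong_refl])
    also have "[zrem u d + zrem v d + zrem t d = zrem (oplus u t) d] (mod d)"
      using zrem_oplus[OF u t d] v0[OF d] by (simp add: cong_sym_eq)
    finally show "[zrem (oplus (oplus u v) t) d = zrem (oplus u t) d] (mod d)" .
  qed
  have "tdvd star w (oplus (oplus u v) t) \<longleftrightarrow> tdvd star w (oplus u t)"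
    by (rule assms[unfolded remainders_eq_iff, THEN bspec, THEN bspec, THEN mp])
      (simp_all add: oplus_betaZ u v t eq)
  then show "oplus u t \<in> Zset star w" using Z oplus_betaZ[OF u t] by (simp add: Zset_def)
qed

lemma MAX_uf_subset_Zset: "MAX_uf star \<subseteq> Zset star w"
  using w w0 by (auto simp: MAX_uf_def Zset_def)

text \<open>If \<open>u\<close> and \<open>z\<close> have the same remainders, then \<open>- u + z\<close> and \<open>u - u\<close> belong to \<open>MAX\<close>, and
  \<open>u + (- u + z) = (u - u) + z\<close>.\<close>
lemma tdvd_by_remainders_if_MAX_cancellable:
  assumes cl: "closed_under_oplus (Zset star w)" and MAX_cancellable
  shows tdvd_by_remainders
proof -
  have "tdvd star w u"
    if u: "u \<in> betaZ" and z: "z \<in> betaZ" and eq: "\<And>d. d \<noteq> 0 \<Longrightarrow> zrem u d = zrem z d"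
      and zw: "tdvd star w z" for u z
  proof -
    define u' where "u' = scale_uf (- 1) u"
    have u': "u' \<in> betaZ" unfolding u'_def by (rule scale_uf_betaZ[OF u])
    have rem_u': "[zrem u' d = - zrem u d] (mod d)" if "d \<noteq> 0" for d
      unfolding u'_def using zrem_scale[OF u that, of "- 1"] by simp
    have "zrem (oplus u u') d = 0 \<and> zrem (oplus u' z) d = 0" if d: "d \<noteq> 0" for d
    proof -
      have "[zrem (oplus u u') d = zrem u d + - zrem u d] (mod d)"
        by (rule cong_trans[OF zrem_oplus[OF u u' d] cong_add[OF cong_refl rem_u'[OF d]]])
      moreover have "[zrem (oplus u' z) d = - zrem u d + zrem z d] (mod d)"
        by (rule cong_trans[OF zrem_oplus[OF u' z d] cong_add[OF rem_u'[OF d] cong_refl]])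
      ultimately show ?thesis
        using zrem_0_iff[OF oplus_betaZ[OF u u'] d] zrem_0_iff[OF oplus_betaZ[OF u' z] d] eq[OF d]
        by (simp add: cong_iff_dvd_diff)
    qed
    then have M: "oplus u u' \<in> MAX_uf star" "oplus u' z \<in> MAX_uf star"
      by (simp_all add: MAX_uf_iff oplus_betaZ u u' z)
    have "oplus (oplus u u') z \<in> Zset star w"
      using cl M(1) MAX_uf_subset_Zset z zw unfolding closed_under_oplus_def by (auto simp: Zset_def)
    \<comment> \<open>Cancellation applies to a middle summand, so a right summand \<open>0\<close>
      is appended.\<close>
    then have "oplus (oplus u (oplus u' z)) (principal_uf 0) \<in> Zset star w"
      by (simp add: oplus_assoc oplus_0_right oplus_betaZ u u' z)
    then have "oplus u (principal_uf 0) \<in> Zset star w"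
      using assms(2) u M(2) principal_uf_betaZ by blast
    then show ?thesis by (simp add: oplus_0_right u Zset_def)
  qed
  note * = this
  show ?thesis unfolding remainders_eq_iff
  proof (intro ballI impI iffI)
    fix u u' assume u: "u \<in> betaZ" "u' \<in> betaZ" and R: "\<forall>d. d \<noteq> 0 \<longrightarrow> zrem u d = zrem u' d"
    show "tdvd star w u'" if "tdvd star w u" using *[OF u(2,1) _ that] R by simp
    show "tdvd star w u" if "tdvd star w u'" using *[OF u _ that] R by simp
  qed
qed

lemma oplus_pow_Zset:
  assumes "closed_under_oplus (Zset star w)"
  shows "oplus_pow w (Suc k) \<in> Zset star w"
proof (induction k)
  case 0
  then show ?case using tdvd_refl w by (simp add: oplus_0_left Zset_def)
next
  case (Suc k)
  then show ?case
    using assms tdvd_refl w unfolding closed_under_oplus_def oplus_pow.simps(2)[of w "Suc k"]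
    by (auto simp: Zset_def)
qed

text \<open>The multiples of \<open>w\<close> are dense, in the profinite topology, in the set of all \<open>u\<close> that are
  divisible by every element of \<open>Dset w\<close>.\<close>
lemma oplus_pow_approx:
  assumes u: "u \<in> betaZ" and D: "Dset w \<subseteq> Dset u" and n: "n \<noteq> 0"
  shows "\<exists>k. zrem (oplus_pow w (Suc k)) n = zrem u n"
proof -
  let ?r = "zrem w n" and ?c = "gcd (zrem w n) n"
  have c0: "?c \<noteq> 0" using n by simp
  have "zrem w ?c = 0" using zrem_0_dvd[OF w, of ?c n] n by simp
  then have "?c \<in> Dset w" using c0 by (simp add: Dset_eq[OF w w0])
  then have "zrem u ?c = 0" using D multiples_mem_iff[OF u c0] by (auto simp: Dset_def)
  then have "?c dvd zrem u n" using zrem_0_dvd[OF u, of ?c n] n by simp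
  then obtain x where x: "[?r * x = zrem u n] (mod n)" using cong_solve_dvd_int by blast
  \<comment> \<open>Adding the absolute value of \<open>n\<close> makes the solution positive, so
    that it is of the form \<open>Suc k\<close>.\<close>
  define k where "k = nat (x mod \<bar>n\<bar> + \<bar>n\<bar> - 1)"
  have "x mod \<bar>n\<bar> \<ge> 0" using n by simp
  then have k: "int (Suc k) = x mod \<bar>n\<bar> + \<bar>n\<bar>" using n unfolding k_def by linarith
  have "n dvd x - x mod \<bar>n\<bar>" by (metis abs_dvd_iff dvd_minus_mod)
  then have "n dvd (x - x mod \<bar>n\<bar>) - \<bar>n\<bar>" by (rule dvd_diff) simp
  then have "[x = int (Suc k)] (mod n)"
    unfolding k cong_iff_dvd_diff by (simp only: diff_diff_eq)
  then have "[int (Suc k) * ?r = zrem u n] (mod n)"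
    using x by (metis cong_scalar_right cong_sym cong_trans mult.commute)
  then have "[zrem (oplus_pow w (Suc k)) n = zrem u n] (mod n)"
    using zrem_oplus_pow[OF w n, of "Suc k"] by (rule cong_trans[rotated])
  then have "zrem (oplus_pow w (Suc k)) n = zrem u n"
    by (rule zrem_eqI[OF oplus_pow_betaZ[OF w] u n])
  then show ?thesis ..
qed

lemma self_divisible_if_tdvd_by_remainders:
  assumes cl: "closed_under_oplus (Zset star w)" and tdvd_by_remainders
  shows "self_divisible w"
proof (rule ccontr)
  assume nsd: "\<not> self_divisible w"
  \<comment> \<open>Closure of \<open>Dset w\<close> under lcm gives directedness; \<open>n\<close>
    itself witnesses nonemptiness.\<close>
  have "\<exists>u\<in>betaZ. \<forall>n\<in>Dset w. Dset w \<inter> multiples n \<in> u"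
  proof (rule directed_ultrafilter)
    show "Dset w \<noteq> {}" using one_mem_Dset[OF w w0] by blast
    show "Dset w \<inter> multiples n \<noteq> {}" if "n \<in> Dset w" for n
      using that by (auto simp: multiples_eq)
    show "\<exists>k\<in>Dset w. Dset w \<inter> multiples k \<subseteq> (Dset w \<inter> multiples n) \<inter> (Dset w \<inter> multiples m)"
      if "n \<in> Dset w" "m \<in> Dset w" for n m
      using Dset_lcm[OF w w0 that] by (intro bexI[of _ "lcm n m"]) (auto simp: multiples_eq)
  qed
  then obtain u where u: "u \<in> betaZ" and Du: "\<forall>n\<in>Dset w. Dset w \<inter> multiples n \<in> u" by blast
  note ufu = betaZ_ultrafilter[OF u]
  have D: "Dset w \<subseteq> Dset u" using Du by (auto simp: Dset_def uf_Int[OF ufu])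
  have DU: "Dset w \<in> u" using Du one_mem_Dset[OF w w0] by (auto simp: uf_Int[OF ufu])
  let ?up = "\<lambda>A. \<forall>x\<in>A. \<forall>y::int. x dvd y \<longrightarrow> y \<in> A"
  \<comment> \<open>The two demands on \<open>z\<close> are paired: every upward closed set of
    \<open>w\<close>, for divisibility by \<open>w\<close>, and every residue class of
    \<open>u\<close>, for equal remainders.\<close>
  let ?I = "{A \<in> w. ?up A} \<times> {n::int. n \<noteq> 0}"
  let ?C = "\<lambda>(A, n). A \<inter> {x. [x = zrem u n] (mod n)}"
  have "\<exists>z\<in>betaZ. \<forall>i\<in>?I. ?C i \<in> z"
  proof (rule directed_ultrafilter)
    have "(UNIV, 1) \<in> ?I" using uf_UNIV[OF uf_w] by simp
    then show "?I \<noteq> {}" by (rule ex_in_conv[THEN iffD1, OF exI])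
    show "?C i \<noteq> {}" if i: "i \<in> ?I" for i
    proof -
      obtain A n where An: "i = (A, n)" "A \<in> w" "?up A" "n \<noteq> 0" using i by blast
      \<comment> \<open>A positive multiple of \<open>w\<close> meets one pair of demands: it is in
        the additively closed \<open>Zset star w\<close>, and it can be given the remainder of
        \<open>u\<close> modulo \<open>n\<close>.\<close>
      obtain k where k: "zrem (oplus_pow w (Suc k)) n = zrem u n"
        using oplus_pow_approx[OF u D \<open>n \<noteq> 0\<close>] by blast
      let ?v = "oplus_pow w (Suc k)"
      have v: "?v \<in> betaZ" by (rule oplus_pow_betaZ[OF w])
      have "tdvd star w ?v" using oplus_pow_Zset[OF cl, of k] by (simp add: Zset_def)
      then have "A \<in> ?v" using An unfolding tdvd_iff[OF w v] by blast
      moreover have "{x. [x = zrem u n] (mod n)} \<in> ?v" using zrem(3)[OF v \<open>n \<noteq> 0\<close>] k by simp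
      ultimately have "A \<inter> {x. [x = zrem u n] (mod n)} \<in> ?v"
        using uf_Int[OF betaZ_ultrafilter[OF v]] by blast
      then show ?thesis using uf_nonempty[OF betaZ_ultrafilter[OF v]] An(1) by auto
    qed
    show "\<exists>k\<in>?I. ?C k \<subseteq> ?C i \<inter> ?C j" if ij: "i \<in> ?I" "j \<in> ?I" for i j
    proof -
      obtain A n B m where AB: "i = (A, n)" "A \<in> w" "?up A" "n \<noteq> 0" "j = (B, m)" "B \<in> w" "?up B" "m \<noteq> 0"
        using ij by blast
      have "A \<inter> B \<in> w" "lcm n m \<noteq> 0" using AB by (simp_all add: uf_Int[OF uf_w] lcm_eq_0_iff)
      moreover have "?up (A \<inter> B)" using AB(3,7) by blast
      ultimately have k: "(A \<inter> B, lcm n m) \<in> ?I" by blast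
      have cg: "[x = zrem u l] (mod l)" if "[x = zrem u (lcm n m)] (mod (lcm n m))" "l dvd lcm n m" for x l
        using cong_dvd_modulus[OF that] zrem_dvd[OF u that(2)] AB(4,8) cong_trans lcm_eq_0_iff by blast
      have "?C (A \<inter> B, lcm n m) \<subseteq> ?C i \<inter> ?C j"
        unfolding AB(1,5) using cg[of _ n] cg[of _ m] by auto
      then show ?thesis using k by blast
    qed
  qed
  then obtain z where z: "z \<in> betaZ" and zC: "\<And>i. i \<in> ?I \<Longrightarrow> ?C i \<in> z" by blast
  note ufz = betaZ_ultrafilter[OF z]
  have "zrem z d = zrem u d" if d: "d \<noteq> 0" for d
  proof -
    have "?C (UNIV, d) \<in> z" by (rule zC) (use d uf_UNIV[OF uf_w] in auto)
    then have "[zrem z d = zrem u d] (mod d)" using mem_cong_iff[OF z d] by simp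
    then show ?thesis by (rule zrem_eqI[OF z u d])
  qed
  moreover have "tdvd star w z"
    unfolding tdvd_iff[OF w z]
  proof (intro ballI impI)
    fix A assume "A \<in> w" and "?up A"
    then have "?C (A, 1) \<in> z" by (intro zC) auto
    then show "A \<in> z" by (simp add: uf_Int[OF ufz])
  qed
  ultimately have "tdvd star w u" using assms(2) z u unfolding remainders_eq_iff by metis
  moreover have "- Dset w \<in> w" using nsd by (simp add: self_divisible_def uf_Compl[OF uf_w])
  moreover have "?up (- Dset w)" using Dset_dvd[OF w w0] by blast
  ultimately have "- Dset w \<in> u" unfolding tdvd_iff[OF w u] by blast
  then show False using DU by (simp add: uf_Compl[OF ufu])
qed

end

section \<open>Profinite groups\<close>

text \<open>In a compact Hausdorff space quasi-components coincide with components, which are points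
  here.\<close>

lemma clopen_separation:
  assumes "stone_space T" and "x \<in> topspace T" and "y \<in> topspace T" and "x \<noteq> y"
  shows "\<exists>C. closedin T C \<and> openin T C \<and> x \<in> C \<and> y \<notin> C"
proof -
  have "compact_space T" "Hausdorff_space T" "totally_disconnected_space T"
    using assms(1) by (auto simp: stone_space_def)
  then have "quasi_component_of T x = connected_component_of T x"
    by (intro quasi_eq_connected_component_of) blast
  moreover have "\<not> connected_component_of T x y"
    using \<open>totally_disconnected_space T\<close> assms(4)
    unfolding connected_component_of_def totally_disconnected_space_def by (metis insert_iff empty_iff subsetD)
  ultimately have "\<not> quasi_component_of T x y" by simp
  then show ?thesis using assms(2,3) by (auto simp: quasi_component_of)
qed

locale compact_group = group G for G (structure) +
  fixes T :: "'a topology"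
  assumes topspace_T: "topspace T = carrier G"
    and compact_T: "compact_space T"
    and continuous_mult: "continuous_map (prod_topology T T) T (\<lambda>(x, y). x \<otimes> y)"
    and continuous_inv: "continuous_map T T (\<lambda>x. inv x)"
begin

text \<open>The complement is the projection, along a compact factor, of the closed set of pairs
  with \<open>c\<close> in \<open>C\<close> and \<open>g \<otimes> c\<close> outside
  \<open>C\<close>.\<close>

lemma openin_translates_in:
  assumes "closedin T C" and "openin T C"
  shows "openin T {g \<in> carrier G. \<forall>c\<in>C. g \<otimes> c \<in> C}"
proof -
  let ?K = "{z \<in> topspace (prod_topology T T). snd z \<in> C} \<inter>
    {z \<in> topspace (prod_topology T T). (case z of (x, y) \<Rightarrow> x \<otimes> y) \<in> topspace T - C}"
  have "closedin (prod_topology T T) ?K"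
    by (intro closedin_Int closedin_continuous_map_preimage[OF continuous_map_snd]
        closedin_continuous_map_preimage[OF continuous_mult] assms(1) closedin_diff closedin_topspace assms(2))
  then have "closedin T (fst ` ?K)"
    using closed_map_fst[OF compact_T, of T] unfolding closed_map_def by blast
  then have "openin T (topspace T - fst ` ?K)" by blast
  moreover have "topspace T - fst ` ?K = {g \<in> carrier G. \<forall>c\<in>C. g \<otimes> c \<in> C}"
    using closedin_subset[OF assms(1)] by (force simp: topspace_T image_iff)
  ultimately show ?thesis by simp
qed

text \<open>The elements carrying \<open>C\<close> into itself by left translation form an open
  monoid, contained in \<open>C\<close> because \<open>\<one>\<close> is in \<open>C\<close>. Those
  whose inverse also belongs to it form the subgroup.\<close>

lemma open_subgroup_avoiding:
  assumes C: "closedin T C" "openin T C" "\<one> \<in> C" "x \<notin> C" and x: "x \<in> carrier G"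
  shows "\<exists>U. subgroup U G \<and> openin T U \<and> x \<notin> U"
proof -
  let ?V = "{g \<in> carrier G. \<forall>c\<in>C. g \<otimes> c \<in> C}"
  let ?U = "?V \<inter> {g \<in> topspace T. inv g \<in> ?V}"
  have CG: "C \<subseteq> carrier G" using closedin_subset[OF C(1)] by (simp add: topspace_T)
  have V_mult: "g \<otimes> h \<in> ?V" if "g \<in> ?V" "h \<in> ?V" for g h
    using that CG by (auto simp: m_assoc subset_iff)
  have "openin T ?U"
    by (intro openin_Int openin_translates_in[OF C(1,2)]
        openin_continuous_map_preimage[OF continuous_inv])
  moreover have "x \<notin> ?U" using C(3,4) x by (force dest: bspec[of C _ \<one>])
  moreover have "subgroup ?U G"
  proof (rule subgroupI)
    show "?U \<subseteq> carrier G" by blast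
    have "\<one> \<in> ?U" using CG by (auto simp: topspace_T)
    then show "?U \<noteq> {}" by blast
    show "inv g \<in> ?U" if "g \<in> ?U" for g
      using that by (auto simp: topspace_T)
    show "g \<otimes> h \<in> ?U" if "g \<in> ?U" "h \<in> ?U" for g h
    proof -
      have g: "g \<in> ?V" "inv g \<in> ?V" and h: "h \<in> ?V" "inv h \<in> ?V" using that by auto
      then have "inv (g \<otimes> h) = inv h \<otimes> inv g" by (simp add: inv_mult_group)
      then show ?thesis using V_mult[OF g(1) h(1)] V_mult[OF h(2) g(2)] g(1) h(1)
        by (simp add: topspace_T)
    qed
  qed
  ultimately show ?thesis by blast
qed

text \<open>The cosets are disjoint open sets covering a compact space, so a finite subcover already
  contains all of them.\<close>

lemma finite_rcosets_open:
  assumes U: "subgroup U G" and "openin T U"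
  shows "finite (rcosets U)"
proof -
  \<comment> \<open>The coset is the preimage of \<open>U\<close> under right translation by
    \<open>inv a\<close>.\<close>
  have "openin T (U #> a)" if a: "a \<in> carrier G" for a
  proof -
    have "continuous_map T (prod_topology T T) (\<lambda>h. (h, inv a))"
      using a by (intro continuous_map_pairedI) (auto simp: topspace_T)
    then have "continuous_map T T ((\<lambda>(x, y). x \<otimes> y) \<circ> (\<lambda>h. (h, inv a)))"
      by (rule continuous_map_compose[OF _ continuous_mult])
    then have "openin T {h \<in> topspace T. ((\<lambda>(x, y). x \<otimes> y) \<circ> (\<lambda>h. (h, inv a))) h \<in> U}"
      by (rule openin_continuous_map_preimage[OF _ assms(2)])
    moreover have "{h \<in> topspace T. ((\<lambda>(x, y). x \<otimes> y) \<circ> (\<lambda>h. (h, inv a))) h \<in> U} = U #> a"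
    proof (intro equalityI subsetI)
      fix h assume "h \<in> {h \<in> topspace T. ((\<lambda>(x, y). x \<otimes> y) \<circ> (\<lambda>h. (h, inv a))) h \<in> U}"
      then have "h \<in> carrier G" "h \<otimes> inv a \<in> U" by (auto simp: topspace_T)
      then show "h \<in> U #> a"
        unfolding r_coset_def using a by (intro UN_I[of "h \<otimes> inv a"]) (auto simp: m_assoc)
    next
      fix h assume "h \<in> U #> a"
      then obtain v where v: "v \<in> U" "h = v \<otimes> a" unfolding r_coset_def by blast
      moreover have "v \<in> carrier G" using v(1) subgroup.subset[OF U] by blast
      ultimately show "h \<in> {h \<in> topspace T. ((\<lambda>(x, y). x \<otimes> y) \<circ> (\<lambda>h. (h, inv a))) h \<in> U}"
        using a by (simp add: topspace_T m_assoc)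
    qed
    ultimately show ?thesis by simp
  qed
  then have op: "\<And>K. K \<in> rcosets U \<Longrightarrow> openin T K" by (auto simp: RCOSETS_def)
  have part: "\<Union>(rcosets U) = topspace T" using rcosets_part_G[OF U] by (simp add: topspace_T)
  have "\<exists>\<F>. finite \<F> \<and> \<F> \<subseteq> rcosets U \<and> topspace T \<subseteq> \<Union>\<F>"
    by (rule compact_T[unfolded compact_space_alt, THEN spec, THEN mp]) (simp add: op part)
  then obtain \<F> where F: "finite \<F>" "\<F> \<subseteq> rcosets U" "topspace T \<subseteq> \<Union>\<F>" by (elim exE conjE)
  have "K \<in> \<F>" if K: "K \<in> rcosets U" for K
  proof -
    obtain a where a: "a \<in> carrier G" "K = U #> a" using K by (auto simp: RCOSETS_def)
    then have aK: "a \<in> K" using rcos_self[OF _ U] by simp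
    then obtain L where L: "L \<in> \<F>" "a \<in> L" using F(3) a(1) by (auto simp: topspace_T)
    then have "L = K"
      using rcos_disjoint[OF U] F(2) K aK unfolding pairwise_def disjnt_iff by blast
    then show ?thesis using L(1) by simp
  qed
  then show ?thesis using F(1) finite_subset[of "rcosets U" \<F>] by blast
qed

end

text \<open>A nontrivial \<open>x\<close> is avoided by an open subgroup \<open>U\<close>, which is
  normal by commutativity and has finite index. As \<open>x\<close> is a power with this index as
  exponent, it is trivial modulo \<open>U\<close>, a contradiction.\<close>

lemma profinite_group_divisible_trivial:
  assumes G: "comm_group G" and prof: "profinite_group G T"
    and x: "x \<in> carrier G" and div: "\<And>n::nat. n > 0 \<Longrightarrow> \<exists>y\<in>carrier G. x = y [^]\<^bsub>G\<^esub> n"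
  shows "x = \<one>\<^bsub>G\<^esub>"
proof (rule ccontr)
  assume ne: "x \<noteq> \<one>\<^bsub>G\<^esub>"
  interpret comm_group G by (rule G)
  interpret compact_group G T
    using prof by unfold_locales (auto simp: profinite_group_def topological_group_on_def stone_space_def)
  obtain C where "closedin T C" "openin T C" "\<one>\<^bsub>G\<^esub> \<in> C" "x \<notin> C"
    using clopen_separation[of T "\<one>\<^bsub>G\<^esub>" x] prof x ne by (auto simp: profinite_group_def topspace_T)
  then obtain U where U: "subgroup U G" "openin T U" "x \<notin> U"
    using open_subgroup_avoiding x by blast
  interpret U: normal U G by (rule subgroup_imp_normal[OF U(1)])
  interpret Q: group "G Mod U" by (rule U.factorgroup_is_group)
  interpret h: group_hom G "G Mod U" "\<lambda>a. U #>\<^bsub>G\<^esub> a"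
    by unfold_locales (rule U.r_coset_hom_Mod)
  have fin: "finite (carrier (G Mod U))"
    using finite_rcosets_open[OF U(1,2)] by (simp add: FactGroup_def)
  have "order (G Mod U) > 0" using fin Q.order_gt_0_iff_finite by blast
  then obtain y where y: "y \<in> carrier G" "x = y [^]\<^bsub>G\<^esub> order (G Mod U)" using div by blast
  then have "U #>\<^bsub>G\<^esub> x = (U #>\<^bsub>G\<^esub> y) [^]\<^bsub>G Mod U\<^esub> order (G Mod U)"
    using h.hom_nat_pow by blast
  also have "\<dots> = \<one>\<^bsub>G Mod U\<^esub>"
    by (rule Q.pow_order_eq_1) (use y(1) h.hom_closed in blast)
  finally have "U #>\<^bsub>G\<^esub> x = U" by (simp add: FactGroup_def)
  then show False using coset_join1[OF _ x U(1)] U(3) by blast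
qed

section \<open>The quotient group\<close>

lemma zrem_mod: "u \<in> betaZ \<Longrightarrow> d \<noteq> 0 \<Longrightarrow> zrem u d mod \<bar>d\<bar> = zrem u d"
  using zrem[of u d] by simp

lemma zrem_eq_modI:
  assumes u: "u \<in> betaZ" and d: "d \<noteq> 0" and "[zrem u d = r] (mod d)"
  shows "zrem u d = r mod \<bar>d\<bar>"
proof -
  have "[zrem u d = r] (mod \<bar>d\<bar>)" using assms(3) by (simp add: cong_iff_dvd_diff)
  then show ?thesis using zrem_mod[OF u d] by (simp add: cong_def)
qed

lemma zrem_oplus_eq:
  "u \<in> betaZ \<Longrightarrow> v \<in> betaZ \<Longrightarrow> d \<noteq> 0 \<Longrightarrow> zrem (oplus u v) d = (zrem u d + zrem v d) mod \<bar>d\<bar>"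
  by (intro zrem_eq_modI oplus_betaZ zrem_oplus)

lemma zrem_uminus_eq:
  "u \<in> betaZ \<Longrightarrow> d \<noteq> 0 \<Longrightarrow> zrem (scale_uf (- 1) u) d = - zrem u d mod \<bar>d\<bar>"
  using zrem_scale[of u d "- 1"] by (intro zrem_eq_modI scale_uf_betaZ) auto

context nonzero_ultrafilter
begin

lemma scong_if_zrem_eq:
  assumes "u \<in> betaZ" and "v \<in> betaZ" and "\<And>d. d \<noteq> 0 \<Longrightarrow> zrem u d = zrem v d"
  shows "scong star w u v"
  unfolding scong_iff[OF w w0 assms(1,2)]
  by (rule uf_mp[OF uf_w not_0_mem[OF w w0]]) (simp add: assms(3))

lemma scong_refl: "u \<in> betaZ \<Longrightarrow> scong star w u u"
  by (intro scong_if_zrem_eq) auto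

lemma scong_sym:
  assumes "u \<in> betaZ" and "v \<in> betaZ" and "scong star w u v"
  shows "scong star w v u"
  using assms(3) unfolding scong_iff[OF w w0 assms(1,2)] scong_iff[OF w w0 assms(2,1)]
  by (rule uf_mp[OF uf_w]) simp

lemma scong_trans:
  assumes u: "u \<in> betaZ" and v: "v \<in> betaZ" and t: "t \<in> betaZ"
    and "scong star w u v" and "scong star w v t"
  shows "scong star w u t"
proof -
  have "{d. d \<noteq> 0 \<and> zrem u d = zrem v d} \<inter> {d. d \<noteq> 0 \<and> zrem v d = zrem t d} \<in> w"
    using assms(4,5) unfolding scong_iff[OF w w0 u v] scong_iff[OF w w0 v t] uf_Int[OF uf_w] by blast
  then show ?thesis unfolding scong_iff[OF w w0 u t] by (rule uf_mp[OF uf_w]) simp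
qed

lemma scong_oplus:
  assumes u: "u \<in> betaZ" "u' \<in> betaZ" and v: "v \<in> betaZ" "v' \<in> betaZ"
    and "scong star w u u'" and "scong star w v v'"
  shows "scong star w (oplus u v) (oplus u' v')"
proof -
  have "{d. d \<noteq> 0 \<and> zrem u d = zrem u' d} \<inter> {d. d \<noteq> 0 \<and> zrem v d = zrem v' d} \<in> w"
    using assms(5,6) unfolding scong_iff[OF w w0 u] scong_iff[OF w w0 v] uf_Int[OF uf_w] by blast
  then show ?thesis
    unfolding scong_iff[OF w w0 oplus_betaZ[OF u(1) v(1)] oplus_betaZ[OF u(2) v(2)]]
    by (rule uf_mp[OF uf_w]) (simp add: zrem_oplus_eq u v)
qed

abbreviation cls where "cls \<equiv> scong_class star w"
abbreviation quot where "quot \<equiv> scong_quotient star w"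

lemma mem_cls: "v \<in> cls u \<longleftrightarrow> u \<in> betaZ \<and> v \<in> betaZ \<and> scong star w u v"
  by (simp add: scong_class_def scong_rel_def)

lemma self_mem_cls: "u \<in> betaZ \<Longrightarrow> u \<in> cls u"
  by (simp add: mem_cls scong_refl)

lemma cls_eq_iff:
  assumes u: "u \<in> betaZ" and v: "v \<in> betaZ"
  shows "cls u = cls v \<longleftrightarrow> scong star w u v"
proof
  assume "cls u = cls v"
  then show "scong star w u v" using self_mem_cls[OF v] mem_cls[of v u] by simp
next
  assume uv: "scong star w u v"
  have "x \<in> cls u \<longleftrightarrow> x \<in> cls v" if x: "x \<in> betaZ" for x
    unfolding mem_cls using u v x uv scong_trans[OF u v x uv] scong_trans[OF v u x scong_sym[OF u v uv]]
    by blast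
  then show "cls u = cls v" using mem_cls by blast
qed

lemma carrier_quot: "carrier quot = cls ` betaZ"
  unfolding scong_quotient_def quotient_def scong_class_def by auto

lemma one_quot: "\<one>\<^bsub>quot\<^esub> = cls (principal_uf 0)"
  by (simp add: scong_quotient_def)

lemma mult_quot:
  assumes u: "u \<in> betaZ" and v: "v \<in> betaZ"
  shows "cls u \<otimes>\<^bsub>quot\<^esub> cls v = cls (oplus u v)"
proof -
  have eq: "cls (oplus x y) = cls (oplus u v)" if "x \<in> cls u" "y \<in> cls v" for x y
  proof -
    have x: "x \<in> betaZ" "scong star w u x" and y: "y \<in> betaZ" "scong star w v y"
      using that by (auto simp: mem_cls)
    show ?thesis
      unfolding cls_eq_iff[OF oplus_betaZ[OF x(1) y(1)] oplus_betaZ[OF u v]]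
      by (rule scong_oplus[OF x(1) u y(1) v scong_sym[OF u x] scong_sym[OF v y]])
  qed
  have "(\<Union>x \<in> cls u. \<Union>y \<in> cls v. cls (oplus x y)) = (\<Union>x \<in> cls u. \<Union>y \<in> cls v. cls (oplus u v))"
    by (intro SUP_cong refl eq)
  also have "\<dots> = cls (oplus u v)"
    using self_mem_cls[OF u] self_mem_cls[OF v] by auto
  finally show ?thesis by (simp add: scong_quotient_def)
qed

text \<open>\<open>oplus\<close> is not commutative and \<open>- u\<close> is not an actual inverse,
  but the required identities hold for remainders, hence up to strong congruence.\<close>

lemma comm_group_quot: "comm_group quot"
proof (rule comm_groupI)
  have Q: "\<exists>u\<in>betaZ. X = cls u" if "X \<in> carrier quot" for X using that by (auto simp: carrier_quot)
  show "\<one>\<^bsub>quot\<^esub> \<in> carrier quot" by (simp add: one_quot carrier_quot principal_uf_betaZ)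
  fix X assume X: "X \<in> carrier quot"
  then obtain u where u: "u \<in> betaZ" "X = cls u" using Q by blast
  show "\<one>\<^bsub>quot\<^esub> \<otimes>\<^bsub>quot\<^esub> X = X"
    by (simp add: one_quot u mult_quot principal_uf_betaZ oplus_0_left)
  let ?u' = "scale_uf (- 1) u"
  have u': "?u' \<in> betaZ" by (rule scale_uf_betaZ[OF u(1)])
  have "scong star w (oplus ?u' u) (principal_uf 0)"
    by (intro scong_if_zrem_eq oplus_betaZ u u' principal_uf_betaZ)
      (simp add: zrem_oplus_eq u u' zrem_uminus_eq zrem_principal_0 mod_add_left_eq)
  then have "cls ?u' \<otimes>\<^bsub>quot\<^esub> X = \<one>\<^bsub>quot\<^esub>"
    by (simp add: u u' mult_quot one_quot cls_eq_iff oplus_betaZ principal_uf_betaZ)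
  then show "\<exists>Y\<in>carrier quot. Y \<otimes>\<^bsub>quot\<^esub> X = \<one>\<^bsub>quot\<^esub>" using u' by (auto simp: carrier_quot)
  fix Y assume "Y \<in> carrier quot"
  then obtain v where v: "v \<in> betaZ" "Y = cls v" using Q by blast
  show "X \<otimes>\<^bsub>quot\<^esub> Y \<in> carrier quot" by (simp add: u v mult_quot carrier_quot oplus_betaZ)
  show "X \<otimes>\<^bsub>quot\<^esub> Y = Y \<otimes>\<^bsub>quot\<^esub> X"
    by (simp add: u v mult_quot cls_eq_iff oplus_betaZ)
      (intro scong_if_zrem_eq oplus_betaZ u v, simp add: zrem_oplus_eq u v add.commute)
  fix Z assume "Z \<in> carrier quot"
  then obtain t where t: "t \<in> betaZ" "Z = cls t" using Q by blast
  show "X \<otimes>\<^bsub>quot\<^esub> Y \<otimes>\<^bsub>quot\<^esub> Z = X \<otimes>\<^bsub>quot\<^esub> (Y \<otimes>\<^bsub>quot\<^esub> Z)"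
    by (simp add: u v t mult_quot oplus_betaZ oplus_assoc)
qed

lemma inv_quot:
  assumes u: "u \<in> betaZ"
  shows "inv\<^bsub>quot\<^esub> cls u = cls (scale_uf (- 1) u)"
proof -
  interpret comm_group quot by (rule comm_group_quot)
  let ?u' = "scale_uf (- 1) u"
  have u': "?u' \<in> betaZ" by (rule scale_uf_betaZ[OF u])
  have "scong star w (oplus ?u' u) (principal_uf 0)"
    by (intro scong_if_zrem_eq oplus_betaZ u u' principal_uf_betaZ)
      (simp add: zrem_oplus_eq u u' zrem_uminus_eq zrem_principal_0 mod_add_left_eq)
  then have "cls ?u' \<otimes>\<^bsub>quot\<^esub> cls u = \<one>\<^bsub>quot\<^esub>"
    by (simp add: u u' mult_quot one_quot cls_eq_iff oplus_betaZ principal_uf_betaZ)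
  then show ?thesis by (intro inv_equality) (auto simp: carrier_quot u u')
qed

lemma pow_quot:
  assumes u: "u \<in> betaZ"
  shows "cls u [^]\<^bsub>quot\<^esub> n = cls (oplus_pow u n)"
proof -
  interpret comm_group quot by (rule comm_group_quot)
  show ?thesis
    by (induction n) (simp_all add: one_quot mult_quot oplus_pow_betaZ u)
qed

text \<open>The class of \<open>w\<close> is infinitely divisible, whatever \<open>w\<close> is.
  This is the common exit for the profinite and the product conditions.\<close>

lemma self_divisible_if_divisible_trivial:
  assumes "\<And>X. X \<in> carrier quot \<Longrightarrow> (\<And>n::nat. n > 0 \<Longrightarrow> \<exists>Y\<in>carrier quot. X = Y [^]\<^bsub>quot\<^esub> n) \<Longrightarrow>
    X = \<one>\<^bsub>quot\<^esub>"
  shows "self_divisible w"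
proof -
  have "cls w = \<one>\<^bsub>quot\<^esub>"
  proof (rule assms)
    show "cls w \<in> carrier quot" using w by (simp add: carrier_quot)
    fix n :: nat assume "n > 0"
    then obtain y where y: "y \<in> betaZ" "scong star w w (oplus_pow y n)"
      using scong_multiple_exists by blast
    then have "cls w = cls y [^]\<^bsub>quot\<^esub> n" by (simp add: pow_quot cls_eq_iff w oplus_pow_betaZ)
    then show "\<exists>Y\<in>carrier quot. cls w = Y [^]\<^bsub>quot\<^esub> n" using y(1) by (auto simp: carrier_quot)
  qed
  then show ?thesis
    unfolding self_divisible_iff_scong one_quot cls_eq_iff[OF w principal_uf_betaZ] .
qed

lemma self_divisible_if_profinite:
  assumes "profinite_group quot T"
  shows "self_divisible w"
  by (rule self_divisible_if_divisible_trivial)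
    (rule profinite_group_divisible_trivial[OF comm_group_quot assms])

text \<open>Each \<open>d\<close> in \<open>Dset w\<close> divides some modulus \<open>e\<close>
  where \<open>u\<close> and \<open>v\<close> agree, so they agree modulo \<open>d\<close>.
  Conversely, \<open>Dset w\<close> is itself a set in \<open>w\<close>.\<close>

lemma scong_iff_Dset:
  assumes sd: "self_divisible w" and u: "u \<in> betaZ" and v: "v \<in> betaZ"
  shows "scong star w u v \<longleftrightarrow> (\<forall>d\<in>Dset w. zrem u d = zrem v d)"
proof
  assume "scong star w u v"
  then have S: "{d. d \<noteq> 0 \<and> zrem u d = zrem v d} \<in> w" unfolding scong_iff[OF w w0 u v] .
  show "\<forall>d\<in>Dset w. zrem u d = zrem v d"
  proof
    fix d assume d: "d \<in> Dset w"
    then have d0: "d \<noteq> 0" by (simp add: Dset_eq[OF w w0])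
    have "{d. d \<noteq> 0 \<and> zrem u d = zrem v d} \<inter> multiples d \<in> w"
      using S d by (simp add: uf_Int[OF uf_w] Dset_def)
    then obtain e where e: "e \<noteq> 0" "zrem u e = zrem v e" "d dvd e"
      using uf_nonempty[OF uf_w] by (auto simp: multiples_eq)
    have "[zrem u d = zrem v d] (mod d)"
      using zrem_dvd[OF u e(3,1)] zrem_dvd[OF v e(3,1)] e(2) by (metis cong_sym cong_trans)
    then show "zrem u d = zrem v d" by (rule zrem_eqI[OF u v d0])
  qed
next
  assume R: "\<forall>d\<in>Dset w. zrem u d = zrem v d"
  have "Dset w \<in> w" using sd by (simp add: self_divisible_def)
  then show "scong star w u v"
    unfolding scong_iff[OF w w0 u v]
    by (rule uf_mp[OF uf_w]) (use R in \<open>simp add: Dset_eq[OF w w0]\<close>)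
qed


section \<open>The profinite completion\<close>

lemma pi_uf_eq_iff:
  "pi_uf u = pi_uf v \<longleftrightarrow> (\<forall>d. d \<noteq> 0 \<longrightarrow> zrem u d = zrem v d)"
  unfolding pi_uf_def remainders_eq_iff[symmetric] by (auto simp: fun_eq_iff restrict_def)

lemma pi_uf_apply: "n \<ge> 1 \<Longrightarrow> pi_uf u n = zrem u (int n)"
  by (simp add: pi_uf_def zrem_def)

lemma carrier_Zhat: "carrier Zhat = {x \<in> extensional {1..}. (\<forall>n\<ge>1. 0 \<le> x n \<and> x n < int n) \<and>
    (\<forall>m\<ge>1. \<forall>n\<ge>1. m dvd n \<longrightarrow> x n mod int m = x m)}"
  unfolding Zhat_def residue_limit_def
  by (auto simp: carrier_integer_mod_group PiE_def Pi_def)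

lemma pi_uf_Zhat:
  assumes u: "u \<in> betaZ"
  shows "pi_uf u \<in> carrier Zhat"
proof -
  have "zrem u (int n) mod int m = zrem u (int m)" if "m \<ge> 1" "n \<ge> 1" "m dvd n" for m n
  proof -
    have "[zrem u (int m) = zrem u (int n)] (mod int m)"
      using zrem_dvd[OF u, of "int m" "int n"] that by (simp add: cong_sym_eq)
    then show ?thesis using zrem_eq_modI[OF u, of "int m"] that(1) by simp
  qed
  moreover have "0 \<le> zrem u (int n) \<and> zrem u (int n) < int n" if "n \<ge> 1" for n
    using zrem[OF u, of "int n"] that by simp
  ultimately show ?thesis
    unfolding carrier_Zhat by (auto simp: pi_uf_apply) (simp add: pi_uf_def)
qed

text \<open>Coherence of \<open>x\<close> makes its residue classes directed: the class modulo an
  lcm refines both given classes.\<close>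

lemma pi_uf_surj:
  assumes x: "x \<in> carrier Zhat"
  shows "\<exists>u\<in>betaZ. pi_uf u = x"
proof -
  have xb: "0 \<le> x n" "x n < int n" if "n \<ge> 1" for n using x that by (auto simp: carrier_Zhat)
  have xd: "x n mod int m = x m" if "m \<ge> 1" "n \<ge> 1" "m dvd n" for m n
    using x that by (auto simp: carrier_Zhat)
  let ?C = "\<lambda>n. {y. [y = x n] (mod (int n))}"
  have "\<exists>u\<in>betaZ. \<forall>n\<in>{1..}. ?C n \<in> u"
  proof (rule directed_ultrafilter)
    show "{1::nat..} \<noteq> {}" by auto
    show "?C n \<noteq> {}" for n using cong_refl by blast
    fix i j :: nat assume ij: "i \<in> {1..}" "j \<in> {1..}"
    let ?l = "lcm i j"
    have l: "?l \<ge> 1" using ij lcm_pos_nat[of i j] by simp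
    have "?C ?l \<subseteq> ?C m" if m: "m \<ge> 1" "m dvd ?l" for m
    proof
      fix y assume "y \<in> ?C ?l"
      then have "[y = x ?l] (mod int m)" using m cong_dvd_modulus[of y "x ?l" "int ?l" "int m"] by simp
      moreover have "[x ?l = x m] (mod int m)" using xd[OF m(1) l m(2)] xb[OF m(1)] by (simp add: cong_def)
      ultimately show "y \<in> ?C m" using cong_trans by blast
    qed
    then show "\<exists>k\<in>{1..}. ?C k \<subseteq> ?C i \<inter> ?C j" using ij l by (intro bexI[of _ ?l]) auto
  qed
  then obtain u where u: "u \<in> betaZ" "\<forall>n\<in>{1..}. ?C n \<in> u" by blast
  have "pi_uf u n = x n" for n
  proof (cases "n \<ge> 1")
    case True
    then have "?C n \<in> u" using u(2) by simp
    then have "[zrem u (int n) = x n] (mod int n)" using mem_cong_iff[OF u(1)] True by simp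
    then have "zrem u (int n) = x n mod int n" using zrem_eq_modI[OF u(1), of "int n"] True by simp
    then show ?thesis using xb[OF True] True by (simp add: pi_uf_apply)
  next
    case False
    then show ?thesis using x by (simp add: pi_uf_def carrier_Zhat extensional_def)
  qed
  then show ?thesis using u(1) by blast
qed

text \<open>The description in \<open>sigma_uf\<close> is justified because equal remainders imply
  strong congruence.\<close>

lemma sigma_uf_pi_uf:
  assumes u: "u \<in> betaZ"
  shows "sigma_uf star w (pi_uf u) = cls u"
  unfolding sigma_uf_def
proof (rule the_equality)
  show "\<exists>u'\<in>betaZ. pi_uf u' = pi_uf u \<and> cls u = cls u'" using u by blast
  fix X assume "\<exists>u'\<in>betaZ. pi_uf u' = pi_uf u \<and> X = cls u'"
  then obtain v where v: "v \<in> betaZ" "pi_uf v = pi_uf u" "X = cls v" by blast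
  then have "scong star w v u" using pi_uf_eq_iff[of v u] by (intro scong_if_zrem_eq u) auto
  then show "X = cls u" using v u cls_eq_iff by simp
qed

lemma kernel_sigma:
  "kernel Zhat quot (sigma_uf star w) = pi_uf ` {u \<in> betaZ. scong star w u (principal_uf 0)}"
  (is "?L = ?R")
proof (intro equalityI subsetI)
  fix x assume "x \<in> ?L"
  then have x: "x \<in> carrier Zhat" "sigma_uf star w x = \<one>\<^bsub>quot\<^esub>" by (auto simp: kernel_def)
  obtain u where u: "u \<in> betaZ" "pi_uf u = x" using pi_uf_surj[OF x(1)] by blast
  have "cls u = cls (principal_uf 0)"
    using x(2) sigma_uf_pi_uf[OF u(1)] u(2) one_quot by simp
  then have "scong star w u (principal_uf 0)"
    unfolding cls_eq_iff[OF u(1) principal_uf_betaZ] .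
  then show "x \<in> ?R" using u by blast
next
  fix x assume "x \<in> ?R"
  then obtain u where u: "u \<in> betaZ" "scong star w u (principal_uf 0)" "x = pi_uf u" by blast
  have "cls u = cls (principal_uf 0)"
    using u(2) unfolding cls_eq_iff[OF u(1) principal_uf_betaZ] .
  then show "x \<in> ?L"
    using sigma_uf_pi_uf[OF u(1)] u(1,3) pi_uf_Zhat[OF u(1)] one_quot by (simp add: kernel_def)
qed

lemma topspace_Zhat: "topspace Zhat_topology = carrier Zhat"
  unfolding Zhat_topology_def Zhat_def residue_limit_def by auto

lemma closedin_Zhat_coordinate:
  assumes "n \<ge> 1"
  shows "closedin Zhat_topology {x \<in> carrier Zhat. x n = 0}"
proof -
  have "continuous_map Zhat_topology (discrete_topology (carrier (integer_mod_group n))) (\<lambda>x. x n)"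
    unfolding Zhat_topology_def using assms
    by (intro continuous_map_from_subtopology continuous_map_product_projection) auto
  then have "closedin Zhat_topology {x \<in> topspace Zhat_topology. x n \<in> {0}}"
    by (rule closedin_continuous_map_preimage) simp
  then show ?thesis by (simp add: topspace_Zhat)
qed

text \<open>The kernel is cut out by the vanishing of the coordinates in \<open>Dset w\<close>, and
  each such condition is closed.\<close>

lemma kernel_closed_if_self_divisible:
  assumes sd: "self_divisible w"
  shows "closedin Zhat_topology (kernel Zhat quot (sigma_uf star w))"
proof -
  let ?N = "{n::nat. n \<ge> 1 \<and> int n \<in> Dset w}"
  have "kernel Zhat quot (sigma_uf star w) = (\<Inter>n\<in>?N. {x \<in> carrier Zhat. x n = 0})"
  proof (intro equalityI subsetI)
    fix x assume "x \<in> kernel Zhat quot (sigma_uf star w)"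
    then obtain u where u: "u \<in> betaZ" "scong star w u (principal_uf 0)" "x = pi_uf u"
      unfolding kernel_sigma by blast
    show "x \<in> (\<Inter>n\<in>?N. {x \<in> carrier Zhat. x n = 0})"
    proof (intro INT_I CollectI conjI)
      fix n assume n: "n \<in> ?N"
      show "x \<in> carrier Zhat" using u by (simp add: pi_uf_Zhat)
      show "x n = 0"
        using u n scong_iff_Dset[OF sd u(1) principal_uf_betaZ] by (auto simp: pi_uf_apply zrem_principal_0)
    qed
  next
    fix x assume x: "x \<in> (\<Inter>n\<in>?N. {x \<in> carrier Zhat. x n = 0})"
    have "1 \<in> ?N" using one_mem_Dset[OF w w0] by simp
    then have "x \<in> carrier Zhat" using x by blast
    then obtain u where u: "u \<in> betaZ" "pi_uf u = x" using pi_uf_surj by blast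
    have "zrem u d = zrem (principal_uf 0) d" if d: "d \<in> Dset w" for d
    proof -
      have d0: "d \<noteq> 0" using d by (simp add: Dset_eq[OF w w0])
      have "\<bar>d\<bar> \<in> Dset w" using Dset_dvd[OF w w0 d, of "\<bar>d\<bar>"] by simp
      then have "nat \<bar>d\<bar> \<in> ?N" using d0 by simp
      then have "pi_uf u (nat \<bar>d\<bar>) = 0" using x u(2) by blast
      moreover have "nat \<bar>d\<bar> \<ge> 1" using d0 by simp
      ultimately have "zrem u d = 0" by (simp add: pi_uf_def zrem_def)
      then show ?thesis using zrem_principal_0[OF d0] by simp
    qed
    then have "scong star w u (principal_uf 0)"
      unfolding scong_iff_Dset[OF sd u(1) principal_uf_betaZ] by blast
    then show "x \<in> kernel Zhat quot (sigma_uf star w)" unfolding kernel_sigma using u by blast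
  qed
  \<comment> \<open>An intersection of closed sets is closed in the space only for a nonempty
    family.\<close>
  moreover have "1 \<in> ?N" using one_mem_Dset[OF w w0] by simp
  ultimately show ?thesis
    by (auto intro!: closedin_Inter closedin_Zhat_coordinate)
qed

text \<open>The image of \<open>w\<close> always lies in the closure of the kernel. A basic
  neighbourhood restricts finitely many coordinates; subtracting from \<open>w\<close> a strongly
  congruent \<open>n\<close>-fold sum, with \<open>n\<close> divisible by all of them, gives a
  kernel element in it.\<close>

lemma self_divisible_if_kernel_closed:
  assumes cl: "closedin Zhat_topology (kernel Zhat quot (sigma_uf star w))"
  shows "self_divisible w"
proof -
  let ?K = "kernel Zhat quot (sigma_uf star w)"
  let ?D = "\<lambda>n. discrete_topology (carrier (integer_mod_group n))"
  have "pi_uf w \<in> ?K"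
  proof (rule ccontr)
    assume "pi_uf w \<notin> ?K"
    then have "pi_uf w \<in> topspace Zhat_topology - ?K" by (simp add: topspace_Zhat pi_uf_Zhat w)
    moreover have "openin Zhat_topology (topspace Zhat_topology - ?K)" using cl by blast
    ultimately obtain W where W: "openin (product_topology ?D {1..}) W" "pi_uf w \<in> W"
      "W \<inter> carrier Zhat \<subseteq> topspace Zhat_topology - ?K"
      unfolding Zhat_topology_def openin_subtopology by blast
    obtain U where U: "finite {i \<in> {1..}. U i \<noteq> topspace (?D i)}" "pi_uf w \<in> Pi\<^sub>E {1..} U" "Pi\<^sub>E {1..} U \<subseteq> W"
      using W(1,2) unfolding openin_product_topology_alt by blast
    define F where "F = {i \<in> {1..}. U i \<noteq> topspace (?D i)}"
    \<comment> \<open>Any positive common multiple of the restricted coordinates would do.\<close>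
    define n where "n = \<Prod>F"
    have F: "finite F" "\<And>i. i \<in> F \<Longrightarrow> i \<ge> 1" using U(1) by (auto simp: F_def)
    have n: "n > 0" unfolding n_def by (rule prod_pos) (use F(2) in force)
    obtain y where y: "y \<in> betaZ" "scong star w w (oplus_pow y n)"
      using scong_multiple_exists[OF n] by blast
    let ?v = "scale_uf (- 1) (oplus_pow y n)"
    have v: "?v \<in> betaZ" by (intro scale_uf_betaZ oplus_pow_betaZ y)
    let ?h = "oplus w ?v"
    have h: "?h \<in> betaZ" by (rule oplus_betaZ[OF w v])
    have zh: "zrem ?h d = (zrem w d - zrem (oplus_pow y n) d) mod \<bar>d\<bar>" if "d \<noteq> 0" for d
      using that by (simp add: zrem_oplus_eq w v zrem_uminus_eq oplus_pow_betaZ y mod_add_right_eq)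
    have "scong star w ?h (principal_uf 0)"
    proof -
      have S: "{d. d \<noteq> 0 \<and> zrem w d = zrem (oplus_pow y n) d} \<in> w"
        using y(2) unfolding scong_iff[OF w w0 w oplus_pow_betaZ[OF y(1)]] .
      show ?thesis
        unfolding scong_iff[OF w w0 h principal_uf_betaZ]
        by (rule uf_mp[OF uf_w S]) (simp add: zh zrem_principal_0)
    qed
    then have hK: "pi_uf ?h \<in> ?K" unfolding kernel_sigma using h by blast
    have "zrem ?h (int i) = zrem w (int i)" if i: "i \<in> F" for i
    proof -
      have i0: "int i \<noteq> 0" using F(2)[OF i] by simp
      have "i dvd n" unfolding n_def by (rule dvd_prodI[OF F(1) i])
      then have "[zrem (oplus_pow y n) (int i) = 0] (mod int i)"
        using zrem_oplus_pow[OF y(1) i0, of n] by (simp add: cong_iff_dvd_diff dvd_diff_right_iff)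
          (meson cong_dvd_iff cong_iff_dvd_diff dvd_mult2 int_dvd_int_iff)
      then have "[zrem w (int i) - zrem (oplus_pow y n) (int i) = zrem w (int i) - 0] (mod int i)"
        by (intro cong_diff cong_refl)
      then show ?thesis using zh[OF i0] zrem_mod[OF w i0] by (simp add: cong_def)
    qed
    then have hw: "pi_uf ?h i = pi_uf w i" if "i \<in> F" for i
      using that F(2) by (simp add: pi_uf_apply)
    have "pi_uf ?h \<in> Pi\<^sub>E {1..} U"
    proof (rule PiE_I)
      fix i :: nat assume i: "i \<in> {1..}"
      show "pi_uf ?h i \<in> U i"
      proof (cases "i \<in> F")
        case True
        then show ?thesis using hw U(2) i by (metis PiE_mem)
      next
        case False
        then have "U i = carrier (integer_mod_group i)" using i by (simp add: F_def)
        then show ?thesis using pi_uf_Zhat[OF h] i by (auto simp: carrier_Zhat carrier_integer_mod_group)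
      qed
    qed (simp add: pi_uf_def)
    then have "pi_uf ?h \<in> topspace Zhat_topology - ?K" using U(3) W(3) pi_uf_Zhat[OF h] by blast
    then show False using hK by blast
  qed
  then obtain u where u: "u \<in> betaZ" "scong star w u (principal_uf 0)" "pi_uf w = pi_uf u"
    unfolding kernel_sigma by blast
  then have "scong star w w u" using pi_uf_eq_iff[of w u] by (intro scong_if_zrem_eq w u) auto
  then show ?thesis
    unfolding self_divisible_iff_scong using scong_trans[OF w u(1) principal_uf_betaZ _ u(2)] by blast
qed

end

section \<open>The quotient topology\<close>

lemma continuous_map_into_embedding:
  assumes f: "embedding_map Y Z f" and g: "g \<in> topspace X \<rightarrow> topspace Y"
    and fg: "continuous_map X Z (f \<circ> g)"
  shows "continuous_map X Y g"
proof -
  let ?S = "subtopology Z (f ` topspace Y)"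
  obtain h where h: "homeomorphic_maps Y ?S f h"
    using f unfolding embedding_map_def homeomorphic_map_maps by blast
  then have hc: "continuous_map ?S Y h" and hf: "\<And>y. y \<in> topspace Y \<Longrightarrow> h (f y) = y"
    by (auto simp: homeomorphic_maps_def)
  have "continuous_map X ?S (f \<circ> g)"
    using fg g by (auto simp: continuous_map_in_subtopology)
  then have "continuous_map X Y (h \<circ> (f \<circ> g))" using hc by (rule continuous_map_compose)
  then show ?thesis
    by (rule continuous_map_eq) (use g hf in \<open>simp add: Pi_iff\<close>)
qed

lemma topspace_betaZ: "topspace betaZ_topology = betaZ"
  unfolding betaZ_topology_def by (auto simp: betaZ_def intro: uf_UNIV)

lemma openin_betaZ_basic: "openin betaZ_topology {u \<in> betaZ. A \<in> u}"
  unfolding betaZ_topology_def by (rule topology_generated_by_Basis) blast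

text \<open>The generating sets form a base, since the one for \<open>A \<inter> B\<close> is the
  intersection of those for \<open>A\<close> and \<open>B\<close>.\<close>

lemma openin_betaZ_imp_basic:
  assumes "openin betaZ_topology U" and "u \<in> U"
  shows "\<exists>A\<in>u. {v \<in> betaZ. A \<in> v} \<subseteq> U"
proof -
  have "generate_topology_on (range (\<lambda>A. {u \<in> betaZ. A \<in> u})) U"
    using assms(1) unfolding betaZ_topology_def by (rule openin_topology_generated_by)
  then have "\<forall>u\<in>U. \<exists>A\<in>u. {v \<in> betaZ. A \<in> v} \<subseteq> U"
  proof induction
    case (Int a b)
    show ?case
    proof
      fix u assume u: "u \<in> a \<inter> b"
      then obtain A B where AB: "A \<in> u" "{v \<in> betaZ. A \<in> v} \<subseteq> a" "B \<in> u" "{v \<in> betaZ. B \<in> v} \<subseteq> b"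
        using Int.IH by blast
      have "a \<subseteq> betaZ"
        using Int.hyps(1) openin_subset[of betaZ_topology a] topspace_betaZ
        by (simp add: betaZ_topology_def openin_topology_generated_by_iff)
      then have uf: "ultrafilter u" using u betaZ_ultrafilter by blast
      have "A \<inter> B \<in> u" using AB by (simp add: uf_Int[OF uf])
      moreover have "{v \<in> betaZ. A \<inter> B \<in> v} \<subseteq> a \<inter> b"
        using AB(2,4) by (auto simp: uf_Int betaZ_ultrafilter)
      ultimately show "\<exists>A\<in>u. {v \<in> betaZ. A \<in> v} \<subseteq> a \<inter> b" by blast
    qed
  next
    case (UN K)
    show ?case
    proof
      fix u assume "u \<in> \<Union>K"
      then obtain k where k: "k \<in> K" "u \<in> k" by blast
      then obtain A where A: "A \<in> u" "{v \<in> betaZ. A \<in> v} \<subseteq> k" using UN.IH[OF k(1)] by blast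
      have "{v \<in> betaZ. A \<in> v} \<subseteq> \<Union>K" using A(2) Union_upper[OF k(1)] by (rule subset_trans)
      then show "\<exists>A\<in>u. {v \<in> betaZ. A \<in> v} \<subseteq> \<Union>K" using A(1) by (rule bexI)
    qed
  next
    case (Basis s)
    then show ?case by auto
  qed simp
  then show ?thesis using assms(2) by blast
qed

text \<open>If no finitely many sets in \<open>\<A>\<close> covered the integers, an ultrafilter
  would contain all their complements. Yet it lies in the cover, hence contains some set in
  \<open>\<A>\<close>.\<close>

lemma (in saturated_extension) compact_betaZ: "compact_space betaZ_topology"
  unfolding compact_space_alt topspace_betaZ
proof (intro allI impI, elim conjE)
  fix \<U> assume op: "\<forall>U\<in>\<U>. openin betaZ_topology U" and cov: "betaZ \<subseteq> \<Union>\<U>"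
  define \<A> where "\<A> = {A. \<exists>U\<in>\<U>. {v \<in> betaZ. A \<in> v} \<subseteq> U}"
  have "\<exists>G. finite G \<and> G \<subseteq> uminus ` \<A> \<and> \<Inter>G = {}"
  proof (rule ccontr)
    assume "\<not> ?thesis"
    then have "\<exists>u\<in>betaZ. uminus ` \<A> \<subseteq> u" by (intro ultrafilter_extending) blast
    then obtain u where u: "u \<in> betaZ" "uminus ` \<A> \<subseteq> u" by blast
    then obtain U where "U \<in> \<U>" "u \<in> U" using cov by blast
    then obtain A where A: "A \<in> u" "A \<in> \<A>" using openin_betaZ_imp_basic[of U u] op by (auto simp: \<A>_def)
    then have "- A \<in> u" using u(2) by blast
    then show False using A(1) uf_Compl[OF betaZ_ultrafilter[OF u(1)]] by blast
  qed
  then obtain G where G: "finite G" "G \<subseteq> uminus ` \<A>" "\<Inter>G = {}" by blast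
  obtain B where B: "B \<subseteq> \<A>" "finite B" "G = uminus ` B" using finite_subset_image[OF G(1,2)] by blast
  have "\<forall>A\<in>B. \<exists>U. U \<in> \<U> \<and> {v \<in> betaZ. A \<in> v} \<subseteq> U" using B(1) by (auto simp: \<A>_def)
  then obtain f where f: "\<forall>A\<in>B. f A \<in> \<U> \<and> {v \<in> betaZ. A \<in> v} \<subseteq> f A" by metis
  have "betaZ \<subseteq> \<Union>(f ` B)"
  proof
    fix u assume u: "u \<in> betaZ"
    have "(\<Union>A\<in>B. A) = UNIV" using G(3) unfolding B(3) by auto
    then have "\<exists>A\<in>B. A \<in> u"
      using uf_UN[OF betaZ_ultrafilter[OF u] B(2), of "\<lambda>A. A"] uf_UNIV[OF betaZ_ultrafilter[OF u]] by simp
    then show "u \<in> \<Union>(f ` B)" using f u by blast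
  qed
  moreover have "finite (f ` B)" "f ` B \<subseteq> \<U>" using B(2) f by auto
  ultimately show "\<exists>\<F>. finite \<F> \<and> \<F> \<subseteq> \<U> \<and> betaZ \<subseteq> \<Union>\<F>" by blast
qed

lemma continuous_zrem:
  assumes d: "d \<noteq> 0"
  shows "continuous_map betaZ_topology (discrete_topology UNIV) (\<lambda>u. zrem u d)"
proof -
  have "openin betaZ_topology {u \<in> betaZ. zrem u d \<in> S}" for S
  proof -
    have "{x. x mod \<bar>d\<bar> \<in> S} \<in> u \<longleftrightarrow> zrem u d \<in> S" if u: "u \<in> betaZ" for u
    proof -
      note uf = betaZ_ultrafilter[OF u]
      have R: "{x. x mod \<bar>d\<bar> = zrem u d} \<in> u"
      proof (rule uf_mp[OF uf zrem(3)[OF u d]])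
        fix x assume "x \<in> {x. [x = zrem u d] (mod d)}"
        then have "[x = zrem u d] (mod \<bar>d\<bar>)" by (simp add: cong_iff_dvd_diff)
        then show "x \<in> {x. x mod \<bar>d\<bar> = zrem u d}" using zrem_mod[OF u d] by (simp add: cong_def)
      qed
      show ?thesis
      proof
        assume "{x. x mod \<bar>d\<bar> \<in> S} \<in> u"
        then have "{x. x mod \<bar>d\<bar> \<in> S} \<inter> {x. x mod \<bar>d\<bar> = zrem u d} \<in> u"
          using R by (simp add: uf_Int[OF uf])
        then show "zrem u d \<in> S" using uf_nonempty[OF uf] by fastforce
      next
        assume "zrem u d \<in> S"
        then show "{x. x mod \<bar>d\<bar> \<in> S} \<in> u" by (intro uf_mp[OF uf R]) simp
      qed
    qed
    then have "{u \<in> betaZ. zrem u d \<in> S} = {u \<in> betaZ. {x. x mod \<bar>d\<bar> \<in> S} \<in> u}" by blast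
    then show ?thesis using openin_betaZ_basic by simp
  qed
  then show ?thesis by (simp add: continuous_map_def topspace_betaZ)
qed

context nonzero_ultrafilter
begin

abbreviation qtop where "qtop \<equiv> scong_quotient_topology star w"

lemma quotient_map_cls: "quotient_map betaZ_topology qtop cls"
  unfolding scong_quotient_topology_def by (rule quotient_map_quotient_topology)

lemma topspace_qtop: "topspace qtop = carrier quot"
  using quotient_imp_surjective_map[OF quotient_map_cls] by (simp add: topspace_betaZ carrier_quot)

text \<open>The choice of representative is immaterial for self-divisible \<open>w\<close> and
  \<open>n\<close> in \<open>Dset w\<close>. These remainders are the coordinates on the
  quotient.\<close>

definition class_rem :: "int set set set \<Rightarrow> int \<Rightarrow> int" where
  "class_rem X n = zrem (SOME u. u \<in> X) n"

lemma class_rem_cls: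
  assumes sd: "self_divisible w" and u: "u \<in> betaZ" and n: "n \<in> Dset w"
  shows "class_rem (cls u) n = zrem u n"
proof -
  have "(SOME v. v \<in> cls u) \<in> cls u" by (rule someI, rule self_mem_cls[OF u])
  then have "(SOME v. v \<in> cls u) \<in> betaZ" "scong star w u (SOME v. v \<in> cls u)" by (auto simp: mem_cls)
  then show ?thesis using scong_iff_Dset[OF sd u] n by (simp add: class_rem_def)
qed

lemma continuous_class_rem:
  assumes sd: "self_divisible w" and n: "n \<in> Dset w"
  shows "continuous_map qtop (discrete_topology UNIV) (\<lambda>X. class_rem X n)"
proof -
  have "n \<noteq> 0" using n by (simp add: Dset_eq[OF w w0])
  then have "continuous_map betaZ_topology (discrete_topology UNIV) ((\<lambda>X. class_rem X n) \<circ> cls)"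
    by (intro continuous_map_eq[OF continuous_zrem]) (simp_all add: topspace_betaZ class_rem_cls[OF sd _ n])
  then show ?thesis using continuous_compose_quotient_map[OF quotient_map_cls] by blast
qed

lemma class_rem_inj:
  assumes sd: "self_divisible w" and X: "X \<in> carrier quot" and Y: "Y \<in> carrier quot"
    and "\<And>n. n \<in> Dset w \<Longrightarrow> class_rem X n = class_rem Y n"
  shows "X = Y"
proof -
  obtain u v where u: "u \<in> betaZ" "X = cls u" and v: "v \<in> betaZ" "Y = cls v"
    using X Y by (auto simp: carrier_quot)
  have "\<forall>d\<in>Dset w. zrem u d = zrem v d"
    using assms(4) u v by (simp add: class_rem_cls[OF sd])
  then show ?thesis using cls_eq_iff[OF u(1) v(1)] scong_iff_Dset[OF sd u(1) v(1)] u v by blast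
qed

lemma class_rem_mult:
  assumes sd: "self_divisible w" and X: "X \<in> carrier quot" and Y: "Y \<in> carrier quot" and n: "n \<in> Dset w"
  shows "class_rem (X \<otimes>\<^bsub>quot\<^esub> Y) n = (class_rem X n + class_rem Y n) mod \<bar>n\<bar>"
proof -
  have "n \<noteq> 0" using n by (simp add: Dset_eq[OF w w0])
  moreover obtain u v where u: "u \<in> betaZ" "X = cls u" and v: "v \<in> betaZ" "Y = cls v"
    using X Y by (auto simp: carrier_quot)
  ultimately show ?thesis
    by (simp add: mult_quot class_rem_cls[OF sd _ n] oplus_betaZ zrem_oplus_eq)
qed

lemma class_rem_inv:
  assumes sd: "self_divisible w" and X: "X \<in> carrier quot" and n: "n \<in> Dset w"
  shows "class_rem (inv\<^bsub>quot\<^esub> X) n = - class_rem X n mod \<bar>n\<bar>"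
proof -
  have "n \<noteq> 0" using n by (simp add: Dset_eq[OF w w0])
  moreover obtain u where u: "u \<in> betaZ" "X = cls u" using X by (auto simp: carrier_quot)
  ultimately show ?thesis
    by (simp add: inv_quot class_rem_cls[OF sd _ n] scale_uf_betaZ zrem_uminus_eq)
qed

lemma compact_qtop: "compact_space qtop"
proof -
  have "compactin betaZ_topology betaZ" using compact_betaZ by (simp add: compact_space_def topspace_betaZ)
  then have "compactin qtop (cls ` betaZ)"
    by (rule image_compactin[OF _ quotient_imp_continuous_map[OF quotient_map_cls]])
  then show ?thesis by (simp add: compact_space_def topspace_qtop carrier_quot)
qed

section \<open>Embedding of the quotient into a product of discrete spaces\<close>

abbreviation rem_product :: "(int \<Rightarrow> int) topology" where
  "rem_product \<equiv> product_topology (\<lambda>_. discrete_topology UNIV) (Dset w)"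

abbreviation class_rems :: "int set set set \<Rightarrow> int \<Rightarrow> int" where
  "class_rems X \<equiv> (\<lambda>n\<in>Dset w. class_rem X n)"

lemma Hausdorff_rem_product: "Hausdorff_space rem_product"
  by (simp add: Hausdorff_space_product_topology)

lemma inj_class_rems:
  assumes sd: "self_divisible w"
  shows "inj_on class_rems (topspace qtop)"
proof (rule inj_onI)
  fix X Y assume XY: "X \<in> topspace qtop" "Y \<in> topspace qtop" and eq: "class_rems X = class_rems Y"
  show "X = Y"
  proof (rule class_rem_inj[OF sd])
    show "X \<in> carrier quot" "Y \<in> carrier quot" using XY by (simp_all add: topspace_qtop)
    fix n assume "n \<in> Dset w"
    then show "class_rem X n = class_rem Y n" using fun_cong[OF eq, of n] by simp
  qed
qed

lemma continuous_class_rems: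
  assumes sd: "self_divisible w"
  shows "continuous_map qtop rem_product class_rems"
proof -
  have "continuous_map qtop (discrete_topology UNIV) (\<lambda>X. class_rems X n)" if "n \<in> Dset w" for n
    using continuous_class_rem[OF sd that] that by simp
  then show ?thesis by (auto simp: continuous_map_componentwise)
qed

text \<open>A continuous injection from a compact space into a Hausdorff space is an
  embedding.\<close>

lemma embedding_class_rems: "self_divisible w \<Longrightarrow> embedding_map qtop rem_product class_rems"
  by (intro continuous_imp_embedding_map continuous_class_rems compact_qtop Hausdorff_rem_product inj_class_rems)

lemma continuous_map_into_qtop:
  assumes sd: "self_divisible w" and g: "g \<in> topspace X \<rightarrow> topspace qtop"
    and rem: "\<And>n. n \<in> Dset w \<Longrightarrow> continuous_map X (discrete_topology UNIV) (\<lambda>x. class_rem (g x) n)"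
  shows "continuous_map X qtop g"
proof (rule continuous_map_into_embedding[OF embedding_class_rems[OF sd] g])
  have "continuous_map X (discrete_topology UNIV) (\<lambda>x. (class_rems \<circ> g) x n)" if "n \<in> Dset w" for n
    using rem[OF that] that by simp
  then show "continuous_map X rem_product (class_rems \<circ> g)" by (auto simp: continuous_map_componentwise)
qed

text \<open>Each coordinate maps a connected set into a discrete space, so it is constant there; the
  coordinates separate classes.\<close>

lemma stone_qtop:
  assumes sd: "self_divisible w"
  shows "stone_space qtop"
proof -
  have "\<exists>a. S \<subseteq> {a}" if S: "connectedin qtop S" for S
  proof (cases "S = {}")
    case False
    then obtain a where a: "a \<in> S" by blast
    have SQ: "S \<subseteq> carrier quot" using connectedin_subset_topspace[OF S] by (simp add: topspace_qtop)
    have "b = a" if b: "b \<in> S" for b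
    proof (rule class_rem_inj[OF sd])
      show "b \<in> carrier quot" "a \<in> carrier quot" using a b SQ by auto
      fix n assume n: "n \<in> Dset w"
      have "connectedin (discrete_topology UNIV) ((\<lambda>X. class_rem X n) ` S)"
        by (rule connectedin_continuous_map_image[OF continuous_class_rem[OF sd n] S])
      then obtain c where "(\<lambda>X. class_rem X n) ` S \<subseteq> {c}" by (auto simp: connectedin_discrete_topology)
      then show "class_rem b n = class_rem a n" using a b by blast
    qed
    then show ?thesis by blast
  qed auto
  then have "totally_disconnected_space qtop" by (simp add: totally_disconnected_space_def)
  moreover have "Hausdorff_space qtop"
    by (rule Hausdorff_space_injective_preimage[OF Hausdorff_rem_product continuous_class_rems[OF sd] inj_class_rems[OF sd]])
  ultimately show ?thesis by (simp add: stone_space_def compact_qtop)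
qed

text \<open>\<open>oplus\<close> is not jointly continuous on \<open>betaZ\<close>, so continuity is
  not inherited from there. It is checked on coordinates, where the operations are modular
  arithmetic.\<close>

lemma topological_group_qtop:
  assumes sd: "self_divisible w"
  shows "topological_group_on quot qtop"
proof -
  interpret comm_group quot by (rule comm_group_quot)
  let ?d = "discrete_topology (UNIV :: int set)"
  have "continuous_map (prod_topology qtop qtop) qtop (\<lambda>(x, y). x \<otimes>\<^bsub>quot\<^esub> y)"
  proof (rule continuous_map_into_qtop[OF sd])
    show "(\<lambda>(x, y). x \<otimes>\<^bsub>quot\<^esub> y) \<in> topspace (prod_topology qtop qtop) \<rightarrow> topspace qtop"
      by (auto simp: topspace_qtop)
    fix n assume n: "n \<in> Dset w"
    let ?p = "\<lambda>z. (class_rem (fst z) n, class_rem (snd z) n)"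
    let ?s = "\<lambda>z :: int \<times> int. (fst z + snd z) mod \<bar>n\<bar>"
    have "continuous_map (prod_topology qtop qtop) (prod_topology ?d ?d) ?p"
      by (intro continuous_map_pairedI
          continuous_map_compose[OF continuous_map_fst continuous_class_rem[OF sd n], unfolded comp_def]
          continuous_map_compose[OF continuous_map_snd continuous_class_rem[OF sd n], unfolded comp_def])
    moreover have "continuous_map (prod_topology ?d ?d) ?d ?s"
      unfolding prod_topology_discrete_topology[symmetric] by simp
    ultimately have "continuous_map (prod_topology qtop qtop) ?d (?s \<circ> ?p)"
      by (rule continuous_map_compose)
    then show "continuous_map (prod_topology qtop qtop) ?d
        (\<lambda>x. class_rem (case x of (x, y) \<Rightarrow> x \<otimes>\<^bsub>quot\<^esub> y) n)"
      by (rule continuous_map_eq) (auto simp: topspace_qtop class_rem_mult[OF sd _ _ n])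
  qed
  moreover have "continuous_map qtop qtop (\<lambda>x. inv\<^bsub>quot\<^esub> x)"
  proof (rule continuous_map_into_qtop[OF sd])
    show "(\<lambda>x. inv\<^bsub>quot\<^esub> x) \<in> topspace qtop \<rightarrow> topspace qtop" by (auto simp: topspace_qtop)
    fix n assume n: "n \<in> Dset w"
    have "continuous_map ?d ?d (\<lambda>r. - r mod \<bar>n\<bar>)" by simp
    then have "continuous_map qtop ?d ((\<lambda>r. - r mod \<bar>n\<bar>) \<circ> (\<lambda>X. class_rem X n))"
      by (rule continuous_map_compose[OF continuous_class_rem[OF sd n]])
    then show "continuous_map qtop ?d (\<lambda>x. class_rem (inv\<^bsub>quot\<^esub> x) n)"
      by (rule continuous_map_eq) (simp add: topspace_qtop class_rem_inv[OF sd _ n])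
  qed
  ultimately show ?thesis by (simp add: topological_group_on_def is_group topspace_qtop)
qed

lemma cls_principal_generated: "cls (principal_uf k) \<in> generate quot {cls (principal_uf 1)}"
proof -
  interpret comm_group quot by (rule comm_group_quot)
  let ?g = "cls (principal_uf 1)"
  have g: "?g \<in> carrier quot" by (simp add: carrier_quot principal_uf_betaZ)
  have oplus_principal: "oplus (principal_uf a) (principal_uf b) = principal_uf (a + b)" for a b
    by (simp add: oplus_def principal_uf_def)
  have scale_principal: "scale_uf (- 1) (principal_uf 1) = principal_uf (- 1)"
    by (simp add: scale_uf_def principal_uf_def)
  have inv_g: "inv\<^bsub>quot\<^esub> ?g = cls (principal_uf (- 1))"
    by (simp add: inv_quot principal_uf_betaZ scale_principal)
  show ?thesis
  proof (induction k rule: int_induct[where k = 0])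
    case base
    then show ?case using generate.one[of quot "{?g}"] by (simp add: one_quot)
  next
    case (step1 i)
    have "cls (principal_uf i) \<otimes>\<^bsub>quot\<^esub> ?g \<in> generate quot {?g}"
      by (intro generate.eng step1 generate.incl) simp
    then show ?case by (simp add: mult_quot principal_uf_betaZ oplus_principal)
  next
    case (step2 i)
    have "cls (principal_uf i) \<otimes>\<^bsub>quot\<^esub> inv\<^bsub>quot\<^esub> ?g \<in> generate quot {?g}"
      by (intro generate.eng step2 generate.inv) simp
    then show ?case by (simp add: inv_g mult_quot principal_uf_betaZ oplus_principal)
  qed
qed

text \<open>Principal ultrafilters are dense in \<open>betaZ\<close>, so their classes are dense in
  the quotient; they are the powers of the class of \<open>1\<close>.\<close>

lemma procyclic_if_self_divisible:
  assumes sd: "self_divisible w"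
  shows "procyclic_group quot qtop"
proof -
  let ?g = "cls (principal_uf 1)"
  have "generate quot {?g} \<inter> V \<noteq> {}" if V: "openin qtop V" "V \<noteq> {}" for V
  proof -
    obtain X where X: "X \<in> V" using V(2) by blast
    then have "X \<in> carrier quot" using openin_subset[OF V(1)] by (auto simp: topspace_qtop)
    then obtain u where u: "u \<in> betaZ" "X = cls u" by (auto simp: carrier_quot)
    have "openin betaZ_topology {u \<in> topspace betaZ_topology. cls u \<in> V}"
      by (rule openin_continuous_map_preimage[OF quotient_imp_continuous_map[OF quotient_map_cls] V(1)])
    then obtain A where A: "A \<in> u" "{v \<in> betaZ. A \<in> v} \<subseteq> {u \<in> betaZ. cls u \<in> V}"
      using openin_betaZ_imp_basic[of _ u] u X by (auto simp: topspace_betaZ)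
    obtain k where "k \<in> A" using uf_nonempty[OF betaZ_ultrafilter[OF u(1)] A(1)] by blast
    then have "principal_uf k \<in> {v \<in> betaZ. A \<in> v}" by (simp add: mem_principal_uf principal_uf_betaZ)
    then have "cls (principal_uf k) \<in> V" using A(2) by blast
    then show ?thesis using cls_principal_generated by blast
  qed
  then have "qtop closure_of generate quot {?g} = topspace qtop" unfolding dense_intersects_open by blast
  moreover have "?g \<in> carrier quot" by (simp add: carrier_quot principal_uf_betaZ)
  ultimately show ?thesis
    unfolding procyclic_group_def profinite_group_def
    using topological_group_qtop[OF sd] stone_qtop[OF sd] by blast
qed

end

section \<open>The local factors\<close>

lemma carrier_residue_limit:
  assumes "0 \<notin> I"
  shows "carrier (residue_limit I) = {x \<in> extensional I. (\<forall>n\<in>I. 0 \<le> x n \<and> x n < int n) \<and>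
    (\<forall>m\<in>I. \<forall>n\<in>I. m dvd n \<longrightarrow> x n mod int m = x m)}"
proof -
  have "carrier (integer_mod_group n) = {0..<int n}" if "n \<in> I" for n
    using that assms by (metis carrier_integer_mod_group)
  then have "(\<Pi>\<^sub>E n\<in>I. carrier (integer_mod_group n)) = (\<Pi>\<^sub>E n\<in>I. {0..<int n})"
    by (rule PiE_cong)
  then show ?thesis unfolding residue_limit_def by (auto simp: PiE_iff)
qed

lemma mult_residue_limit: "x \<otimes>\<^bsub>residue_limit I\<^esub> y = (\<lambda>i\<in>I. (x i + y i) mod int i)"
  by (simp add: residue_limit_def)

lemma residue_limit_singleton:
  assumes "n > 0"
  shows "residue_limit {n} = product_group {n} integer_mod_group"
proof -
  have "{x \<in> carrier (product_group {n} integer_mod_group).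
      \<forall>m\<in>{n}. \<forall>k\<in>{n}. m dvd k \<longrightarrow> x k mod int m = x m} = carrier (product_group {n} integer_mod_group)"
  proof -
    have "x n mod int n = x n" if "x \<in> carrier (product_group {n} integer_mod_group)" for x
      using that assms PiE_mem[of x "{n}" "\<lambda>n. carrier (integer_mod_group n)" n]
      by (simp add: carrier_integer_mod_group)
    then show ?thesis by blast
  qed
  then show ?thesis by (simp add: residue_limit_def)
qed

text \<open>The Chinese remainder theorem is applied in the naturals, which is why the residues are
  taken nonnegative.\<close>

lemma simultaneous_residues:
  fixes k :: "nat \<Rightarrow> nat" and r :: "nat \<Rightarrow> int"
  assumes "finite P" and "\<And>p. p \<in> P \<Longrightarrow> prime p" and "\<And>p. p \<in> P \<Longrightarrow> r p \<ge> 0"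
  shows "\<exists>x::int. \<forall>p\<in>P. [x = r p] (mod int (p ^ k p))"
proof -
  have "coprime (p ^ k p) (q ^ k q)" if "p \<in> P" "q \<in> P" "p \<noteq> q" for p q
    using primes_coprime[of p q] assms(2) that by simp
  then obtain x where x: "\<forall>p\<in>P. [x = nat (r p)] (mod p ^ k p)"
    using chinese_remainder_nat[OF assms(1), of "\<lambda>p. p ^ k p" "\<lambda>p. nat (r p)"] by blast
  have "[int x = r p] (mod int (p ^ k p))" if p: "p \<in> P" for p
  proof -
    have "[int x = int (nat (r p))] (mod int (p ^ k p))"
      using x p cong_int_iff by blast
    then show ?thesis using assms(3)[OF p] by simp
  qed
  then show ?thesis by blast
qed

lemma dvd_if_prime_powers_dvd:
  fixes d x :: int
  assumes "d \<noteq> 0" and "\<And>p k. prime (p::nat) \<Longrightarrow> int (p ^ k) dvd d \<Longrightarrow> int (p ^ k) dvd x"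
  shows "d dvd x"
proof (cases "x = 0")
  case False
  show ?thesis
  proof (rule multiplicity_le_imp_dvd[OF assms(1)])
    fix q :: int assume q: "prime q"
    have qn: "int (nat q ^ k) = q ^ k" for k using prime_gt_0_int[OF q] by simp
    have "prime (nat q)" using q prime_int_nat_transfer by blast
    moreover have "int (nat q ^ multiplicity q d) dvd d" unfolding qn by (rule multiplicity_dvd)
    ultimately have "int (nat q ^ multiplicity q d) dvd x" by (rule assms(2))
    then have "q ^ multiplicity q d dvd x" by (simp only: qn)
    then show "multiplicity q d \<le> multiplicity q x"
      using False q by (intro multiplicity_geI) (auto simp: not_prime_unit)
  qed
qed simp

context nonzero_ultrafilter
begin

text \<open>With these moduli a finite cyclic factor and the \<open>p\<close>-adic integers are both
  inverse limits of residues and can be treated together.\<close>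

definition local_index :: "nat \<Rightarrow> nat set" where
  "local_index p = (case phi_uf w p of enat k \<Rightarrow> {p ^ k} | \<infinity> \<Rightarrow> range (\<lambda>k. p ^ k))"

lemma local_factor_eq: "prime p \<Longrightarrow> local_factor w p = residue_limit (local_index p)"
  by (auto simp: local_factor_def local_index_def padic_group_def residue_limit_singleton prime_gt_0_nat
      split: enat.split)

lemma phi_set_eq: "{k. multiples (int p ^ k) \<in> w} = {k. int (p ^ k) \<in> Dset w}"
  by (simp add: Dset_def)

lemma local_index_Dset:
  assumes p: "prime p" and i: "i \<in> local_index p"
  shows "int i \<in> Dset w" and "\<exists>k. i = p ^ k" and "i > 0"
proof -
  let ?K = "{k. int (p ^ k) \<in> Dset w}"
  have "int i \<in> Dset w \<and> (\<exists>k. i = p ^ k)"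
  proof (cases "finite ?K")
    case True
    have "0 \<in> ?K" using one_mem_Dset[OF w w0] by simp
    then have "?K \<noteq> {}" by blast
    then have "Max ?K \<in> ?K" by (rule Max_in[OF True])
    moreover have "i = p ^ Max ?K"
      using i True by (simp add: local_index_def phi_uf_def phi_set_eq Let_def)
    ultimately show ?thesis by blast
  next
    case False
    then obtain k where k: "i = p ^ k"
      using i by (auto simp: local_index_def phi_uf_def phi_set_eq Let_def)
    obtain l where l: "l \<ge> k" "l \<in> ?K" using False unfolding infinite_nat_iff_unbounded_le by blast
    have "int (p ^ k) dvd int (p ^ l)" using le_imp_power_dvd[OF l(1)] int_dvd_int_iff by blast
    then have "int (p ^ k) \<in> Dset w" using l(2) Dset_dvd[OF w w0] by blast
    then show ?thesis using k by blast
  qed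
  then show "int i \<in> Dset w" "\<exists>k. i = p ^ k" "i > 0" using prime_gt_0_nat[OF p] by auto
qed

text \<open>The local moduli are cofinal among the powers of \<open>p\<close> that divide
  \<open>w\<close>.\<close>

lemma local_index_cover:
  assumes "int (p ^ k) \<in> Dset w"
  shows "\<exists>i\<in>local_index p. p ^ k dvd i"
proof -
  let ?K = "{k. int (p ^ k) \<in> Dset w}"
  show ?thesis
  proof (cases "finite ?K")
    case True
    then have "local_index p = {p ^ Max ?K}"
      by (simp add: local_index_def phi_uf_def phi_set_eq Let_def)
    moreover have "k \<le> Max ?K" using True assms by (intro Max_ge) auto
    ultimately show ?thesis using le_imp_power_dvd by blast
  next
    case False
    then have "local_index p = range (\<lambda>k. p ^ k)"
      by (simp add: local_index_def phi_uf_def phi_set_eq Let_def)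
    then show ?thesis using dvd_refl by blast
  qed
qed

lemma local_index_chain:
  assumes p: "prime p" and "i \<in> local_index p" and "j \<in> local_index p" and "i \<le> j"
  shows "i dvd j"
proof -
  obtain a b where ab: "i = p ^ a" "j = p ^ b" using local_index_Dset(2)[OF p] assms(2,3) by blast
  then have "a \<le> b" using assms(4) prime_gt_1_nat[OF p] by simp
  then show ?thesis using ab le_imp_power_dvd by blast
qed

text \<open>A congruence modulo \<open>d\<close> in \<open>Dset w\<close> can be tested on the prime
  powers dividing \<open>d\<close>. These are in \<open>Dset w\<close> as well, so each divides a
  local modulus.\<close>

lemma scong_iff_local:
  assumes sd: "self_divisible w" and u: "u \<in> betaZ" and v: "v \<in> betaZ"
  shows "scong star w u v \<longleftrightarrow> (\<forall>p. prime p \<longrightarrow> (\<forall>i\<in>local_index p. zrem u (int i) = zrem v (int i)))"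
proof
  assume "scong star w u v"
  then show "\<forall>p. prime p \<longrightarrow> (\<forall>i\<in>local_index p. zrem u (int i) = zrem v (int i))"
    unfolding scong_iff_Dset[OF sd u v] using local_index_Dset(1) by blast
next
  assume R: "\<forall>p. prime p \<longrightarrow> (\<forall>i\<in>local_index p. zrem u (int i) = zrem v (int i))"
  show "scong star w u v"
    unfolding scong_iff_Dset[OF sd u v]
  proof
    fix d assume d: "d \<in> Dset w"
    then have d0: "d \<noteq> 0" by (simp add: Dset_eq[OF w w0])
    have "d dvd zrem u d - zrem v d"
    proof (rule dvd_if_prime_powers_dvd[OF d0])
      fix p k :: nat assume p: "prime p" and pk: "int (p ^ k) dvd d"
      then have "int (p ^ k) \<in> Dset w" using Dset_dvd[OF w w0 d] by blast
      then obtain i where i: "i \<in> local_index p" "p ^ k dvd i" using local_index_cover by blast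
      have pki: "int (p ^ k) dvd int i" using i(2) int_dvd_int_iff by blast
      have i0: "int i \<noteq> 0" using local_index_Dset(3)[OF p i(1)] by simp
      have "[zrem u d = zrem u (int i)] (mod int (p ^ k))"
        using zrem_dvd[OF u pk d0] zrem_dvd[OF u pki i0] cong_sym cong_trans by blast
      moreover have "[zrem v d = zrem v (int i)] (mod int (p ^ k))"
        using zrem_dvd[OF v pk d0] zrem_dvd[OF v pki i0] cong_sym cong_trans by blast
      moreover have "zrem u (int i) = zrem v (int i)" using R p i(1) by blast
      ultimately have "[zrem u d = zrem v d] (mod int (p ^ k))" by (metis cong_sym cong_trans)
      then show "int (p ^ k) dvd zrem u d - zrem v d" by (simp only: cong_iff_dvd_diff)
    qed
    then show "zrem u d = zrem v d" by (intro zrem_eqI[OF u v d0]) (simp only: cong_iff_dvd_diff)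
  qed
qed

abbreviation local_product :: "(nat \<Rightarrow> nat \<Rightarrow> int) monoid" where
  "local_product \<equiv> product_group {p. prime p} (local_factor w)"

lemma carrier_local_product:
  "x \<in> carrier local_product \<longleftrightarrow> x \<in> extensional {p. prime p} \<and>
    (\<forall>p. prime p \<longrightarrow> x p \<in> carrier (residue_limit (local_index p)))"
  by (auto simp: PiE_iff local_factor_eq)

lemma carrier_local:
  "prime p \<Longrightarrow> carrier (residue_limit (local_index p)) = {x \<in> extensional (local_index p).
    (\<forall>n\<in>local_index p. 0 \<le> x n \<and> x n < int n) \<and>
    (\<forall>m\<in>local_index p. \<forall>n\<in>local_index p. m dvd n \<longrightarrow> x n mod int m = x m)}"
  by (rule carrier_residue_limit) (use local_index_Dset(3) in blast)

lemma mult_local_product: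
  assumes "prime p" and "i \<in> local_index p"
  shows "(x \<otimes>\<^bsub>local_product\<^esub> y) p i = (x p i + y p i) mod int i"
  using assms by (simp add: local_factor_eq mult_residue_limit)

lemma local_product_eqI:
  assumes x: "x \<in> carrier local_product" and y: "y \<in> carrier local_product"
    and eq: "\<And>p i. prime p \<Longrightarrow> i \<in> local_index p \<Longrightarrow> x p i = y p i"
  shows "x = y"
proof
  fix p
  show "x p = y p"
  proof (cases "prime p")
    case True
    have "x p \<in> extensional (local_index p)" "y p \<in> extensional (local_index p)"
      using x y True carrier_local[OF True] unfolding carrier_local_product by auto
    then show ?thesis by (rule extensionalityI) (use eq True in blast)
  next
    case False
    then show ?thesis using x y unfolding carrier_local_product by (simp add: extensional_def)
  qed
qed

text \<open>Infinitely divisible elements of the product vanish, and a purely algebraic isomorphism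
  carries this back to the quotient.\<close>

lemma iso_imp_self_divisible:
  assumes "quot \<cong> local_product"
  shows "self_divisible w"
proof -
  interpret comm_group quot by (rule comm_group_quot)
  obtain f where f: "f \<in> hom quot local_product" "bij_betw f (carrier quot) (carrier local_product)"
    using assms unfolding is_iso_def iso_def by blast
  have fc: "f X \<in> carrier local_product" if "X \<in> carrier quot" for X
    using f(1) that by (rule hom_in_carrier)
  have fm: "f (X \<otimes>\<^bsub>quot\<^esub> Y) p i = (f X p i + f Y p i) mod int i"
    if "X \<in> carrier quot" "Y \<in> carrier quot" "prime p" "i \<in> local_index p" for X Y p i
    using hom_mult[OF f(1) that(1,2)] mult_local_product[OF that(3,4)] by simp
  have f1: "f \<one>\<^bsub>quot\<^esub> p i = 0" if p: "prime p" and i: "i \<in> local_index p" for p i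
  proof -
    have "0 \<le> f \<one>\<^bsub>quot\<^esub> p i" "f \<one>\<^bsub>quot\<^esub> p i < int i"
      using fc[OF one_closed] p i carrier_local[OF p] unfolding carrier_local_product by auto
    then have "f \<one>\<^bsub>quot\<^esub> p i mod int i = f \<one>\<^bsub>quot\<^esub> p i" by simp
    then have "[f \<one>\<^bsub>quot\<^esub> p i = f \<one>\<^bsub>quot\<^esub> p i + f \<one>\<^bsub>quot\<^esub> p i] (mod int i)"
      using fm[OF one_closed one_closed p i] by (simp add: cong_def)
    then have "int i dvd f \<one>\<^bsub>quot\<^esub> p i" by (simp add: cong_iff_dvd_diff)
    then show ?thesis
      using \<open>f \<one>\<^bsub>quot\<^esub> p i mod int i = f \<one>\<^bsub>quot\<^esub> p i\<close> by (simp add: dvd_eq_mod_eq_0)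
  qed
  have fp: "f (Y [^]\<^bsub>quot\<^esub> n) p i = (int n * f Y p i) mod int i"
    if Y: "Y \<in> carrier quot" and p: "prime p" and i: "i \<in> local_index p" for Y n p i
  proof (induction n)
    case 0
    then show ?case using f1[OF p i] by simp
  next
    case (Suc n)
    have "f (Y [^]\<^bsub>quot\<^esub> Suc n) p i = (f (Y [^]\<^bsub>quot\<^esub> n) p i + f Y p i) mod int i"
      using fm[OF nat_pow_closed[OF Y] Y p i] by simp
    then show ?case using Suc by (simp add: mod_add_right_eq algebra_simps)
  qed
  show ?thesis
  proof (rule self_divisible_if_divisible_trivial)
    fix X assume X: "X \<in> carrier quot" and div: "\<And>n::nat. n > 0 \<Longrightarrow> \<exists>Y\<in>carrier quot. X = Y [^]\<^bsub>quot\<^esub> n"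
    have "f X = f \<one>\<^bsub>quot\<^esub>"
    proof (rule local_product_eqI[OF fc[OF X] fc[OF one_closed]])
      fix p i assume p: "prime p" and i: "i \<in> local_index p"
      \<comment> \<open>The exponent is the modulus \<open>i\<close>: an \<open>i\<close>-th power
        has coordinate \<open>0\<close> modulo \<open>i\<close>.\<close>
      obtain Y where Y: "Y \<in> carrier quot" "X = Y [^]\<^bsub>quot\<^esub> i"
        using div[OF local_index_Dset(3)[OF p i]] by blast
      then show "f X p i = f \<one>\<^bsub>quot\<^esub> p i" using fp[OF Y(1) p i, of i] f1[OF p i] by simp
    qed
    then show "X = \<one>\<^bsub>quot\<^esub>" using f(2) X one_closed unfolding bij_betw_def by (meson inj_onD)
  qed
qed

section \<open>The isomorphism with the product of the local factors\<close>

definition local_rems :: "int set set \<Rightarrow> nat \<Rightarrow> nat \<Rightarrow> int" where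
  "local_rems u = (\<lambda>p\<in>{p. prime p}. \<lambda>i\<in>local_index p. zrem u (int i))"

lemma local_rems_apply: "prime p \<Longrightarrow> i \<in> local_index p \<Longrightarrow> local_rems u p i = zrem u (int i)"
  by (simp add: local_rems_def)

lemma local_rems_carrier:
  assumes u: "u \<in> betaZ"
  shows "local_rems u \<in> carrier local_product"
proof -
  have "local_rems u p \<in> carrier (residue_limit (local_index p))" if p: "prime p" for p
    unfolding carrier_local[OF p]
  proof (intro CollectI conjI ballI impI)
    show "local_rems u p \<in> extensional (local_index p)" using p by (simp add: local_rems_def)
    fix n assume n: "n \<in> local_index p"
    have n0: "int n \<noteq> 0" using local_index_Dset(3)[OF p n] by simp
    show "0 \<le> local_rems u p n" "local_rems u p n < int n"
      using zrem[OF u n0] by (simp_all add: local_rems_apply[OF p n])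
    fix m assume m: "m \<in> local_index p" and mn: "n dvd m"
    have m0: "int m \<noteq> 0" using local_index_Dset(3)[OF p m] by simp
    have "[zrem u (int n) = zrem u (int m)] (mod int n)"
      using zrem_dvd[OF u _ m0, of "int n"] mn by (simp add: cong_sym_eq)
    then show "local_rems u p m mod int n = local_rems u p n"
      using zrem_eq_modI[OF u n0] by (simp add: local_rems_apply[OF p n] local_rems_apply[OF p m])
  qed
  moreover have "local_rems u \<in> extensional {p. prime p}" by (simp add: local_rems_def)
  ultimately show ?thesis unfolding carrier_local_product by blast
qed

lemma local_rems_mult:
  assumes u: "u \<in> betaZ" and v: "v \<in> betaZ"
  shows "local_rems (oplus u v) = local_rems u \<otimes>\<^bsub>local_product\<^esub> local_rems v"
proof (intro ext)
  fix p i
  show "local_rems (oplus u v) p i = (local_rems u \<otimes>\<^bsub>local_product\<^esub> local_rems v) p i"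
  proof (cases "prime p \<and> i \<in> local_index p")
    case True
    then have p: "prime p" and i: "i \<in> local_index p" by auto
    have "int i \<noteq> 0" using local_index_Dset(3)[OF p i] by simp
    then show ?thesis
      using mult_local_product[OF p i] zrem_oplus_eq[OF u v]
      by (simp add: local_rems_apply[OF p i])
  next
    case False
    then show ?thesis by (auto simp: local_rems_def local_factor_eq mult_residue_limit)
  qed
qed

text \<open>Finitely many prescribed coordinates are met by an integer, by the Chinese remainder
  theorem; compactness then meets all of them at once.\<close>

lemma local_rems_surj:
  assumes h: "h \<in> carrier local_product"
  shows "\<exists>u\<in>betaZ. local_rems u = h"
proof -
  have hp: "h p \<in> carrier (residue_limit (local_index p))" if "prime p" for p
    using h that unfolding carrier_local_product by blast
  have hb: "0 \<le> h p i" "h p i < int i" if "prime p" "i \<in> local_index p" for p i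
    using hp[OF that(1)] that unfolding carrier_local[OF that(1)] by auto
  have hd: "h p j mod int i = h p i" if "prime p" "i \<in> local_index p" "j \<in> local_index p" "i dvd j" for p i j
    using hp[OF that(1)] that unfolding carrier_local[OF that(1)] by auto
  let ?Q = "{(p, i). prime p \<and> i \<in> local_index p}"
  let ?C = "\<lambda>F. {y. \<forall>(p, i)\<in>F. [y = h p i] (mod int i)}"
  have "\<exists>u\<in>betaZ. \<forall>F\<in>{F. finite F \<and> F \<subseteq> ?Q}. ?C F \<in> u"
  proof (rule directed_ultrafilter)
    show "{F. finite F \<and> F \<subseteq> ?Q} \<noteq> {}" by blast
    fix F assume F: "F \<in> {F. finite F \<and> F \<subseteq> ?Q}"
    \<comment> \<open>For each prime the prescribed moduli form a divisibility chain, so by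
      coherence of \<open>h\<close> the largest one implies the others.\<close>
    define m where "m p = Max {i. (p, i) \<in> F}" for p
    have fin: "finite {i. (p, i) \<in> F}" for p
    proof (rule finite_subset)
      show "{i. (p, i) \<in> F} \<subseteq> snd ` F" by force
      show "finite (snd ` F)" using F by simp
    qed
    have m: "(p, m p) \<in> F \<and> i \<le> m p" if "(p, i) \<in> F" for p i
    proof -
      have "{i. (p, i) \<in> F} \<noteq> {}" using that by blast
      then show ?thesis
        using Max_in[OF fin[of p]] Max_ge[OF fin[of p], of i] that unfolding m_def by blast
    qed
    have FQ: "prime p" "i \<in> local_index p" if "(p, i) \<in> F" for p i using F that by auto
    have "\<exists>k. m p = p ^ k" if pF: "p \<in> fst ` F" for p
    proof -
      obtain i where "(p, i) \<in> F" using pF by force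
      then have "(p, m p) \<in> F" using m by blast
      then show ?thesis using local_index_Dset(2) FQ by blast
    qed
    then obtain k where k: "\<And>p. p \<in> fst ` F \<Longrightarrow> m p = p ^ k p" by metis
    obtain x where x: "\<forall>p\<in>fst ` F. [x = h p (m p)] (mod int (p ^ k p))"
    proof -
      have "\<exists>x::int. \<forall>p\<in>fst ` F. [x = h p (m p)] (mod int (p ^ k p))"
      proof (rule simultaneous_residues)
        show "finite (fst ` F)" using F by simp
        fix p assume "p \<in> fst ` F"
        then obtain i where pi: "(p, i) \<in> F" by force
        then have pm: "(p, m p) \<in> F" using m by blast
        show "prime p" using FQ[OF pi] by blast
        show "0 \<le> h p (m p)" using hb FQ[OF pm] by blast
      qed
      then show ?thesis using that by blast
    qed
    have "[x = h p i] (mod int i)" if pi: "(p, i) \<in> F" for p i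
    proof -
      have pm: "(p, m p) \<in> F" "i \<le> m p" using m[OF pi] by auto
      have pF: "p \<in> fst ` F" using pi by force
      have "i dvd m p" using local_index_chain FQ[OF pi] FQ[OF pm(1)] pm(2) by blast
      then have "int i dvd int (m p)" by simp
      moreover have "[x = h p (m p)] (mod int (m p))" using bspec[OF x pF] unfolding k[OF pF] .
      ultimately have "[x = h p (m p)] (mod int i)" using cong_dvd_modulus by blast
      moreover have "[h p (m p) = h p i] (mod int i)"
        using hd[OF FQ(1)[OF pi] FQ(2)[OF pi] FQ(2)[OF pm(1)] \<open>i dvd m p\<close>] hb[OF FQ[OF pi]]
        by (simp add: cong_def)
      ultimately show ?thesis by (rule cong_trans)
    qed
    then show "?C F \<noteq> {}" by blast
    fix F' assume F': "F' \<in> {F. finite F \<and> F \<subseteq> ?Q}"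
    show "\<exists>K\<in>{F. finite F \<and> F \<subseteq> ?Q}. ?C K \<subseteq> ?C F \<inter> ?C F'"
      by (rule bexI[of _ "F \<union> F'"]) (use F F' in auto)
  qed
  then obtain u where u: "u \<in> betaZ" and uC: "\<forall>F\<in>{F. finite F \<and> F \<subseteq> ?Q}. ?C F \<in> u" by blast
  have "local_rems u = h"
  proof (rule local_product_eqI[OF local_rems_carrier[OF u] h])
    fix p i assume p: "prime p" and i: "i \<in> local_index p"
    have i0: "int i \<noteq> 0" using local_index_Dset(3)[OF p i] by simp
    have "?C {(p, i)} \<in> u" by (rule bspec[OF uC]) (use p i in simp)
    then have "[zrem u (int i) = h p i] (mod int i)" using mem_cong_iff[OF u i0] by simp
    then have "zrem u (int i) = h p i mod \<bar>int i\<bar>" by (rule zrem_eq_modI[OF u i0])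
    then show "local_rems u p i = h p i"
      using hb[OF p i] by (simp add: local_rems_apply[OF p i])
  qed
  then show ?thesis using u by blast
qed

lemma local_rems_eq_iff:
  assumes sd: "self_divisible w" and u: "u \<in> betaZ" and v: "v \<in> betaZ"
  shows "local_rems u = local_rems v \<longleftrightarrow> cls u = cls v"
proof -
  have "local_rems u = local_rems v \<longleftrightarrow>
      (\<forall>p. prime p \<longrightarrow> (\<forall>i\<in>local_index p. zrem u (int i) = zrem v (int i)))"
    unfolding local_rems_def by (auto simp: fun_eq_iff restrict_def)
  then show ?thesis by (simp add: cls_eq_iff[OF u v] scong_iff_local[OF sd u v])
qed

lemma self_divisible_imp_iso:
  assumes sd: "self_divisible w"
  shows "quot \<cong> local_product"
proof -
  define f where "f X = local_rems (SOME u. u \<in> X)" for X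
  have f: "f (cls u) = local_rems u" if u: "u \<in> betaZ" for u
  proof -
    have "(SOME v. v \<in> cls u) \<in> cls u" by (rule someI, rule self_mem_cls[OF u])
    then have v: "(SOME v. v \<in> cls u) \<in> betaZ" "scong star w u (SOME v. v \<in> cls u)" by (auto simp: mem_cls)
    then show ?thesis
      using local_rems_eq_iff[OF sd u v(1)] cls_eq_iff[OF u v(1)] by (simp add: f_def)
  qed
  have "f \<in> hom quot local_product"
  proof (rule homI)
    fix X Y assume "X \<in> carrier quot" "Y \<in> carrier quot"
    then obtain u v where u: "u \<in> betaZ" "X = cls u" and v: "v \<in> betaZ" "Y = cls v"
      by (auto simp: carrier_quot)
    show "f X \<in> carrier local_product" using f[OF u(1)] local_rems_carrier[OF u(1)] u(2) by simp
    show "f (X \<otimes>\<^bsub>quot\<^esub> Y) = f X \<otimes>\<^bsub>local_product\<^esub> f Y"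
      unfolding u(2) v(2) mult_quot[OF u(1) v(1)] f[OF oplus_betaZ[OF u(1) v(1)]] f[OF u(1)] f[OF v(1)]
      by (rule local_rems_mult[OF u(1) v(1)])
  qed
  moreover have "bij_betw f (carrier quot) (carrier local_product)"
    unfolding bij_betw_def
  proof
    show "inj_on f (carrier quot)"
    proof (rule inj_onI)
      fix X Y assume "X \<in> carrier quot" "Y \<in> carrier quot" and eq: "f X = f Y"
      then obtain u v where u: "u \<in> betaZ" "X = cls u" and v: "v \<in> betaZ" "Y = cls v"
        by (auto simp: carrier_quot)
      then show "X = Y" using eq f local_rems_eq_iff[OF sd u(1) v(1)] by simp
    qed
    show "f ` carrier quot = carrier local_product"
    proof (intro equalityI subsetI)
      fix h assume "h \<in> f ` carrier quot"
      then obtain u where u: "u \<in> betaZ" "h = f (cls u)" unfolding carrier_quot by blast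
      then show "h \<in> carrier local_product" using f[OF u(1)] local_rems_carrier[OF u(1)] by (simp only:)
    next
      fix h assume "h \<in> carrier local_product"
      then obtain u where u: "u \<in> betaZ" "local_rems u = h" using local_rems_surj by blast
      then have "h = f (cls u)" "cls u \<in> carrier quot" using f by (simp_all add: carrier_quot)
      then show "h \<in> f ` carrier quot" by blast
    qed
  qed
  ultimately show ?thesis unfolding is_iso_def iso_def by blast
qed

end

theorem theorem6p7:
  fixes emb :: "int \<Rightarrow> 'z"
    and star :: "int list set \<Rightarrow> 'z list set"
    and w :: "int set set"
  assumes "elementary_extension emb star"
    and "continuum_plus_saturated star"
    and "w \<in> betaZ" and "w \<noteq> principal_uf 0"
  shows "all_equivalent
    [ \<comment> \<open>1\<close> self_divisible w,
      \<comment> \<open>2\<close> \<forall>B \<in> w. \<exists>A \<in> w. \<forall>a \<in> A. \<forall>a' \<in> A. \<exists>b \<in> B. b dvd gcd a a',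
      \<comment> \<open>3\<close> \<forall>B \<in> w. \<exists>A \<in> w. \<exists>b \<in> B. A \<subseteq> multiples b,
      \<comment> \<open>4\<close> \<forall>B \<in> w. \<exists>b \<in> B. multiples b \<in> w,
      \<comment> \<open>5\<close> \<forall>B \<in> w. {b \<in> B. multiples b \<in> w} \<in> w,
      \<comment> \<open>6\<close> \<forall>k::int. k \<noteq> 0 \<longrightarrow> self_divisible (scale_uf k w),
      \<comment> \<open>7\<close> \<exists>n m::nat. 0 < n \<and> 0 < m \<and> n \<noteq> m \<and> scong star w (oplus_pow w n) (oplus_pow w m),
      \<comment> \<open>8\<close> \<forall>v \<in> betaZ - {principal_uf 0}.
        wcong star v w (principal_uf 0) \<longrightarrow> scong star v w (principal_uf 0),
      \<comment> \<open>9\<close> \<forall>a. realizes star [a] (tensor [w]) \<longrightarrow> {b. star_dvd star b a} \<subseteq> star_set star (Dset w),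
      \<comment> \<open>10\<close> closed_under_oplus (Zset star w) \<and>
        (\<forall>u \<in> betaZ. \<forall>t \<in> betaZ. \<forall>v \<in> MAX_uf star.
          oplus (oplus u v) t \<in> Zset star w \<longrightarrow> oplus u t \<in> Zset star w),
      \<comment> \<open>11\<close> closed_under_oplus (Zset star w) \<and>
        Zset star w = {u \<in> betaZ. pi_uf u \<in> pi_uf ` Zset star w},
      \<comment> \<open>12\<close> closed_under_oplus (Zset star w) \<and>
        (\<forall>u \<in> betaZ. \<forall>u' \<in> betaZ.
          (\<forall>n \<ge> 1. remainder_uf u n = remainder_uf u' n) \<longrightarrow> (tdvd star w u \<longleftrightarrow> tdvd star w u')),
      \<comment> \<open>13\<close> closedin Zhat_topology (kernel Zhat (scong_quotient star w) (sigma_uf star w)),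
      \<comment> \<open>14\<close> procyclic_group (scong_quotient star w) (scong_quotient_topology star w),
      \<comment> \<open>15\<close> \<exists>T. profinite_group (scong_quotient star w) T,
      \<comment> \<open>16\<close> scong_quotient star w \<cong> product_group {p. prime p} (local_factor w)
    ]"
proof -
  interpret nonzero_ultrafilter emb star w
    by unfold_locales (rule assms)+
  let ?sd = "self_divisible w" and ?cl = "closed_under_oplus (Zset star w)"
  have 12: "?sd \<longleftrightarrow> ?cl \<and> tdvd_by_remainders"
    using Zset_closed_under_oplus tdvd_by_remainders_if_self_divisible self_divisible_if_tdvd_by_remainders by blast
  have 11: "?sd \<longleftrightarrow> ?cl \<and> Zset star w = {u \<in> betaZ. pi_uf u \<in> pi_uf ` Zset star w}"
    unfolding Zset_eq_preimage_iff by (rule 12)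
  have 10: "?sd \<longleftrightarrow> ?cl \<and> MAX_cancellable"
    using 12 MAX_cancellable_if_tdvd_by_remainders tdvd_by_remainders_if_MAX_cancellable by blast
  have 13: "?sd \<longleftrightarrow> closedin Zhat_topology (kernel Zhat quot (sigma_uf star w))"
    using kernel_closed_if_self_divisible self_divisible_if_kernel_closed by blast
  have 15: "?sd \<longleftrightarrow> (\<exists>T. profinite_group quot T)"
    using procyclic_if_self_divisible self_divisible_if_profinite unfolding procyclic_group_def by blast
  have 14: "?sd \<longleftrightarrow> procyclic_group quot qtop"
    using procyclic_if_self_divisible 15 unfolding procyclic_group_def by blast
  have 16: "?sd \<longleftrightarrow> quot \<cong> local_product"
    using self_divisible_imp_iso iso_imp_self_divisible by blast
  \<comment> \<open>Rewriting each condition back to \<open>self_divisible w\<close> turns the list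
    into copies of one proposition.\<close>
  show ?thesis
    unfolding self_divisible_iff_common_divisor[OF w w0, symmetric] self_divisible_iff_subset_multiples[OF w w0, symmetric] self_divisible_iff_ex_multiples[OF w w0, symmetric]
      self_divisible_iff_Collect_multiples[OF w w0, symmetric] self_divisible_iff_scale[OF w w0, symmetric] self_divisible_iff_oplus_pow[symmetric] self_divisible_iff_wcong[symmetric]
      self_divisible_iff_star_divisors[symmetric] 10[symmetric] 11[symmetric] 12[symmetric] 13[symmetric] 14[symmetric]
      15[symmetric] 16[symmetric]
    by (simp add: all_equivalent_def)
qed

end
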